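(* Let $(V_j)_{j\in\mathbb{Z}}$ be a GMRA of $L^2(\mathbb{R}^n)$ (with respect to the dilation matrix $A$), let $\Phi$ be a NTF generator for $V_0$, and let $\Psi$ be a countable subset of $L^2(\mathbb{R}^n)$. Then $\Psi$ is a NTF generator for $W_0:=V_1\ominus V_0$ if and only if the following two equations hold for a.e. $\xi\in\mathbb{R}^n$: $$-\sum_{\varphi\in\Phi}\widehat{\varphi}(\xi)\overline{\widehat{\varphi}(\xi+2s\pi)}=\sum_{\psi\in\Psi}\widehat{\psi}(\xi)\overline{\widehat{\psi}(\xi+2s\pi)},\qquad (s\in\mathbb{Z}^n\setminus A^*\mathbb{Z}^n);$$ $$\sum_{\varphi\in\Phi}\widehat{\varphi}((A^* )^{-1}\xi)\overline{\widehat{\varphi}((A^* )^{-1}(\xi+2s\pi))}-\sum_{\varphi\in\Phi}\widehat{\varphi}(\xi)\overline{\widehat{\varphi}(\xi+2s\pi)}=\sum_{\psi\in\Psi}\widehat{\psi}(\xi)\overline{\widehat{\psi}(\xi+2s\pi)},\qquad (s\in A^*\mathbb{Z}^n).$$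
   Context: $A$ is a fixed $n\times n$ matrix, all of whose eigenvalues $\lambda$ satisfy $|\lambda|>1$, with $A\mathbb{Z}^n\subset\mathbb{Z}^n$; $A^*$ is its adjoint (transpose). On $L^2(\mathbb{R}^n)$ put $T_kf(\xi)=f(\xi-k)$ for $k\in\mathbb{Z}^n$ and $D_Af(\xi)=|\det A|^{1/2}f(A\xi)$. The Fourier transform is $\widehat f(\xi)=\int_{\mathbb{R}^n}f(x)e^{-i\langle x\,|\,\xi\rangle}\,dx$ (extended to $L^2(\mathbb{R}^n)$). A family $\{e_i\}_{i\in I}$ in a Hilbert space $H$ is a normalized tight frame (NTF) for $H$ if its members lie in $H$ and $\sum_{i\in I}|\langle f\,|\,e_i\rangle|^2=\|f\|^2$ for all $f\in H$. A closed subspace $V\subset L^2(\mathbb{R}^n)$ is shift invariant (SI) if $T_kV=V$ for all $k\in\mathbb{Z}^n$. A subset $\Phi\subset V$ is a NTF generator for the SI space $V$ if $\{T_k\varphi\,|\,k\in\mathbb{Z}^n,\varphi\in\Phi\}$ is a NTF for $V$. A generalized multiresolution analysis (GMRA) is a sequence $(V_j)_{j\in\mathbb{Z}}$ of closed subspaces of $L^2(\mathbb{R}^n)$ such that: $V_j\subset V_{j+1}$ for all $j$; $f\in V_j$ iff $D_Af\in V_{j+1}$ for all $j$; $\overline{\bigcup_{j}V_j}=L^2(\mathbb{R}^n)$; $\bigcap_jV_j=\{0\}$; and $T_kV_0=V_0$ for all $k\in\mathbb{Z}^n$. $V_1\ominus V_0$ denotes the orthogonal complement of $V_0$ in $V_1$.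 *)

theory Defs
  imports "HOL-Analysis.Analysis"
begin

section \<open>The Hilbert space of square-integrable functions modulo null sets\<close>

definition square_integrable :: "('a::euclidean_space \<Rightarrow> complex) \<Rightarrow> bool" where
  "square_integrable f \<longleftrightarrow>
     f \<in> borel_measurable lborel \<and> integrable lborel (\<lambda>x. (cmod (f x))\<^sup>2)"

lemma square_integrable_measurable:
  "square_integrable f \<Longrightarrow> f \<in> borel_measurable lborel"
  by (simp add: square_integrable_def)

lemma square_integrable_zero: "square_integrable (\<lambda>x. 0)"
  by (simp add: square_integrable_def)

lemma square_integrable_scale:
  assumes "square_integrable f"
  shows "square_integrable (\<lambda>x. c * f x)"
  using assms by (auto simp: square_integrable_def norm_mult power_mult_distrib)

lemma square_integrable_add:
  assumes "square_integrable f" "square_integrable g"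
  shows "square_integrable (\<lambda>x. f x + g x)"
proof -
  have [measurable]: "f \<in> borel_measurable lborel" "g \<in> borel_measurable lborel"
    using assms by (auto simp: square_integrable_def)
  have le: "(cmod (a + b))\<^sup>2 \<le> 2 * (cmod a)\<^sup>2 + 2 * (cmod b)\<^sup>2" for a b
  proof -
    have "(cmod (a + b))\<^sup>2 \<le> (cmod a + cmod b)\<^sup>2"
      by (intro power_mono norm_triangle_ineq) simp
    also have "\<dots> \<le> 2 * (cmod a)\<^sup>2 + 2 * (cmod b)\<^sup>2"
      using zero_le_power2[of "cmod a - cmod b"] by (simp add: power2_eq_square algebra_simps)
    finally show ?thesis .
  qed
  have "integrable lborel (\<lambda>x. (cmod (f x + g x))\<^sup>2)"
  proof (rule Bochner_Integration.integrable_bound)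
    show "integrable lborel (\<lambda>x. 2 * (cmod (f x))\<^sup>2 + 2 * (cmod (g x))\<^sup>2)"
      using assms by (auto simp: square_integrable_def)
  qed (use le in auto)
  then show ?thesis by (simp add: square_integrable_def)
qed

lemma square_integrable_mult_integrable:
  assumes "square_integrable f" "square_integrable g"
  shows "integrable lborel (\<lambda>x. f x * cnj (g x))"
proof -
  have [measurable]: "f \<in> borel_measurable lborel" "g \<in> borel_measurable lborel"
    using assms by (auto simp: square_integrable_def)
  have cnj_meas [measurable]: "cnj \<in> borel_measurable borel"
    by (intro borel_measurable_continuous_onI continuous_intros)
  have le: "cmod a * cmod b \<le> (cmod a)\<^sup>2 + (cmod b)\<^sup>2" for a b
  proof -
    have "2 * (cmod a * cmod b) \<le> (cmod a)\<^sup>2 + (cmod b)\<^sup>2"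
      using zero_le_power2[of "cmod a - cmod b"] by (simp add: power2_eq_square algebra_simps)
    moreover have "0 \<le> cmod a * cmod b" by simp
    ultimately show ?thesis by linarith
  qed
  show ?thesis
  proof (rule Bochner_Integration.integrable_bound)
    show "integrable lborel (\<lambda>x. (cmod (f x))\<^sup>2 + (cmod (g x))\<^sup>2)"
      using assms by (auto simp: square_integrable_def)
  qed (use le in \<open>auto simp: norm_mult\<close>)
qed

lemma square_integrable_translate:
  assumes "square_integrable f"
  shows "square_integrable (\<lambda>x. f (x - k))"
proof -
  have [measurable]: "f \<in> borel_measurable lborel"
    using assms by (auto simp: square_integrable_def)
  have "integrable (distr lborel borel ((+) (-k))) (\<lambda>x. (cmod (f x))\<^sup>2)"
    using assms unfolding lborel_distr_plus by (simp add: square_integrable_def)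
  then have "integrable lborel (\<lambda>x. (cmod (f (-k + x)))\<^sup>2)"
    by (subst (asm) integrable_distr_eq) auto
  then show ?thesis
    by (auto simp: square_integrable_def)
qed

definition l2_eq :: "('a::euclidean_space \<Rightarrow> complex) \<Rightarrow> ('a \<Rightarrow> complex) \<Rightarrow> bool" where
  "l2_eq f g \<longleftrightarrow>
     square_integrable f \<and> square_integrable g \<and> (AE x in lborel. f x = g x)"

lemma part_equivp_l2_eq: "part_equivp l2_eq"
proof (rule part_equivpI)
  show "\<exists>f. l2_eq f f"
    by (rule exI[of _ "\<lambda>_. 0"]) (simp add: l2_eq_def square_integrable_zero)
  show "symp l2_eq" by (auto simp: symp_def l2_eq_def)
  show "transp l2_eq" by (auto simp: transp_def l2_eq_def)
qed

text \<open>
  Borel representatives suffice, since every Lebesgue measurable function agrees almost everywhere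
  with a Borel one. \<open>rep_l2 f\<close> is an arbitrarily chosen representative, so a statement about its
  values is meaningful only up to null sets.
\<close>

quotient_type (overloaded) 'a l2 = "'a::euclidean_space \<Rightarrow> complex" / partial: l2_eq
  morphisms rep_l2 abs_l2
  by (rule part_equivp_l2_eq)

lift_definition cinner :: "'a::euclidean_space l2 \<Rightarrow> 'a l2 \<Rightarrow> complex"
  is "\<lambda>f g. LINT x|lborel. f x * cnj (g x)"
proof -
  fix f f' g g' :: "'a \<Rightarrow> complex"
  assume f: "l2_eq f f'" and g: "l2_eq g g'"
  have "AE x in lborel. f x * cnj (g x) = f' x * cnj (g' x)"
    using f g by (auto simp: l2_eq_def)
  then show "(LINT x|lborel. f x * cnj (g x)) = (LINT x|lborel. f' x * cnj (g' x))"
    using f g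
    by (intro integral_cong_AE borel_measurable_integrable square_integrable_mult_integrable)
       (auto simp: l2_eq_def)
qed

lift_definition scale_l2 :: "complex \<Rightarrow> 'a::euclidean_space l2 \<Rightarrow> 'a l2"
  is "\<lambda>c f x. c * f x"
  by (auto simp: l2_eq_def square_integrable_scale)

instantiation l2 :: (euclidean_space) real_inner
begin

lift_definition zero_l2 :: "'a l2" is "\<lambda>x. 0"
  by (simp add: l2_eq_def square_integrable_zero)

lift_definition plus_l2 :: "'a l2 \<Rightarrow> 'a l2 \<Rightarrow> 'a l2" is "\<lambda>f g x. f x + g x"
  by (auto simp: l2_eq_def square_integrable_add)

definition uminus_l2 :: "'a l2 \<Rightarrow> 'a l2" where "- f = scale_l2 (- 1) f"

definition minus_l2 :: "'a l2 \<Rightarrow> 'a l2 \<Rightarrow> 'a l2" where "f - g = f + (- g)" for f g :: "'a l2"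

definition scaleR_l2 :: "real \<Rightarrow> 'a l2 \<Rightarrow> 'a l2" where "r *\<^sub>R f = scale_l2 (complex_of_real r) f"

definition inner_l2 :: "'a l2 \<Rightarrow> 'a l2 \<Rightarrow> real" where "f \<bullet> g = Re (cinner f g)"

definition norm_l2 :: "'a l2 \<Rightarrow> real" where "norm f = sqrt (f \<bullet> f)" for f :: "'a l2"

definition sgn_l2 :: "'a l2 \<Rightarrow> 'a l2" where "sgn f = scaleR (inverse (norm f)) f" for f :: "'a l2"

definition dist_l2 :: "'a l2 \<Rightarrow> 'a l2 \<Rightarrow> real" where "dist f g = norm (f - g)" for f g :: "'a l2"

definition uniformity_l2 :: "('a l2 \<times> 'a l2) filter" where
  "uniformity_l2 = (INF e\<in>{0<..}. principal {(f, g). dist f g < e})"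

definition open_l2 :: "'a l2 set \<Rightarrow> bool" where
  "open_l2 U = (\<forall>f\<in>U. \<forall>\<^sub>F (f', g) in uniformity. f' = f \<longrightarrow> g \<in> U)"

instance
proof
  fix f g h :: "'a l2" and r s :: real
  show "f + g + h = f + (g + h)"
    by transfer (auto simp: l2_eq_def algebra_simps intro!: square_integrable_add)
  show "f + g = g + f"
    by transfer (auto simp: l2_eq_def algebra_simps intro!: square_integrable_add)
  show "0 + f = f"
    by transfer (auto simp: l2_eq_def)
  show "- f + f = 0"
    unfolding uminus_l2_def
    by transfer (auto simp: l2_eq_def square_integrable_zero)
  show "f - g = f + (- g)" by (rule minus_l2_def)
  show "r *\<^sub>R (f + g) = r *\<^sub>R f + r *\<^sub>R g"
    unfolding scaleR_l2_def
    by transfer (auto simp: l2_eq_def distrib_left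
        intro!: square_integrable_add square_integrable_scale)
  show "(r + s) *\<^sub>R f = r *\<^sub>R f + s *\<^sub>R f"
    unfolding scaleR_l2_def
    by transfer (auto simp: l2_eq_def distrib_right
        intro!: square_integrable_add square_integrable_scale)
  show "r *\<^sub>R s *\<^sub>R f = (r * s) *\<^sub>R f"
    unfolding scaleR_l2_def
    by transfer (auto simp: l2_eq_def mult.assoc intro!: square_integrable_scale)
  show "1 *\<^sub>R f = f"
    unfolding scaleR_l2_def by transfer (auto simp: l2_eq_def)
  show "dist f g = norm (f - g)" by (rule dist_l2_def)
  show "sgn f = scaleR (inverse (norm f)) f" by (rule sgn_l2_def)
  show "(uniformity :: ('a l2 \<times> 'a l2) filter) = (INF e\<in>{0<..}. principal {(x, y). dist x y < e})"
    by (rule uniformity_l2_def)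
  show "open U = (\<forall>x\<in>U. \<forall>\<^sub>F (x', y) in uniformity. x' = x \<longrightarrow> y \<in> U)" for U :: "'a l2 set"
    by (rule open_l2_def)
  have "cinner f g = cnj (cinner g f)"
    by transfer (subst Bochner_Integration.integral_cnj[symmetric], simp add: mult.commute)
  then show "f \<bullet> g = g \<bullet> f" by (simp add: inner_l2_def)
  have "cinner (f + g) h = cinner f h + cinner g h"
  proof (transfer, goal_cases)
    case (1 f g h)
    then show ?case
      by (subst Bochner_Integration.integral_add[symmetric])
         (auto simp: l2_eq_def distrib_right intro!: square_integrable_mult_integrable)
  qed
  then show "(f + g) \<bullet> h = f \<bullet> h + g \<bullet> h" by (simp add: inner_l2_def)
  have "cinner (scale_l2 c f) g = c * cinner f g" for c
    by transfer (simp add: mult.assoc)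
  then show "(r *\<^sub>R f) \<bullet> g = r * (f \<bullet> g)" by (simp add: inner_l2_def scaleR_l2_def)
  have self: "f \<bullet> f = (LINT x|lborel. (cmod (rep_l2 f x))\<^sup>2)" for f :: "'a l2"
  proof -
    have "cinner f f = (LINT x|lborel. rep_l2 f x * cnj (rep_l2 f x))"
      unfolding cinner.rep_eq by simp
    also have "\<dots> = (LINT x|lborel. complex_of_real ((cmod (rep_l2 f x))\<^sup>2))"
      by (simp only: complex_norm_square)
    also have "\<dots> = complex_of_real (LINT x|lborel. (cmod (rep_l2 f x))\<^sup>2)"
      by (rule integral_complex_of_real)
    finally show ?thesis
      unfolding inner_l2_def by simp
  qed
  show "0 \<le> f \<bullet> f" by (simp add: self)
  have sq: "square_integrable (rep_l2 f)"
    using Quotient_rep_reflp[OF Quotient_l2, of f] by (simp add: l2_eq_def)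
  show "f \<bullet> f = 0 \<longleftrightarrow> f = 0"
  proof -
    have "f \<bullet> f = 0 \<longleftrightarrow> (AE x in lborel. (cmod (rep_l2 f x))\<^sup>2 = 0)"
      unfolding self using sq
      by (intro integral_nonneg_eq_0_iff_AE) (auto simp: square_integrable_def)
    also have "\<dots> \<longleftrightarrow> l2_eq (rep_l2 f) (\<lambda>x. 0)"
      using sq by (simp add: l2_eq_def square_integrable_zero)
    also have "\<dots> \<longleftrightarrow> f = 0"
      using Quotient_rel[OF Quotient_l2, of "rep_l2 f" "\<lambda>x. 0"] sq square_integrable_zero
      by (auto simp: l2_eq_def zero_l2_def Quotient_abs_rep[OF Quotient_l2])
    finally show ?thesis .
  qed
  show "norm f = sqrt (f \<bullet> f)" by (rule norm_l2_def)
qed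

end

global_interpretation l2: vector_space "scale_l2 :: complex \<Rightarrow> 'a::euclidean_space l2 \<Rightarrow> 'a l2"
proof
  fix a b :: complex and f g :: "'a l2"
  show "scale_l2 a (f + g) = scale_l2 a f + scale_l2 a g"
    by transfer (auto simp: l2_eq_def distrib_left
        intro!: square_integrable_add square_integrable_scale)
  show "scale_l2 (a + b) f = scale_l2 a f + scale_l2 b f"
    by transfer (auto simp: l2_eq_def distrib_right
        intro!: square_integrable_add square_integrable_scale)
  show "scale_l2 a (scale_l2 b f) = scale_l2 (a * b) f"
    by transfer (auto simp: l2_eq_def mult.assoc intro!: square_integrable_scale)
  show "scale_l2 1 f = f"
    by transfer (auto simp: l2_eq_def)
qed

definition orth_diff :: "'a::euclidean_space l2 set \<Rightarrow> 'a l2 set \<Rightarrow> 'a l2 set" where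
  "orth_diff V U = {f \<in> V. \<forall>g\<in>U. cinner f g = 0}"

section \<open>Translation, dilation and the Fourier transform\<close>

lift_definition translate :: "'a::euclidean_space \<Rightarrow> 'a l2 \<Rightarrow> 'a l2"
  is "\<lambda>k f x. f (x - k)"
proof -
  fix k :: 'a and f g :: "'a \<Rightarrow> complex"
  assume fg: "l2_eq f g"
  then have [measurable]: "f \<in> borel_measurable lborel" "g \<in> borel_measurable lborel"
    by (auto simp: l2_eq_def square_integrable_def)
  have "AE x in distr lborel borel ((+) (-k)). f x = g x"
    using fg unfolding lborel_distr_plus by (simp add: l2_eq_def)
  then have "AE x in lborel. f (-k + x) = g (-k + x)"
    by (subst (asm) AE_distr_iff) auto
  then show "l2_eq (\<lambda>x. f (x - k)) (\<lambda>x. g (x - k))"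
    using fg by (simp add: l2_eq_def square_integrable_translate)
qed

text \<open>
  The function below is square integrable, and its class is independent of the chosen
  representative, because \<open>A\<close> is either invertible or has determinant 0.
\<close>

definition dilate :: "real^'n^'n \<Rightarrow> (real^'n) l2 \<Rightarrow> (real^'n) l2" where
  "dilate A f = abs_l2 (\<lambda>x. complex_of_real (sqrt \<bar>det A\<bar>) * rep_l2 f (A *v x))"

definition fourier_integral :: "('a::euclidean_space \<Rightarrow> complex) \<Rightarrow> 'a \<Rightarrow> complex" where
  "fourier_integral f \<xi> = (LINT x|lborel. f x * exp (- (\<i> * complex_of_real (x \<bullet> \<xi>))))"

text \<open>
  The Fourier transform is the unique continuous operator on square-integrable classes given by the
  Fourier integral on those that are also integrable. No factor of \<open>2 * pi\<close> is included, so by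
  Plancherel it is unitary only up to the scalar \<open>sqrt (2 * pi) ^ DIM('a)\<close>.
\<close>

definition fourier :: "'a::euclidean_space l2 \<Rightarrow> 'a l2" where
  "fourier = (THE F. continuous_on UNIV F \<and>
     (\<forall>f. integrable lborel (rep_l2 f) \<longrightarrow>
        (AE \<xi> in lborel. rep_l2 (F f) \<xi> = fourier_integral (rep_l2 f) \<xi>)))"

text \<open>
  For a countable \<open>\<Phi>\<close> the following two notions do not depend, for almost every \<open>\<xi>\<close>, on the chosen
  representatives of the transforms, even for all \<open>\<eta>\<close> in a countable family of affine images of
  \<open>\<xi>\<close> under invertible maps. As an infinite sum that does not converge is 0 by convention,
  convergence has to be stated separately.
\<close>

definition fourier_summable :: "'a::euclidean_space l2 set \<Rightarrow> 'a \<Rightarrow> 'a \<Rightarrow> bool" where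
  "fourier_summable \<Phi> \<xi> \<eta> \<longleftrightarrow>
     (\<lambda>\<phi>. rep_l2 (fourier \<phi>) \<xi> * cnj (rep_l2 (fourier \<phi>) \<eta>)) summable_on \<Phi>"

definition fourier_sum :: "'a::euclidean_space l2 set \<Rightarrow> 'a \<Rightarrow> 'a \<Rightarrow> complex" where
  "fourier_sum \<Phi> \<xi> \<eta> =
     (\<Sum>\<^sub>\<infinity>\<phi>\<in>\<Phi>. rep_l2 (fourier \<phi>) \<xi> * cnj (rep_l2 (fourier \<phi>) \<eta>))"

section \<open>Shift-invariant spaces, normalized tight frames and GMRAs\<close>

definition int_lattice :: "(real^'n) set" where
  "int_lattice = {k. \<forall>i. k $ i \<in> \<int>}"

definition eigenvalue :: "complex^'n^'n \<Rightarrow> complex \<Rightarrow> bool" where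
  "eigenvalue M l \<longleftrightarrow> (\<exists>v. v \<noteq> 0 \<and> M *v v = l *s v)"

definition dilation_matrix :: "real^'n^'n \<Rightarrow> bool" where
  "dilation_matrix A \<longleftrightarrow>
     (\<forall>l. eigenvalue (map_matrix complex_of_real A) l \<longrightarrow> cmod l > 1) \<and>
     (*v) A ` int_lattice \<subseteq> int_lattice"

definition closed_subspace :: "'a::euclidean_space l2 set \<Rightarrow> bool" where
  "closed_subspace V \<longleftrightarrow> l2.subspace V \<and> closed V"

definition ntf :: "'i set \<Rightarrow> ('i \<Rightarrow> 'a::euclidean_space l2) \<Rightarrow> 'a l2 set \<Rightarrow> bool" where
  "ntf I e H \<longleftrightarrow>
     (\<forall>i\<in>I. e i \<in> H) \<and>
     (\<forall>f\<in>H. ((\<lambda>i. (cmod (cinner f (e i)))\<^sup>2) has_sum (norm f)\<^sup>2) I)"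

definition shift_invariant :: "(real^'n) l2 set \<Rightarrow> bool" where
  "shift_invariant V \<longleftrightarrow>
     closed_subspace V \<and> (\<forall>k\<in>int_lattice. translate k ` V = V)"

text \<open>
  The translates form a family indexed by pairs \<open>(k, \<phi>)\<close>: a function that is a translate of two
  different generators is counted twice.
\<close>

definition ntf_generator :: "(real^'n) l2 set \<Rightarrow> (real^'n) l2 set \<Rightarrow> bool" where
  "ntf_generator \<Phi> V \<longleftrightarrow>
     shift_invariant V \<and> \<Phi> \<subseteq> V \<and>
     ntf (int_lattice \<times> \<Phi>) (\<lambda>(k, \<phi>). translate k \<phi>) V"

definition gmra :: "real^'n^'n \<Rightarrow> (int \<Rightarrow> (real^'n) l2 set) \<Rightarrow> bool" where
  "gmra A V \<longleftrightarrow>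
     (\<forall>j. closed_subspace (V j)) \<and>
     (\<forall>j. V j \<subseteq> V (j + 1)) \<and>
     (\<forall>j f. f \<in> V j \<longleftrightarrow> dilate A f \<in> V (j + 1)) \<and>
     closure (\<Union>j. V j) = UNIV \<and>
     (\<Inter>j. V j) = {0} \<and>
     (\<forall>k\<in>int_lattice. translate k ` V 0 = V 0)"

end

theory Submission
  imports Defs
begin

text \<open>
  For a set \<open>\<Theta>\<close> of functions let \<open>Q \<Theta> f\<close> be the sum of \<open>\<bar>\<langle>f, T k \<theta>\<rangle>\<bar>\<^sup>2\<close> over the integer vectors \<open>k\<close> and
  over \<open>\<theta> \<in> \<Theta>\<close> (\<open>frame_sum\<close>). The set \<open>\<Theta>\<close> is a normalized tight frame generator of a shift-invariant
  space \<open>W\<close> exactly if \<open>Q \<Theta> f = \<parallel>P f\<parallel>\<^sup>2\<close> for every square-integrable \<open>f\<close>, where \<open>P\<close> projects onto \<open>W\<close>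
  (\<open>frame_sum_proj\<close>, \<open>ntf_generatorI\<close>): the identity for \<open>f\<close> orthogonal to \<open>W\<close> forces the generators
  into \<open>W\<close>. Since \<open>V 1\<close> is the orthogonal sum of \<open>V 0\<close> and \<open>W\<close>, the property of \<open>\<Psi>\<close> in question says
  that \<open>Q \<Psi> f + Q \<Phi> f\<close> is the squared norm of the projection of \<open>f\<close> onto \<open>V 1\<close>. As \<open>V 1\<close> is the
  dilate of \<open>V 0\<close>, this squared norm is a constant multiple of \<open>Q \<Phi>\<close> at \<open>f\<close> composed with the inverse
  of \<open>A\<close>. So the claim is an identity between quadratic forms.

  The forms are computed on the Fourier side. The numbers \<open>\<langle>f, T k \<theta>\<rangle>\<close> are the Fourier coefficients of
  a \<open>2\<pi>\<close>-periodisation, and Parseval's identity on the torus turns \<open>Q \<Theta> f\<close> into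
  \<open>(2\<pi>)\<^sup>-\<^sup>n \<integral> \<Sum>\<^sub>t cnj (u \<xi>) * u (\<xi> + 2\<pi>t) * K (\<xi>, \<xi> + 2\<pi>t) d\<xi>\<close>, where \<open>u\<close> is the Fourier transform of
  \<open>f\<close>, \<open>t\<close> runs over the integer vectors and \<open>K = fourier_sum \<Theta>\<close> (\<open>frame_sum_gram\<close>). For the dilated
  form only the \<open>t\<close> in the image of the integer lattice under the transpose of \<open>A\<close> occur, and the
  arguments of \<open>K\<close> are transformed by the inverse of that transpose (\<open>frame_sum_dilated\<close>). The two
  equations of the theorem say that the kernels on both sides agree, in the two cases of \<open>t\<close> outside
  and inside that image. Equal kernels give equal forms at once; conversely a test function \<open>u\<close>
  supported in two translates of a fundamental cell isolates one value of \<open>t\<close>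
  (\<open>lattice_form_vanish\<close>).

  Two analytic points make this rigorous. Bessel's inequality bounds \<open>K (\<xi>, \<xi>)\<close> by \<open>1\<close> almost
  everywhere (\<open>spectral_le_1\<close>), hence all sums converge absolutely, and the second equation at \<open>t = 0\<close>
  transfers this bound to \<open>\<Psi>\<close>. The integral formula is proved for \<open>u\<close> bounded with bounded support;
  the passage to all \<open>f\<close> uses that the defect \<open>\<parallel>P f\<parallel>\<^sup>2 - Q \<Psi> f\<close> is nonnegative and obeys the
  parallelogram law, so that it vanishes everywhere once it vanishes on a dense set
  (\<open>frame_sum_dense_ext\<close>).

  The Fourier analysis is developed from the definitions. Fourier series are complete by the theorem
  of Stone and Weierstrass on a product of circles, which yields Parseval's identity on a cell.
  Plancherel's identity for functions supported in a cell is the average of Parseval's identity over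
  all shifts of the dual lattice, and it extends by completeness of the space of square-integrable
  functions; the conjugated transform is an adjoint and shows that the transform is onto.
\<close>

section \<open>The Hilbert space of square-integrable functions\<close>

lemma cnj_borel_measurable [measurable]: "cnj \<in> borel_measurable borel"
  by (intro borel_measurable_continuous_onI continuous_intros)

lemma square_integrable_rep [simp]: "square_integrable (rep_l2 f)"
  using Quotient_rep_reflp[OF Quotient_l2, of f] by (simp add: l2_eq_def)

lemma rep_l2_measurable [measurable]: "rep_l2 f \<in> borel_measurable borel"
  using square_integrable_measurable[OF square_integrable_rep, of f] by simp

lemma rep_abs_l2:
  assumes "square_integrable f"
  shows "AE x in lborel. rep_l2 (abs_l2 f) x = f x"
proof -
  have "l2_eq f f" using assms by (simp add: l2_eq_def)
  then have "l2_eq (rep_l2 (abs_l2 f)) f"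
    by (rule rep_abs_rsp_left[OF Quotient3_l2])
  then show ?thesis by (simp add: l2_eq_def)
qed

lemma l2_eqI:
  assumes "AE x in lborel. rep_l2 f x = rep_l2 g x"
  shows "f = g"
proof -
  have "l2_eq (rep_l2 f) (rep_l2 g)" using assms by (simp add: l2_eq_def)
  then show ?thesis using Quotient_rel_rep[OF Quotient_l2, of f g] by simp
qed

lemma abs_rep_l2 [simp]: "abs_l2 (rep_l2 f) = f"
  by (rule Quotient_abs_rep[OF Quotient_l2])

lemma rep_plus: "AE x in lborel. rep_l2 (f + g) x = rep_l2 f x + rep_l2 g x"
proof -
  have "f + g = abs_l2 (\<lambda>x. rep_l2 f x + rep_l2 g x)"
    by (simp add: plus_l2_def map_fun_def)
  then show ?thesis using rep_abs_l2[OF square_integrable_add[OF square_integrable_rep square_integrable_rep]] by metis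
qed

lemma rep_scale: "AE x in lborel. rep_l2 (scale_l2 c f) x = c * rep_l2 f x"
proof -
  have "scale_l2 c f = abs_l2 (\<lambda>x. c * rep_l2 f x)"
    by (simp add: scale_l2_def map_fun_def)
  then show ?thesis using rep_abs_l2[OF square_integrable_scale[OF square_integrable_rep]] by metis
qed

lemma rep_minus: "AE x in lborel. rep_l2 (f - g) x = rep_l2 f x - rep_l2 g x"
  unfolding minus_l2_def uminus_l2_def
  using rep_plus[of f "scale_l2 (-1) g"] rep_scale[of "-1" g] by eventually_elim simp

lemma rep_zero: "AE x in lborel. rep_l2 0 x = 0"
  using rep_abs_l2[OF square_integrable_zero] by (simp add: zero_l2_def)

lemma rep_translate: "AE x in lborel. rep_l2 (translate k f) x = rep_l2 f (x - k)"
proof -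
  have "translate k f = abs_l2 (\<lambda>x. rep_l2 f (x - k))"
    by (simp add: translate_def map_fun_def)
  then show ?thesis using rep_abs_l2[OF square_integrable_translate[OF square_integrable_rep]] by metis
qed

lemma cinner_rep: "cinner f g = (LINT x|lborel. rep_l2 f x * cnj (rep_l2 g x))"
  by (simp add: cinner.rep_eq)

lemma integrable_cinner [simp]: "integrable lborel (\<lambda>x. rep_l2 f x * cnj (rep_l2 g x))"
  by (rule square_integrable_mult_integrable) auto

lemma cinner_eqI:
  assumes "AE x in lborel. rep_l2 f x = u x" "AE x in lborel. rep_l2 g x = v x"
    and "u \<in> borel_measurable borel" "v \<in> borel_measurable borel"
  shows "cinner f g = (LINT x|lborel. u x * cnj (v x))"
  unfolding cinner_rep using assms by (intro integral_cong_AE) auto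

lemma cinner_commute: "cinner f g = cnj (cinner g f)"
  unfolding cinner_rep by (subst Bochner_Integration.integral_cnj[symmetric]) (simp add: mult.commute)

lemma cinner_add_left: "cinner (f + g) h = cinner f h + cinner g h"
proof -
  have "cinner (f + g) h = (LINT x|lborel. (rep_l2 f x + rep_l2 g x) * cnj (rep_l2 h x))"
    by (rule cinner_eqI[OF rep_plus]) auto
  then show ?thesis by (simp add: distrib_right cinner_rep)
qed

lemma cinner_scale_left: "cinner (scale_l2 c f) h = c * cinner f h"
proof -
  have "cinner (scale_l2 c f) h = (LINT x|lborel. (c * rep_l2 f x) * cnj (rep_l2 h x))"
    by (rule cinner_eqI[OF rep_scale]) auto
  then show ?thesis by (simp add: mult.assoc cinner_rep)
qed

lemma cinner_add_right: "cinner h (f + g) = cinner h f + cinner h g"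
  by (metis cinner_commute cinner_add_left complex_cnj_add)

lemma cinner_scale_right: "cinner h (scale_l2 c f) = cnj c * cinner h f"
  by (metis cinner_commute cinner_scale_left complex_cnj_mult)

lemma cinner_minus_left: "cinner (f - g) h = cinner f h - cinner g h"
  by (metis add_diff_cancel_right' cinner_add_left diff_add_cancel)

lemma cinner_minus_right: "cinner h (f - g) = cinner h f - cinner h g"
  by (metis add_diff_cancel_right' cinner_add_right diff_add_cancel)

lemma cinner_zero_left [simp]: "cinner 0 h = 0"
  using cinner_minus_left[of h h h] by simp

lemma cinner_zero_right [simp]: "cinner h 0 = 0"
  using cinner_minus_right[of h h h] by simp

lemma cinner_sum_left: "cinner (\<Sum>i\<in>I. f i) h = (\<Sum>i\<in>I. cinner (f i) h)"
  by (induction I rule: infinite_finite_induct) (auto simp: cinner_add_left)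

lemma cinner_sum_right: "cinner h (\<Sum>i\<in>I. f i) = (\<Sum>i\<in>I. cinner h (f i))"
  by (induction I rule: infinite_finite_induct) (auto simp: cinner_add_right)

lemma norm_sq_integral: "(norm f)\<^sup>2 = (LINT x|lborel. (cmod (rep_l2 f x))\<^sup>2)"
proof -
  have "cinner f f = (LINT x|lborel. complex_of_real ((cmod (rep_l2 f x))\<^sup>2))"
    unfolding cinner_rep by (simp only: complex_norm_square)
  also have "\<dots> = complex_of_real (LINT x|lborel. (cmod (rep_l2 f x))\<^sup>2)"
    by (rule integral_complex_of_real)
  finally show ?thesis by (simp add: power2_norm_eq_inner inner_l2_def)
qed

lemma cinner_self: "cinner f f = complex_of_real ((norm f)\<^sup>2)"
proof -
  have "cinner f f = (LINT x|lborel. complex_of_real ((cmod (rep_l2 f x))\<^sup>2))"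
    unfolding cinner_rep by (simp only: complex_norm_square)
  also have "\<dots> = complex_of_real (LINT x|lborel. (cmod (rep_l2 f x))\<^sup>2)"
    by (rule integral_complex_of_real)
  finally show ?thesis by (simp add: norm_sq_integral)
qed

lemma norm_sq_nn_integral: "ennreal ((norm f)\<^sup>2) = (\<integral>\<^sup>+x. ennreal ((cmod (rep_l2 f x))\<^sup>2) \<partial>lborel)"
  unfolding norm_sq_integral
  by (subst nn_integral_eq_integral)
     (use square_integrable_rep[of f] in \<open>auto simp: square_integrable_def\<close>)

lemma norm_scale_l2: "norm (scale_l2 c f) = cmod c * norm f"
proof -
  have "complex_of_real ((norm (scale_l2 c f))\<^sup>2) = complex_of_real ((cmod c * norm f)\<^sup>2)"
    unfolding cinner_self[symmetric]
    using complex_norm_square[of c] cinner_self[of f]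
    by (simp add: cinner_scale_left cinner_scale_right power_mult_distrib)
  then have "(norm (scale_l2 c f))\<^sup>2 = (cmod c * norm f)\<^sup>2" by (simp only: of_real_eq_iff)
  then show ?thesis by (simp add: power2_eq_iff_nonneg)
qed

lemma tendsto_cinner:
  assumes "(f \<longlongrightarrow> a) F" "(g \<longlongrightarrow> b) F"
  shows "((\<lambda>x. cinner (f x) (g x)) \<longlongrightarrow> cinner a b) F"
proof -
  have eq: "cinner p q = complex_of_real (p \<bullet> q) + \<i> * complex_of_real (scale_l2 (- \<i>) p \<bullet> q)" for p q :: "'b::euclidean_space l2"
    by (simp add: inner_l2_def cinner_scale_left complex_eq_iff del: l2.scale_minus_left)
  have "((\<lambda>x. scale_l2 (- \<i>) (f x)) \<longlongrightarrow> scale_l2 (- \<i>) a) F"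
  proof (subst tendsto_dist_iff)
    have "dist (scale_l2 (- \<i>) (f x)) (scale_l2 (- \<i>) a) = dist (f x) a" for x
      unfolding dist_norm l2.scale_right_diff_distrib[symmetric] by (simp add: norm_scale_l2)
    then show "((\<lambda>x. dist (scale_l2 (- \<i>) (f x)) (scale_l2 (- \<i>) a)) \<longlongrightarrow> 0) F"
      using assms(1) by (subst (asm) tendsto_dist_iff) simp
  qed
  then show ?thesis unfolding eq using assms by (intro tendsto_intros)
qed

lemma nn_integral_norm_minus:
  "(\<integral>\<^sup>+x. ennreal ((cmod (rep_l2 f x - rep_l2 g x))\<^sup>2) \<partial>lborel) = ennreal ((norm (f - g))\<^sup>2)"
  unfolding norm_sq_nn_integral using rep_minus[of f g] by (intro nn_integral_cong_AE) auto

lemma norm_abs_l2_minus: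
  assumes "square_integrable u"
  shows "ennreal ((norm (abs_l2 u - f))\<^sup>2) = (\<integral>\<^sup>+x. ennreal ((cmod (u x - rep_l2 f x))\<^sup>2) \<partial>lborel)"
  unfolding nn_integral_norm_minus[symmetric] using rep_abs_l2[OF assms]
  by (intro nn_integral_cong_AE) auto

lemma square_integrableI:
  assumes "u \<in> borel_measurable borel" "(\<integral>\<^sup>+x. ennreal ((cmod (u x))\<^sup>2) \<partial>lborel) < \<infinity>"
  shows "square_integrable u"
  unfolding square_integrable_def using assms
  by (auto intro!: integrableI_bounded)

lemma square_integrable_diffD:
  assumes [measurable]: "u \<in> borel_measurable borel" 
    and "(\<integral>\<^sup>+x. ennreal ((cmod (u x - rep_l2 f x))\<^sup>2) \<partial>lborel) < \<infinity>"
  shows "square_integrable u"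
proof -
  have "square_integrable (\<lambda>x. (u x - rep_l2 f x) + rep_l2 f x)"
    by (intro square_integrable_add square_integrable_rep square_integrableI) (use assms in auto)
  then show ?thesis by simp
qed

text \<open>
  An almost everywhere limit of functions in a ball stays in the ball, by Fatou's lemma. This proves
  completeness, and later identifies limits in norm with pointwise limits.
\<close>

lemma l2_fatou:
  fixes u :: "'a::euclidean_space \<Rightarrow> complex"
  assumes [measurable]: "u \<in> borel_measurable borel"
    and lim: "AE x in lborel. (\<lambda>n. rep_l2 (f n) x) \<longlonglongrightarrow> u x"
    and le: "\<And>n. n \<ge> N \<Longrightarrow> norm (f n - g) \<le> e"
  shows "square_integrable u \<and> norm (abs_l2 u - g) \<le> e"
proof -
  have e: "e \<ge> 0" using le[of N] norm_ge_zero order_trans by blast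
  have "(\<integral>\<^sup>+x. ennreal ((cmod (u x - rep_l2 g x))\<^sup>2) \<partial>lborel)
      = (\<integral>\<^sup>+x. liminf (\<lambda>n. ennreal ((cmod (rep_l2 (f n) x - rep_l2 g x))\<^sup>2)) \<partial>lborel)"
  proof (rule nn_integral_cong_AE, use lim in eventually_elim)
    case (elim x)
    then have "(\<lambda>n. ennreal ((cmod (rep_l2 (f n) x - rep_l2 g x))\<^sup>2)) \<longlonglongrightarrow> ennreal ((cmod (u x - rep_l2 g x))\<^sup>2)"
      by (intro tendsto_intros tendsto_ennrealI)
    then show ?case by (intro lim_imp_Liminf[symmetric]) auto
  qed
  also have "\<dots> \<le> liminf (\<lambda>n. \<integral>\<^sup>+x. ennreal ((cmod (rep_l2 (f n) x - rep_l2 g x))\<^sup>2) \<partial>lborel)"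
    by (rule nn_integral_liminf) auto
  also have "\<dots> \<le> ennreal (e\<^sup>2)"
    unfolding nn_integral_norm_minus
    by (rule Liminf_le) (auto intro!: exI[of _ N] ennreal_leI power_mono le simp: eventually_sequentially)
  finally have *: "(\<integral>\<^sup>+x. ennreal ((cmod (u x - rep_l2 g x))\<^sup>2) \<partial>lborel) \<le> ennreal (e\<^sup>2)" .
  have sq: "square_integrable u"
    by (rule square_integrable_diffD) (use * in \<open>auto intro: le_less_trans\<close>)
  have "(norm (abs_l2 u - g))\<^sup>2 \<le> e\<^sup>2"
    using * unfolding norm_abs_l2_minus[OF sq, symmetric] by (simp add: ennreal_le_iff)
  then show ?thesis using sq e power2_le_imp_le by blast
qed

text \<open>
  The argument of Riesz and Fischer. Along a subsequence with steps of norm below \<open>3\<^sup>-\<^sup>k\<close> the sum of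
  \<open>4\<^sup>k\<close> times the squared pointwise steps has a finite integral. So at almost every point it is finite,
  which bounds the steps there by a multiple of \<open>2\<^sup>-\<^sup>k\<close> and makes the subsequence converge.
\<close>

instance l2 :: (euclidean_space) complete_space
proof
  fix X :: "nat \<Rightarrow> 'a l2"
  assume X: "Cauchy X"
  have "\<exists>N. \<forall>m\<ge>N. \<forall>n\<ge>N. norm (X m - X n) < (1/3) ^ k" for k
    using X unfolding Cauchy_def dist_norm by (metis zero_less_power zero_less_divide_1_iff zero_less_numeral)
  then obtain N where N: "\<And>k m n. m \<ge> N k \<Longrightarrow> n \<ge> N k \<Longrightarrow> norm (X m - X n) < (1/3) ^ k"
    by metis
  \<comment> \<open>Partial sums of the thresholds form an increasing sequence that dominates them.\<close>
  define r where "r k = (\<Sum>i\<le>k. N i)" for k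
  have rN: "r k \<ge> N k" "r (Suc k) \<ge> r k" "r k' \<ge> r k" if "k' \<ge> k" for k k'
    using that unfolding r_def by (auto intro: member_le_sum sum_mono2)
  define u where "u k = rep_l2 (X (r k))" for k
  define d where "d k = (\<lambda>x. cmod (u (Suc k) x - u k x))" for k
  have [measurable]: "u k \<in> borel_measurable borel" "d k \<in> borel_measurable borel" for k
    unfolding u_def d_def by measurable
  have "(\<integral>\<^sup>+x. (\<Sum>k. ennreal (4 ^ k * (d k x)\<^sup>2)) \<partial>lborel) = (\<Sum>k. \<integral>\<^sup>+x. ennreal (4 ^ k * (d k x)\<^sup>2) \<partial>lborel)"
    by (rule nn_integral_suminf) auto
  also have "\<dots> = (\<Sum>k. ennreal (4 ^ k * (norm (X (r (Suc k)) - X (r k)))\<^sup>2))"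
    unfolding d_def u_def
    by (subst ennreal_mult, simp_all, subst nn_integral_cmult)
       (auto simp: nn_integral_norm_minus[simplified] ennreal_mult)
  also have "\<dots> \<le> (\<Sum>k. ennreal ((4/9) ^ k))"
  proof (intro suminf_le ennreal_leI)
    fix k
    have "norm (X (r (Suc k)) - X (r k)) < (1/3) ^ k"
      by (rule N) (use rN(1)[of k k] rN(2)[of k k] in auto)
    then have "(norm (X (r (Suc k)) - X (r k)))\<^sup>2 \<le> ((1/3) ^ k)\<^sup>2"
      by (intro power_mono) auto
    also have "\<dots> = (1/9) ^ k" by (simp add: power2_eq_square power_mult_distrib[symmetric])
    finally have "4 ^ k * (norm (X (r (Suc k)) - X (r k)))\<^sup>2 \<le> 4 ^ k * (1/9) ^ k" by (intro mult_left_mono) auto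
    then show "4 ^ k * (norm (X (r (Suc k)) - X (r k)))\<^sup>2 \<le> (4/9) ^ k" by (simp add: power_mult_distrib[symmetric])
  qed auto
  also have "\<dots> < \<infinity>"
    by (subst suminf_ennreal2) (auto intro: summable_geometric)
  finally have "AE x in lborel. (\<Sum>k. ennreal (4 ^ k * (d k x)\<^sup>2)) \<noteq> \<infinity>"
    by (intro nn_integral_PInf_AE) auto
  then have "AE x in lborel. convergent (\<lambda>k. u k x)"
  proof eventually_elim
    case (elim x)
    define S where "S = (\<Sum>k. ennreal (4 ^ k * (d k x)\<^sup>2))"
    have "S < top" using elim by (simp add: S_def less_top)
    then have C: "S = ennreal (enn2real S)" by simp
    define C where "C = enn2real S"
    have C: "(\<Sum>k. ennreal (4 ^ k * (d k x)\<^sup>2)) = ennreal C" "C \<ge> 0"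
      using C by (simp_all only: S_def[symmetric] C_def[symmetric]) (simp add: C_def)
    have dk: "d k x \<le> sqrt C * (1/2) ^ k" for k
    proof -
      have "ennreal (4 ^ k * (d k x)\<^sup>2) \<le> ennreal C"
      proof -
        have "sum (\<lambda>k. ennreal (4 ^ k * (d k x)\<^sup>2)) {k} \<le> (\<Sum>k. ennreal (4 ^ k * (d k x)\<^sup>2))"
          by (rule sum_le_suminf) (auto intro: summableI)
        then show ?thesis by (simp only: C(1)) simp
      qed
      then have "4 ^ k * (d k x)\<^sup>2 \<le> C" using C(2) by (simp add: ennreal_le_iff)
      moreover have "4 ^ k * (d k x)\<^sup>2 = (2 ^ k * d k x)\<^sup>2"
        by (simp add: power_mult_distrib power2_eq_square power_mult_distrib[symmetric])
      ultimately have "2 ^ k * d k x \<le> sqrt C" by (simp add: real_le_rsqrt)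
      then show ?thesis by (simp add: power_divide field_simps)
    qed
    have "summable (\<lambda>k. d k x)"
      by (rule summable_comparison_test'[where g="\<lambda>k. sqrt C * (1/2) ^ k" and N=0])
         (use dk in \<open>auto simp: d_def intro!: summable_mult summable_geometric\<close>)
    then have "summable (\<lambda>k. u (Suc k) x - u k x)"
      unfolding d_def by (rule summable_norm_cancel)
    then have "convergent (\<lambda>n. \<Sum>k<n. (u (Suc k) x - u k x))" by (simp add: summable_iff_convergent)
    then have "convergent (\<lambda>n. (u n x - u 0 x) + u 0 x)"
      by (intro convergent_add convergent_const) (simp add: sum_lessThan_telescope[of "\<lambda>k. u k x"])
    then show ?case by simp
  qed
  then have lim: "AE x in lborel. (\<lambda>k. rep_l2 (X (r k)) x) \<longlonglongrightarrow> lim (\<lambda>k. u k x)"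
    by eventually_elim (simp add: convergent_LIMSEQ_iff u_def)
  define v where "v x = lim (\<lambda>k. u k x)" for x
  have [measurable]: "v \<in> borel_measurable borel"
    unfolding v_def by measurable
  have "norm (abs_l2 v - X m) \<le> (1/3) ^ k" if m: "m \<ge> N k" for m k
  proof (rule conjunct2[OF l2_fatou])
    show "AE x in lborel. (\<lambda>k. rep_l2 (X (r k)) x) \<longlonglongrightarrow> v x" using lim by (simp add: v_def)
    show "norm (X (r n) - X m) \<le> (1/3) ^ k" if "n \<ge> k" for n
      by (rule less_imp_le[OF N]) (use rN(1)[of k k] rN(3)[OF that] m in auto)
  qed measurable
  then have le: "norm (X m - abs_l2 v) \<le> (1/3) ^ k" if "m \<ge> N k" for m k
    using that by (simp add: norm_minus_commute)
  have "X \<longlonglongrightarrow> abs_l2 v"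
    unfolding lim_sequentially dist_norm
  proof (intro allI impI)
    fix e :: real assume "e > 0"
    then obtain k where "(1/3) ^ k < e"
      using real_arch_pow_inv[of e "1/3"] by auto
    then show "\<exists>no. \<forall>n\<ge>no. norm (X n - abs_l2 v) < e"
      using le[of k] by (intro exI[of _ "N k"]) (auto intro: order_le_less_trans)
  qed
  then show "convergent X" by (auto simp: convergent_def)
qed

text \<open>
  A sequence in \<open>V\<close> that minimises the distance to \<open>f\<close> is Cauchy by the parallelogram law applied at
  midpoints, and at the minimum the first variation vanishes in every direction of \<open>V\<close>.
\<close>

lemma hilbert_projection:
  fixes V :: "'h::{real_inner, complete_space} set"
  assumes V: "subspace V" "closed V"
  obtains p where "p \<in> V" "\<And>v. v \<in> V \<Longrightarrow> (f - p) \<bullet> v = 0"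
proof -
  have ne: "V \<noteq> {}" using V(1) subspace_0 by blast
  define d where "d = infdist f V"
  have d: "d \<le> norm (f - v)" if "v \<in> V" for v
    unfolding d_def using infdist_le[OF that, of f] by (simp add: dist_norm)
  have d0: "d \<ge> 0" by (simp add: d_def infdist_nonneg)
  have "\<exists>v\<in>V. norm (f - v) < d + 1 / real (Suc n)" for n
  proof (rule ccontr)
    assume "\<not> ?thesis"
    then have "d + 1 / real (Suc n) \<le> infdist f V"
      unfolding infdist_notempty[OF ne] using ne by (intro cINF_greatest) (auto simp: dist_norm not_less)
    then show False by (simp add: d_def)
  qed
  then obtain v where v: "\<And>n. v n \<in> V" "\<And>n. norm (f - v n) < d + 1 / real (Suc n)" by metis
  have key: "(norm (v m - v n))\<^sup>2 \<le> 2 * ((d + e)\<^sup>2 - d\<^sup>2) * 2"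
    if "norm (f - v m) \<le> d + e" "norm (f - v n) \<le> d + e" for m n e
  proof -
    have "(1/2) *\<^sub>R (v m + v n) \<in> V"
      using V(1) v(1) by (intro subspace_mul subspace_add)
    from d[OF this] have "d\<^sup>2 \<le> (norm (f - (1/2) *\<^sub>R (v m + v n)))\<^sup>2"
      using d0 by (intro power_mono)
    then have "4 * d\<^sup>2 \<le> (norm (2 *\<^sub>R (f - (1/2) *\<^sub>R (v m + v n))))\<^sup>2"
      by (simp add: power_mult_distrib)
    also have "2 *\<^sub>R (f - (1/2) *\<^sub>R (v m + v n)) = (f - v m) + (f - v n)"
      by (simp add: algebra_simps scaleR_2)
    finally have 1: "4 * d\<^sup>2 \<le> (norm ((f - v m) + (f - v n)))\<^sup>2" .
    have "(norm (v m - v n))\<^sup>2 = (norm ((f - v m) - (f - v n)))\<^sup>2"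
      by (simp add: norm_minus_commute)
    also have "\<dots> = 2 * (norm (f - v m))\<^sup>2 + 2 * (norm (f - v n))\<^sup>2 - (norm ((f - v m) + (f - v n)))\<^sup>2"
      by (simp add: power2_norm_eq_inner algebra_simps inner_commute)
    also have "\<dots> \<le> 2 * (d + e)\<^sup>2 + 2 * (d + e)\<^sup>2 - 4 * d\<^sup>2"
      using 1 power_mono[OF that(1), of 2] power_mono[OF that(2), of 2] by simp
    finally show ?thesis by (simp add: algebra_simps)
  qed
  have "Cauchy v"
  proof (rule metric_CauchyI)
    fix e :: real assume e: "e > 0"
    have "(\<lambda>n. 2 * ((d + 1 / real (Suc n))\<^sup>2 - d\<^sup>2) * 2) \<longlonglongrightarrow> 2 * ((d + 0)\<^sup>2 - d\<^sup>2) * 2"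
      by (intro tendsto_intros LIMSEQ_Suc[OF lim_1_over_n])
    then have "eventually (\<lambda>n. 2 * ((d + 1 / real (Suc n))\<^sup>2 - d\<^sup>2) * 2 < e\<^sup>2) sequentially"
      by (rule order_tendstoD) (use e in auto)
    then obtain N where N: "2 * ((d + 1 / real (Suc N))\<^sup>2 - d\<^sup>2) * 2 < e\<^sup>2"
      by (auto simp: eventually_sequentially)
    have "norm (f - v n) \<le> d + 1 / real (Suc N)" if "n \<ge> N" for n
    proof -
      have "1 / real (Suc n) \<le> 1 / real (Suc N)" using that by (intro divide_left_mono) auto
      then show ?thesis using v(2)[of n] by simp
    qed
    then have "(norm (v m - v n))\<^sup>2 < e\<^sup>2" if "m \<ge> N" "n \<ge> N" for m n
      using key[of m "1 / real (Suc N)" n] that N by (meson order_le_less_trans)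
    then have "dist (v m) (v n) < e" if "m \<ge> N" "n \<ge> N" for m n
      unfolding dist_norm using that e power2_less_imp_less by (metis less_imp_le)
    then show "\<exists>M. \<forall>m\<ge>M. \<forall>n\<ge>M. dist (v m) (v n) < e" by blast
  qed
  then obtain p where p: "v \<longlonglongrightarrow> p" using Cauchy_convergent convergent_def by blast
  have pV: "p \<in> V" using closed_sequentially[OF V(2) _ p] v(1) by blast
  have "norm (f - p) \<le> d + 0"
  proof (rule LIMSEQ_le)
    show "(\<lambda>n. norm (f - v n)) \<longlonglongrightarrow> norm (f - p)" by (intro tendsto_intros p)
    show "(\<lambda>n. d + 1 / real (Suc n)) \<longlonglongrightarrow> d + 0" by (intro tendsto_intros LIMSEQ_Suc[OF lim_1_over_n])
  qed (use v(2) less_imp_le in auto)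
  then have p_le: "norm (f - p) \<le> norm (f - u)" if "u \<in> V" for u using d[OF that] by simp
  have "(f - p) \<bullet> u = 0" if u: "u \<in> V" for u
  proof (cases "u = 0")
    case False
    define t where "t = ((f - p) \<bullet> u) / (u \<bullet> u)"
    have uu: "u \<bullet> u > 0" using False by simp
    have "(norm (f - p))\<^sup>2 \<le> (norm (f - (p + t *\<^sub>R u)))\<^sup>2"
      by (intro power_mono p_le) (use V(1) pV u in \<open>auto intro: subspace_add subspace_mul\<close>)
    also have "\<dots> = (norm ((f - p) - t *\<^sub>R u))\<^sup>2" by (simp add: algebra_simps)
    also have "\<dots> = (norm (f - p))\<^sup>2 - 2 * t * ((f - p) \<bullet> u) + t * t * (u \<bullet> u)"
      unfolding power2_norm_eq_inner inner_diff_left inner_diff_right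
      by (simp add: inner_commute algebra_simps)
    also have "t * t * (u \<bullet> u) = t * ((f - p) \<bullet> u)"
      using uu by (simp add: t_def)
    finally have "t * ((f - p) \<bullet> u) \<le> 0" by simp
    then have "((f - p) \<bullet> u)\<^sup>2 \<le> 0"
      using uu by (simp add: t_def divide_le_0_iff power2_eq_square) 
    then show ?thesis by simp
  qed simp
  then show ?thesis using that pV by blast
qed

lemma l2_scaleR: "r *\<^sub>R f = scale_l2 (complex_of_real r) f" for f :: "'a::euclidean_space l2"
  by (simp add: scaleR_l2_def)

lemma l2_subspace_imp_subspace:
  assumes "l2.subspace V" shows "subspace V"
  using assms unfolding subspace_def l2.subspace_def l2_scaleR by auto

lemma cinner_eq_0I:
  assumes "\<And>c. scale_l2 c v \<in> V \<and> f \<bullet> scale_l2 c v = 0"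
  shows "cinner f v = 0"
  using assms[of 1] assms[of \<i>] by (simp add: inner_l2_def cinner_scale_right complex_eq_iff)

text \<open>
  Real orthogonality to \<open>V\<close> is complex orthogonality, because \<open>V\<close> contains \<open>\<i> v\<close> together with \<open>v\<close>.
\<close>

lemma closed_subspace_projection:
  assumes "closed_subspace V"
  obtains p where "p \<in> V" "\<And>v. v \<in> V \<Longrightarrow> cinner (f - p) v = 0"
proof -
  from assms have V: "l2.subspace V" "closed V" by (auto simp: closed_subspace_def)
  obtain p where p: "p \<in> V" "\<And>v. v \<in> V \<Longrightarrow> (f - p) \<bullet> v = 0"
    using hilbert_projection[OF l2_subspace_imp_subspace[OF V(1)] V(2)] by blast
  have "cinner (f - p) v = 0" if "v \<in> V" for v
    by (rule cinner_eq_0I) (use V(1) p that l2.subspace_scale in blast)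
  with p(1) that show ?thesis by blast
qed

lemma norm_sq_orthogonal_add:
  assumes "cinner f g = 0"
  shows "(norm (f + g))\<^sup>2 = (norm f)\<^sup>2 + (norm g)\<^sup>2"
proof -
  have "f \<bullet> g = 0" using assms by (simp add: inner_l2_def)
  then show ?thesis by (simp add: power2_norm_eq_inner inner_add_left inner_add_right inner_commute)
qed

section \<open>Tiling by translates of a cube\<close>

text \<open>
  Sums of nonnegative terms are handled as integrals over counting measures, which makes the theorems
  of Tonelli and Fatou available for them.
\<close>

lemma has_sum_nonneg_iff_nn_integral:
  fixes g :: "'i \<Rightarrow> real"
  assumes "\<And>i. i \<in> I \<Longrightarrow> g i \<ge> 0" and S: "S \<ge> 0"
  shows "(g has_sum S) I \<longleftrightarrow> (\<integral>\<^sup>+i. ennreal (g i) \<partial>count_space I) = ennreal S"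
proof -
  have eq: "Infinite_Sum.abs_summable_on g I \<longleftrightarrow> g summable_on I"
    using assms by (intro summable_on_cong) auto
  show ?thesis
  proof
    assume s: "(g has_sum S) I"
    then have "Infinite_Sum.abs_summable_on g I" using eq has_sum_imp_summable by blast
    then have a: "Infinite_Set_Sum.abs_summable_on g I" using abs_summable_equivalent by blast
    have "(\<integral>\<^sup>+i. ennreal (g i) \<partial>count_space I) = ennreal (infsetsum g I)"
      by (rule nn_integral_conv_infsetsum[OF a assms(1)])
    then show "(\<integral>\<^sup>+i. ennreal (g i) \<partial>count_space I) = ennreal S"
      using infsetsum_infsum[OF a] infsumI[OF s] by simp
  next
    assume n: "(\<integral>\<^sup>+i. ennreal (g i) \<partial>count_space I) = ennreal S"
    have "integrable (count_space I) g"
      using assms n by (intro integrableI_nonneg) (auto simp: AE_count_space)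
    then have a: "Infinite_Set_Sum.abs_summable_on g I" by (simp add: Infinite_Set_Sum.abs_summable_on_def)
    have "g summable_on I" using a abs_summable_equivalent eq by blast
    moreover have "infsum g I = S"
      using nn_integral_conv_infsetsum[OF a assms(1)] n infsetsum_infsum[OF a] S
      by (metis assms(1) ennreal_inj infsum_nonneg)
    ultimately show "(g has_sum S) I" using has_sum_infsum by blast
  qed
qed

lemma AE_translate:
  assumes "AE x in lborel. P (x :: 'a::euclidean_space)"
  shows "AE x in lborel. P (x + v)"
proof -
  have "AE x in distr lborel borel ((+) v). P x"
    using assms unfolding lborel_distr_plus .
  then have "AE x in lborel. P (v + x)"
    by (rule AE_distrD[rotated]) simp
  then show ?thesis by (simp add: add.commute)
qed

lemma nn_integral_translate:
  assumes [measurable]: "h \<in> borel_measurable borel"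
  shows "(\<integral>\<^sup>+x. h (x + v) \<partial>lborel) = (\<integral>\<^sup>+x. h x \<partial>(lborel :: 'a::euclidean_space measure))"
  by (subst (2) lborel_distr_plus[of v, symmetric]) (simp add: nn_integral_distr add.commute)

lemma integrable_translate_iff:
  fixes h :: "'a::euclidean_space \<Rightarrow> 'b::{banach, second_countable_topology}"
  assumes [measurable]: "h \<in> borel_measurable borel"
  shows "integrable lborel (\<lambda>x. h (x + v)) \<longleftrightarrow> integrable lborel h"
  by (subst (2) lborel_distr_plus[of v, symmetric]) (simp add: integrable_distr_eq add.commute)

lemma integral_translate:
  fixes h :: "'a::euclidean_space \<Rightarrow> 'b::{banach, second_countable_topology}"
  assumes [measurable]: "h \<in> borel_measurable borel"
  shows "(LINT x|lborel. h (x + v)) = (LINT x|lborel. h x)"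
  by (subst (2) lborel_distr_plus[of v, symmetric]) (simp add: integral_distr add.commute)

lemma int_lattice_0 [simp]: "0 \<in> int_lattice"
  and int_lattice_add: "k \<in> int_lattice \<Longrightarrow> l \<in> int_lattice \<Longrightarrow> k + l \<in> int_lattice"
  and int_lattice_minus: "k \<in> int_lattice \<Longrightarrow> - k \<in> int_lattice"
  and int_lattice_diff: "k \<in> int_lattice \<Longrightarrow> l \<in> int_lattice \<Longrightarrow> k - l \<in> int_lattice"
  by (auto simp: int_lattice_def)

lemma countable_int_lattice [simp]: "countable (int_lattice :: (real^'n) set)"
proof -
  have "int_lattice \<subseteq> range (\<lambda>f :: 'n \<Rightarrow> int. \<chi> i. of_int (f i))"
  proof
    fix k :: "real^'n" assume "k \<in> int_lattice"
    then have "\<forall>i. \<exists>z. k $ i = of_int z" by (auto simp: int_lattice_def Ints_def)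
    then obtain f where "\<forall>i. k $ i = of_int (f i)" by metis
    then show "k \<in> range (\<lambda>f :: 'n \<Rightarrow> int. \<chi> i. of_int (f i))"
      by (intro image_eqI[of _ _ f]) (auto simp: vec_eq_iff)
  qed
  then show ?thesis by (rule countable_subset) (rule countable_image[OF countableI_type])
qed

text \<open>
  Half-open, so that the translates by \<open>c\<close> times the integer vectors cover every point exactly once.
\<close>

definition cell :: "real \<Rightarrow> (real^'n) set" where
  "cell c = {x. \<forall>i. - c / 2 \<le> x $ i \<and> x $ i < c / 2}"

lemma cell_measurable [measurable]: "cell c \<in> sets borel"
  unfolding cell_def by measurable

lemma cell_unique:
  assumes "k \<in> int_lattice" "x \<in> cell c" "x + c *\<^sub>R k \<in> cell c"
  shows "k = 0"
proof -
  have "k $ i = 0" for i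
  proof -
    obtain z where z: "k $ i = of_int z" using assms(1) by (auto simp: int_lattice_def Ints_def)
    have "- c / 2 \<le> x $ i" "x $ i < c / 2" "- c / 2 \<le> x $ i + c * of_int z" "x $ i + c * of_int z < c / 2"
      using assms(2,3) unfolding cell_def mem_Collect_eq vector_add_component vector_scaleR_component z[symmetric] by auto
    then have "\<bar>c * of_int z\<bar> < c" unfolding abs_less_iff by (intro conjI) linarith+
    then have "c > 0" "\<bar>c * of_int z\<bar> < c" using abs_ge_zero[of "c * of_int z"] by linarith+
    then have "\<bar>of_int z :: real\<bar> < 1" by (simp add: abs_mult)
    then show ?thesis using z by simp
  qed
  then show ?thesis by (simp add: vec_eq_iff)
qed

lemma cell_exists:
  assumes "c > 0"
  shows "\<exists>k\<in>int_lattice. x - c *\<^sub>R k \<in> cell c"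
proof -
  define k :: "real^'a" where "k = (\<chi> i. of_int \<lfloor>x $ i / c + 1 / 2\<rfloor>)"
  have "- c / 2 \<le> (x - c *\<^sub>R k) $ i \<and> (x - c *\<^sub>R k) $ i < c / 2" for i
  proof -
    have "of_int \<lfloor>x $ i / c + 1 / 2\<rfloor> \<le> x $ i / c + 1 / 2" "x $ i / c + 1 / 2 < of_int \<lfloor>x $ i / c + 1 / 2\<rfloor> + 1"
      by linarith+
    then have "c * of_int \<lfloor>x $ i / c + 1 / 2\<rfloor> \<le> c * (x $ i / c + 1 / 2)" 
      "c * (x $ i / c + 1 / 2) < c * (of_int \<lfloor>x $ i / c + 1 / 2\<rfloor> + 1)"
      using assms by (simp_all add: mult_left_mono)
    then show ?thesis using assms by (simp add: k_def algebra_simps)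
  qed
  then have "x - c *\<^sub>R k \<in> cell c" by (simp add: cell_def)
  moreover have "k \<in> int_lattice" by (simp add: k_def int_lattice_def)
  ultimately show ?thesis by blast
qed

lemma cell_ex1:
  assumes "c > 0"
  obtains k where "k \<in> int_lattice" "\<And>l. l \<in> int_lattice \<Longrightarrow> x - c *\<^sub>R l \<in> cell c \<longleftrightarrow> l = k"
proof -
  obtain k where k: "k \<in> int_lattice" "x - c *\<^sub>R k \<in> cell c" using cell_exists[OF assms] by blast
  have "l = k" if "l \<in> int_lattice" "x - c *\<^sub>R l \<in> cell c" for l
  proof -
    have "x - c *\<^sub>R k + c *\<^sub>R (k - l) \<in> cell c" using that by (simp add: algebra_simps)
    then have "k - l = 0" by (rule cell_unique[OF int_lattice_diff[OF k(1) that(1)] k(2)])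
    then show ?thesis by simp
  qed
  with k that show ?thesis by blast
qed

lemma pair_sigma_finite_count_lborel: 
  "countable I \<Longrightarrow> pair_sigma_finite (count_space I) (lborel :: 'a::euclidean_space measure)"
  by (intro pair_sigma_finite.intro sigma_finite_measure_count_space_countable sigma_finite_lborel)

lemma nn_integral_count_space_swap:
  assumes "countable I" "\<And>i. i \<in> I \<Longrightarrow> f i \<in> borel_measurable borel"
  shows "(\<integral>\<^sup>+i. (\<integral>\<^sup>+x. f i x \<partial>lborel) \<partial>count_space I) = (\<integral>\<^sup>+x. (\<integral>\<^sup>+i. f i x \<partial>count_space I) \<partial>(lborel :: 'a::euclidean_space measure))"
proof -
  interpret pair_sigma_finite "count_space I" "lborel :: 'a measure"
    by (rule pair_sigma_finite_count_lborel) fact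
  show ?thesis
    by (rule Fubini'[symmetric])
       (use assms in \<open>auto intro!: measurable_pair_measure_countable1\<close>)
qed

lemma integral_count_space_swap:
  fixes f :: "'i \<Rightarrow> 'a::euclidean_space \<Rightarrow> complex"
  assumes "countable I" "\<And>i. i \<in> I \<Longrightarrow> f i \<in> borel_measurable borel"
    and fin: "(\<integral>\<^sup>+i. (\<integral>\<^sup>+x. ennreal (cmod (f i x)) \<partial>lborel) \<partial>count_space I) < \<infinity>"
  shows "(LINT i|count_space I. LINT x|lborel. f i x) = (LINT x|lborel. LINT i|count_space I. f i x)"
    and "integrable lborel (\<lambda>x. LINT i|count_space I. f i x)"
    and "AE x in lborel. integrable (count_space I) (\<lambda>i. f i x)"
proof -
  interpret pair_sigma_finite "count_space I" "lborel :: 'a measure"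
    by (rule pair_sigma_finite_count_lborel) fact
  have m: "case_prod f \<in> borel_measurable (count_space I \<Otimes>\<^sub>M lborel)"
    using assms by (auto intro!: measurable_pair_measure_countable1)
  have i: "integrable (count_space I \<Otimes>\<^sub>M lborel) (case_prod f)"
    by (rule integrableI_bounded[OF m])
       (subst sigma_finite_measure.nn_integral_fst[OF sigma_finite_lborel, symmetric],
        use m fin in \<open>auto simp: case_prod_beta\<close>)
  show "(LINT i|count_space I. LINT x|lborel. f i x) = (LINT x|lborel. LINT i|count_space I. f i x)"
    using Fubini_integral[OF i] by simp
  show "integrable lborel (\<lambda>x. LINT i|count_space I. f i x)" by (rule integrable_snd[OF i])
  show "AE x in lborel. integrable (count_space I) (\<lambda>i. f i x)" by (rule AE_integrable_snd[OF i])
qed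

lemma measurable_integral_count_space:
  fixes f :: "'i \<Rightarrow> 'a::euclidean_space \<Rightarrow> complex"
  assumes "countable I" "\<And>i. i \<in> I \<Longrightarrow> f i \<in> borel_measurable borel"
  shows "(\<lambda>x. LINT i|count_space I. f i x) \<in> borel_measurable borel"
proof -
  interpret sigma_finite_measure "count_space I"
    by (rule sigma_finite_measure_count_space_countable) fact
  have "(\<lambda>x. LINT i|count_space I. f i x) \<in> borel_measurable (lborel :: 'a measure)"
  proof (rule borel_measurable_lebesgue_integral)
    show "(\<lambda>(x, i). f i x) \<in> borel_measurable (lborel \<Otimes>\<^sub>M count_space I)"
    proof (subst measurable_pair_swap_iff)
      show "(\<lambda>(x, y). case (y, x) of (x, i) \<Rightarrow> f i x) \<in> borel_measurable (count_space I \<Otimes>\<^sub>M (lborel :: 'a measure))"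
        using assms by (auto intro!: measurable_pair_measure_countable1)
    qed
  qed
  then show ?thesis by simp
qed

lemma measurable_nn_integral_count_space:
  fixes f :: "'i \<Rightarrow> 'a::euclidean_space \<Rightarrow> ennreal"
  assumes "countable I" "\<And>i. i \<in> I \<Longrightarrow> f i \<in> borel_measurable borel"
  shows "(\<lambda>x. \<integral>\<^sup>+i. f i x \<partial>count_space I) \<in> borel_measurable borel"
proof -
  interpret sigma_finite_measure "count_space I"
    by (rule sigma_finite_measure_count_space_countable) fact
  have "(\<lambda>x. \<integral>\<^sup>+i. f i x \<partial>count_space I) \<in> borel_measurable (lborel :: 'a measure)"
  proof (rule borel_measurable_nn_integral)
    show "(\<lambda>(x, i). f i x) \<in> borel_measurable (lborel \<Otimes>\<^sub>M count_space I)"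
    proof (subst measurable_pair_swap_iff)
      show "(\<lambda>(x, y). case (y, x) of (x, i) \<Rightarrow> f i x) \<in> borel_measurable (count_space I \<Otimes>\<^sub>M (lborel :: 'a measure))"
        using assms by (auto intro!: measurable_pair_measure_countable1)
    qed
  qed
  then show ?thesis by simp
qed

lemma nn_integral_count_space_single:
  assumes "k \<in> I" "\<And>i. i \<in> I \<Longrightarrow> i \<noteq> k \<Longrightarrow> f i = (0 :: ennreal)"
  shows "(\<integral>\<^sup>+i. f i \<partial>count_space I) = f k"
proof -
  have "(\<integral>\<^sup>+i. f i \<partial>count_space I) = (\<integral>\<^sup>+i. f i \<partial>count_space {k})"
    using assms by (intro nn_integral_count_space_eq) auto
  then show ?thesis by (simp add: nn_integral_count_space_finite)
qed

lemma integral_count_space_finite_subset: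
  fixes f :: "'i \<Rightarrow> 'b::{banach, second_countable_topology}"
  assumes "finite J" "J \<subseteq> I" "\<And>i. i \<in> I \<Longrightarrow> i \<notin> J \<Longrightarrow> f i = 0"
  shows "(LINT i|count_space I. f i) = (\<Sum>i\<in>J. f i)"
proof -
  have "{a\<in>I. f a \<noteq> 0} \<subseteq> J" using assms by auto
  then have "finite {a\<in>I. f a \<noteq> 0}" using assms(1) finite_subset by blast
  then have "(LINT i|count_space I. f i) = (\<Sum>a | a \<in> I \<and> f a \<noteq> 0. f a)"
    by (rule lebesgue_integral_count_space_finite_support)
  also have "\<dots> = (\<Sum>i\<in>J. f i)"
    using assms by (intro sum.mono_neutral_left) auto
  finally show ?thesis .
qed

text \<open>
  At each point exactly one of the translates of the cell contributes; summing over the translates and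
  moving each of them back to the cell gives the formula.
\<close>

lemma nn_integral_tiling:
  fixes h :: "real^'n \<Rightarrow> ennreal"
  assumes c: "c > 0" and [measurable]: "h \<in> borel_measurable borel"
  shows "(\<integral>\<^sup>+x. h x \<partial>lborel) = (\<integral>\<^sup>+x\<in>cell c. (\<integral>\<^sup>+k. h (x + c *\<^sub>R k) \<partial>count_space int_lattice) \<partial>lborel)"
proof -
  have "(\<integral>\<^sup>+x. h x \<partial>lborel) = (\<integral>\<^sup>+x. (\<integral>\<^sup>+k. h x * indicator (cell c) (x - c *\<^sub>R k) \<partial>count_space int_lattice) \<partial>lborel)"
  proof (rule nn_integral_cong)
    fix x :: "real^'n"
    obtain k where "k \<in> int_lattice" "\<And>l. l \<in> int_lattice \<Longrightarrow> x - c *\<^sub>R l \<in> cell c \<longleftrightarrow> l = k"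
      using cell_ex1[OF c] by blast
    then show "h x = (\<integral>\<^sup>+k. h x * indicator (cell c) (x - c *\<^sub>R k) \<partial>count_space int_lattice)"
      by (subst nn_integral_count_space_single[of k]) auto
  qed
  also have "\<dots> = (\<integral>\<^sup>+k. (\<integral>\<^sup>+x. h x * indicator (cell c) (x - c *\<^sub>R k) \<partial>lborel) \<partial>count_space int_lattice)"
    by (rule nn_integral_count_space_swap[symmetric]) auto
  also have "\<dots> = (\<integral>\<^sup>+k. (\<integral>\<^sup>+x. h (x + c *\<^sub>R k) * indicator (cell c) x \<partial>lborel) \<partial>count_space int_lattice)"
  proof (rule nn_integral_cong)
    fix k :: "real^'n"
    show "(\<integral>\<^sup>+x. h x * indicator (cell c) (x - c *\<^sub>R k) \<partial>lborel) = (\<integral>\<^sup>+x. h (x + c *\<^sub>R k) * indicator (cell c) x \<partial>lborel)"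
      using nn_integral_translate[of "\<lambda>x. h x * indicator (cell c) (x - c *\<^sub>R k)" "c *\<^sub>R k"] by simp
  qed
  also have "\<dots> = (\<integral>\<^sup>+x\<in>cell c. (\<integral>\<^sup>+k. h (x + c *\<^sub>R k) \<partial>count_space int_lattice) \<partial>lborel)"
    by (subst nn_integral_count_space_swap) (auto simp: nn_integral_multc)
  finally show ?thesis .
qed

lemma integral_tiling:
  fixes h :: "real^'n \<Rightarrow> complex"
  assumes c: "c > 0" and h: "integrable lborel h" and [measurable]: "h \<in> borel_measurable borel"
  shows "(LINT x|lborel. h x) = (LINT x|lborel. indicator (cell c) x *\<^sub>R (LINT k|count_space int_lattice. h (x + c *\<^sub>R k)))"
    and "integrable lborel (\<lambda>x. indicator (cell c) x *\<^sub>R (LINT k|count_space int_lattice. h (x + c *\<^sub>R k)))"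
proof -
  have fin: "(\<integral>\<^sup>+k. (\<integral>\<^sup>+x. ennreal (cmod (indicator (cell c) (x - c *\<^sub>R k) *\<^sub>R h x)) \<partial>lborel) \<partial>count_space int_lattice) < \<infinity>"
  proof -
    have "(\<integral>\<^sup>+k. (\<integral>\<^sup>+x. ennreal (cmod (indicator (cell c) (x - c *\<^sub>R k) *\<^sub>R h x)) \<partial>lborel) \<partial>count_space int_lattice)
       = (\<integral>\<^sup>+x. (\<integral>\<^sup>+k. ennreal (cmod (indicator (cell c) (x - c *\<^sub>R k) *\<^sub>R h x)) \<partial>count_space int_lattice) \<partial>lborel)"
      by (rule nn_integral_count_space_swap) auto
    also have "\<dots> = (\<integral>\<^sup>+x. ennreal (cmod (h x)) \<partial>lborel)"
    proof (rule nn_integral_cong)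
      fix x :: "real^'n"
      obtain k where "k \<in> int_lattice" "\<And>l. l \<in> int_lattice \<Longrightarrow> x - c *\<^sub>R l \<in> cell c \<longleftrightarrow> l = k"
        using cell_ex1[OF c] by blast
      then show "(\<integral>\<^sup>+k. ennreal (cmod (indicator (cell c) (x - c *\<^sub>R k) *\<^sub>R h x)) \<partial>count_space int_lattice) = ennreal (cmod (h x))"
        by (subst nn_integral_count_space_single[of k]) auto
    qed
    also have "\<dots> < \<infinity>" using h by (simp add: integrable_iff_bounded)
    finally show ?thesis .
  qed
  have tr: "(LINT x|lborel. indicator (cell c) (x - c *\<^sub>R k) *\<^sub>R h x) = (LINT x|lborel. indicator (cell c) x *\<^sub>R h (x + c *\<^sub>R k))" for k
    using integral_translate[of "\<lambda>x. indicator (cell c) (x - c *\<^sub>R k) *\<^sub>R h x" "c *\<^sub>R k"] by simp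
  have fin': "(\<integral>\<^sup>+k. (\<integral>\<^sup>+x. ennreal (cmod (indicator (cell c) x *\<^sub>R h (x + c *\<^sub>R k))) \<partial>lborel) \<partial>count_space int_lattice) < \<infinity>"
  proof -
    have "(\<integral>\<^sup>+x. ennreal (cmod (indicator (cell c) (x - c *\<^sub>R k) *\<^sub>R h x)) \<partial>lborel) 
        = (\<integral>\<^sup>+x. ennreal (cmod (indicator (cell c) x *\<^sub>R h (x + c *\<^sub>R k))) \<partial>lborel)" for k
      using nn_integral_translate[of "\<lambda>x. ennreal (cmod (indicator (cell c) (x - c *\<^sub>R k) *\<^sub>R h x))" "c *\<^sub>R k"] by simp
    then show ?thesis using fin by simp
  qed
  note sw = integral_count_space_swap[OF countable_int_lattice _ fin]
  note sw' = integral_count_space_swap[OF countable_int_lattice _ fin']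
  have "(LINT x|lborel. h x) = (LINT x|lborel. LINT k|count_space int_lattice. indicator (cell c) (x - c *\<^sub>R k) *\<^sub>R h x)"
  proof (rule Bochner_Integration.integral_cong[OF refl])
    fix x :: "real^'n"
    obtain k where "k \<in> int_lattice" "\<And>l. l \<in> int_lattice \<Longrightarrow> x - c *\<^sub>R l \<in> cell c \<longleftrightarrow> l = k"
      using cell_ex1[OF c] by blast
    then show "h x = (LINT k|count_space int_lattice. indicator (cell c) (x - c *\<^sub>R k) *\<^sub>R h x)"
      by (subst integral_count_space_finite_subset[of "{k}"]) auto
  qed
  also have "\<dots> = (LINT k|count_space int_lattice. LINT x|lborel. indicator (cell c) x *\<^sub>R h (x + c *\<^sub>R k))"
    by (subst sw(1)[symmetric]) (auto simp: tr)
  also have "\<dots> = (LINT x|lborel. LINT k|count_space int_lattice. indicator (cell c) x *\<^sub>R h (x + c *\<^sub>R k))"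
    by (rule sw'(1)) auto
  also have "\<dots> = (LINT x|lborel. indicator (cell c) x *\<^sub>R (LINT k|count_space int_lattice. h (x + c *\<^sub>R k)))"
    by (simp add: integral_scaleR_right)
  finally show "(LINT x|lborel. h x) = (LINT x|lborel. indicator (cell c) x *\<^sub>R (LINT k|count_space int_lattice. h (x + c *\<^sub>R k)))" .
  show "integrable lborel (\<lambda>x. indicator (cell c) x *\<^sub>R (LINT k|count_space int_lattice. h (x + c *\<^sub>R k)))"
    using sw'(2) by simp
qed

lemma cell_subset_cbox: "cell c \<subseteq> cbox (\<chi> i. - c / 2) (\<chi> i. c / 2)"
  and box_subset_cell: "box (\<chi> i. - c / 2) (\<chi> i. c / 2) \<subseteq> cell c"
  by (auto simp: cell_def mem_box_cart less_imp_le)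

lemma bounded_subset_cell:
  assumes "bounded (E :: (real^'n) set)" obtains c where "E \<subseteq> cell c"
proof -
  obtain a where a: "\<And>x. x \<in> E \<Longrightarrow> norm x \<le> a" using assms bounded_iff by metis
  have "E \<subseteq> cell (2 * a + 1)"
  proof
    fix x assume "x \<in> E"
    then have "\<bar>x $ i\<bar> \<le> a" for i using a component_le_norm_cart[of x i] order_trans by blast
    then have "- a \<le> x $ i \<and> x $ i \<le> a" for i by (simp add: abs_le_iff minus_le_iff)
    moreover have "- (2 * a + 1) / 2 = - a - 1 / 2" "(2 * a + 1) / 2 = a + 1 / 2" by (simp_all add: field_simps)
    ultimately show "x \<in> cell (2 * a + 1)"
      unfolding cell_def mem_Collect_eq by (smt (verit) divide_pos_pos zero_less_one)
  qed
  then show ?thesis by (rule that)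
qed

lemma bounded_cell: "bounded (cell c :: (real^'n) set)"
  using cell_subset_cbox[of c] bounded_cbox bounded_subset by metis

lemma cell_AE_box:
  "AE x in lborel. x \<in> (cell c :: (real^'n) set) \<longleftrightarrow> x \<in> box (\<chi> i. - c / 2) (\<chi> i. c / 2)"
proof -
  let ?a = "(\<chi> i. - c / 2) :: real^'n" and ?b = "(\<chi> i. c / 2) :: real^'n"
  have "emeasure lborel (cbox ?a ?b - box ?a ?b) = 0"
    by (subst emeasure_Diff) (auto simp: box_subset_cbox emeasure_lborel_box_eq emeasure_lborel_cbox_eq)
  then have "cbox ?a ?b - box ?a ?b \<in> null_sets lborel" by (simp add: null_sets_def)
  then have "AE x in lborel. x \<notin> cbox ?a ?b - box ?a ?b" by (rule AE_not_in)
  then show ?thesis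
    using cell_subset_cbox[of c] box_subset_cell[of c] by (auto simp: subset_iff)
qed

lemma emeasure_cell:
  assumes "c \<ge> 0"
  shows "emeasure lborel (cell c :: (real^'n) set) = ennreal (c ^ CARD('n))"
proof -
  let ?a = "(\<chi> i. - c / 2) :: real^'n" and ?b = "(\<chi> i. c / 2) :: real^'n"
  have "emeasure lborel (cell c :: (real^'n) set) = emeasure lborel (box ?a ?b)"
    by (rule emeasure_eq_AE) (use cell_AE_box in auto)
  also have "\<dots> = ennreal (\<Prod>b\<in>(Basis :: (real^'n) set). c)"
    using assms by (subst emeasure_lborel_box) (auto simp: Basis_vec_def inner_axis inner_diff_left intro!: arg_cong[of _ _ ennreal] prod.cong simp del: prod_constant)
  finally show ?thesis by simp
qed

lemma measure_cell: "c \<ge> 0 \<Longrightarrow> measure lborel (cell c :: (real^'n) set) = c ^ CARD('n)"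
  using emeasure_cell[of c, where 'n='n] by (simp add: measure_def)

text \<open>
  The pieces of a translated cell that lie in different tiles are moved back by lattice vectors, under
  which the integrand is invariant, and reassemble to the original cell.
\<close>

lemma integral_cell_translate:
  fixes g :: "real^'n \<Rightarrow> complex"
  assumes c: "c > 0" and [measurable]: "g \<in> borel_measurable borel"
    and per: "\<And>x k. k \<in> int_lattice \<Longrightarrow> g (x + c *\<^sub>R k) = g x"
    and bdd: "\<And>x. cmod (g x) \<le> C"
  shows "(LINT x|lborel. indicator (cell c) x *\<^sub>R g (x + v)) = (LINT x|lborel. indicator (cell c) x *\<^sub>R g x)"
proof -
  let ?h = "\<lambda>x. indicator (cell c) (x - v) *\<^sub>R g x"
  have i: "integrable lborel (\<lambda>x. indicator (cell c) x *\<^sub>R g (x + v))"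
  proof (rule Bochner_Integration.integrable_bound)
    show "integrable lborel (\<lambda>x. indicator (cell c :: (real^'n) set) x *\<^sub>R C)"
      using emeasure_cell[of c, where 'n='n] c by (intro integrable_scaleR_left) auto
    show "AE x in lborel. norm (indicator (cell c) x *\<^sub>R g (x + v)) \<le> norm (indicator (cell c) x *\<^sub>R C)"
    proof (rule AE_I2)
      fix x
      show "norm (indicator (cell c) x *\<^sub>R g (x + v)) \<le> norm (indicator (cell c) x *\<^sub>R C)"
        using bdd[of "x + v"] by (auto simp: indicator_def)
    qed
  qed auto
  then have "integrable lborel ?h"
    using integrable_translate_iff[of ?h v] by simp
  note t = integral_tiling(1)[OF c this]
  have "(LINT x|lborel. indicator (cell c) x *\<^sub>R g (x + v)) = (LINT x|lborel. ?h x)"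
    using integral_translate[of ?h v] by simp
  also have "\<dots> = (LINT x|lborel. indicator (cell c) x *\<^sub>R (LINT k|count_space int_lattice. ?h (x + c *\<^sub>R k)))"
    by (rule t) auto
  also have "\<dots> = (LINT x|lborel. indicator (cell c) x *\<^sub>R g x)"
  proof (intro Bochner_Integration.integral_cong refl arg_cong2[of _ _ _ _ scaleR])
    fix x :: "real^'n"
    obtain k where k: "k \<in> int_lattice" "\<And>l. l \<in> int_lattice \<Longrightarrow> (x - v) - c *\<^sub>R l \<in> cell c \<longleftrightarrow> l = k"
      using cell_ex1[OF c] by blast
    have l_iff: "x + c *\<^sub>R l - v \<in> cell c \<longleftrightarrow> l = - k" if "l \<in> int_lattice" for l
    proof -
      have "x + c *\<^sub>R l - v = x - v - c *\<^sub>R (- l)" by (simp add: algebra_simps)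
      then show ?thesis using k(2)[OF int_lattice_minus[OF that]] by (metis minus_minus)
    qed
    then have "(LINT k|count_space int_lattice. ?h (x + c *\<^sub>R k)) = (\<Sum>k\<in>{-k}. ?h (x + c *\<^sub>R k))"
      using k(1) by (intro integral_count_space_finite_subset) (auto simp: int_lattice_minus)
    also have "\<dots> = g x"
      using l_iff[of "-k"] k(1) per[of "-k"]
      by (simp add: int_lattice_minus)
    finally show "(LINT k|count_space int_lattice. ?h (x + c *\<^sub>R k)) = g x" .
  qed
  finally show ?thesis .
qed

section \<open>Fourier series on a cube\<close>

definition texp :: "real \<Rightarrow> real^'n \<Rightarrow> real^'n \<Rightarrow> complex" where
  "texp c k x = cis (2 * pi / c * (k \<bullet> x))"

lemma norm_texp [simp]: "cmod (texp c k x) = 1"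
  by (simp add: texp_def)

lemma cis_measurable [measurable]: "cis \<in> borel_measurable borel"
  by (intro borel_measurable_continuous_onI continuous_intros)

lemma texp_measurable [measurable]: "texp c k \<in> borel_measurable borel"
  unfolding texp_def by measurable

lemma texp_add_freq: "texp c (k + l) x = texp c k x * texp c l x"
  by (simp add: texp_def cis_mult inner_add_left distrib_left)

lemma texp_add: "texp c k (x + y) = texp c k x * texp c k y"
  by (simp add: texp_def cis_mult inner_add_right distrib_left)

lemma cnj_texp: "cnj (texp c k x) = texp c (- k) x"
  by (simp add: texp_def cis_cnj)

lemma texp_0 [simp]: "texp c 0 x = 1" 
  by (simp add: texp_def)

lemma inner_int_lattice: "k \<in> int_lattice \<Longrightarrow> l \<in> int_lattice \<Longrightarrow> (k \<bullet> l) \<in> \<int>"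
  unfolding inner_vec_def by (auto simp: int_lattice_def intro!: Ints_sum Ints_mult)

lemma cis_2pi_Ints: "z \<in> \<int> \<Longrightarrow> cis (2 * pi * z) = 1"
  by (rule cis_multiple_2pi)

lemma texp_periodic:
  assumes "c \<noteq> 0" "k \<in> int_lattice" "l \<in> int_lattice"
  shows "texp c k (x + c *\<^sub>R l) = texp c k x"
proof -
  have "texp c k (c *\<^sub>R l) = cis (2 * pi * (k \<bullet> l))"
    unfolding texp_def by (rule arg_cong[of _ _ cis]) (use assms in simp)
  also have "\<dots> = 1" by (intro cis_2pi_Ints inner_int_lattice assms)
  finally show ?thesis by (simp add: texp_add)
qed

text \<open>
  For \<open>k \<noteq> 0\<close> a shift by half a period in a coordinate where \<open>k\<close> does not vanish changes the sign of
  the integrand, but not the integral.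
\<close>

lemma integral_texp_cell:
  fixes k :: "real^'n"
  assumes c: "c > 0" and k: "k \<in> int_lattice"
  shows "(LINT x|lborel. indicator (cell c) x *\<^sub>R texp c k x) = (if k = 0 then of_real (c ^ CARD('n)) else 0)"
proof (cases "k = 0")
  case True
  have "(LINT x|lborel. indicator (cell c :: (real^'n) set) x *\<^sub>R (1::complex)) = measure lborel (cell c :: (real^'n) set) *\<^sub>R 1"
    using emeasure_cell[of c, where 'n='n] c by (subst integral_scaleR_left) auto
  then show ?thesis using True c by (simp add: measure_cell scaleR_conv_of_real)
next
  case False
  then obtain j where j: "k $ j \<noteq> 0" by (auto simp: vec_eq_iff)
  define v :: "real^'n" where "v = axis j (c / (2 * k $ j))"
  have "texp c k v = cis pi" using j c by (simp add: texp_def v_def inner_axis)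
  then have v: "texp c k (x + v) = - texp c k x" for x by (simp add: texp_add)
  have "(LINT x|lborel. indicator (cell c) x *\<^sub>R texp c k (x + v)) = (LINT x|lborel. indicator (cell c) x *\<^sub>R texp c k x)"
    by (rule integral_cell_translate[OF c, where C=1]) (use c k in \<open>auto simp: texp_periodic\<close>)
  then show ?thesis using False by (simp add: v)
qed

inductive trig_poly :: "real \<Rightarrow> (real^'n \<Rightarrow> complex) \<Rightarrow> bool" for c where
  texp: "k \<in> int_lattice \<Longrightarrow> trig_poly c (\<lambda>x. a * texp c k x)"
| add: "trig_poly c f \<Longrightarrow> trig_poly c g \<Longrightarrow> trig_poly c (\<lambda>x. f x + g x)"

lemma trig_poly_const: "trig_poly c (\<lambda>x. a)"
  using trig_poly.texp[OF int_lattice_0, of c a] by simp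

lemma trig_poly_mult_texp:
  assumes "trig_poly c g" "k \<in> int_lattice"
  shows "trig_poly c (\<lambda>x. a * texp c k x * g x)"
  using assms(1)
proof induction
  case (texp l b)
  then have "trig_poly c (\<lambda>x. (a * b) * texp c (k + l) x)"
    using assms(2) by (intro trig_poly.texp int_lattice_add)
  then show ?case by (simp add: texp_add_freq mult_ac)
next
  case (add f g)
  then show ?case using trig_poly.add[OF add.IH] by (simp add: distrib_left)
qed

lemma trig_poly_mult:
  assumes "trig_poly c f" "trig_poly c g"
  shows "trig_poly c (\<lambda>x. f x * g x)"
  using assms(1)
proof induction
  case (texp l b)
  then show ?case using trig_poly_mult_texp[OF assms(2)] by simp
next
  case (add f g)
  then show ?case using trig_poly.add[OF add.IH] by (simp add: distrib_right)
qed

lemma trig_poly_sum: "(\<And>i. i \<in> I \<Longrightarrow> trig_poly c (f i)) \<Longrightarrow> trig_poly c (\<lambda>x. \<Sum>i\<in>I. f i x)"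
  by (induction I rule: infinite_finite_induct) (auto simp: trig_poly_const trig_poly.add)

text \<open>
  The torus as a subset of \<open>complex^'n\<close>. Real polynomials in the coordinates of the image are
  trigonometric polynomials in \<open>x\<close>, and on compact sets they approximate all continuous functions.
\<close>

definition circle_map :: "real \<Rightarrow> real^'n \<Rightarrow> complex^'n" where
  "circle_map c x = (\<chi> j. cis (2 * pi / c * x $ j))"

lemma cis_eq_texp_axis: "cis (2 * pi / c * x $ j) = texp c (axis j 1) x"
  by (simp add: texp_def inner_axis inner_commute)

lemma axis_int_lattice [simp]: "axis j 1 \<in> int_lattice"
  by (simp add: int_lattice_def axis_def)

lemma trig_poly_real_polynomial:
  fixes p :: "complex^'n \<Rightarrow> real"
  assumes "real_polynomial_function p"
  shows "trig_poly c (\<lambda>x. complex_of_real (p (circle_map c x)))"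
  using assms
proof induction
  case (linear f)
  then have lin: "linear f" by (rule bounded_linear.linear)
  have ax: "axis j z = Re z *\<^sub>R axis j 1 + Im z *\<^sub>R axis j \<i>" for j :: 'n and z :: complex
    by (auto simp: axis_def vec_eq_iff complex_eq_iff)
  have f: "f z = (\<Sum>j\<in>UNIV. Re (z $ j) * f (axis j 1) + Im (z $ j) * f (axis j \<i>))" for z
  proof -
    have "z = (\<Sum>j\<in>UNIV. axis j (z $ j))"
      by (simp add: vec_eq_iff axis_def if_distrib[of "\<lambda>f. f $ _"] cong: if_cong)
    then have "f z = (\<Sum>j\<in>UNIV. f (axis j (z $ j)))"
      using linear_sum[OF lin] by metis
    also have "\<dots> = (\<Sum>j\<in>UNIV. Re (z $ j) * f (axis j 1) + Im (z $ j) * f (axis j \<i>))"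
      by (rule sum.cong[OF refl], subst ax) (simp add: linear_add[OF lin] linear_scale[OF lin])
    finally show ?thesis .
  qed
  have eq: "complex_of_real (f (circle_map c x)) = (\<Sum>j\<in>UNIV.
     ((of_real (f (axis j 1)) - \<i> * of_real (f (axis j \<i>))) / 2) * texp c (axis j 1) x
   + ((of_real (f (axis j 1)) + \<i> * of_real (f (axis j \<i>))) / 2) * texp c (- axis j 1) x)" for x
  proof -
    have "complex_of_real (Re z * a + Im z * b)
        = (of_real a - \<i> * of_real b) / 2 * z + (of_real a + \<i> * of_real b) / 2 * cnj z" for z a b
      by (simp add: complex_eq_iff field_simps)
    then show ?thesis
      by (subst f, subst of_real_sum)
         (simp only: circle_map_def vec_lambda_beta cis_eq_texp_axis cnj_texp[symmetric])
  qed
  show ?case unfolding eq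
    by (intro trig_poly_sum trig_poly.add trig_poly.texp int_lattice_minus axis_int_lattice)
next
  case (const a)
  then show ?case by (rule trig_poly_const)
next
  case (add f g)
  then show ?case using trig_poly.add[OF add.IH] by simp
next
  case (mult f g)
  then show ?case using trig_poly_mult[OF mult.IH] by simp
qed

lemma integrable_mult_bounded:
  fixes F g :: "'a::euclidean_space \<Rightarrow> complex"
  assumes "integrable lborel F" "g \<in> borel_measurable borel" "\<And>x. cmod (g x) \<le> C"
  shows "integrable lborel (\<lambda>x. F x * g x)"
proof (rule Bochner_Integration.integrable_bound)
  have [measurable]: "F \<in> borel_measurable borel" "g \<in> borel_measurable borel"
    using assms borel_measurable_integrable[OF assms(1)] by auto
  show "integrable lborel (\<lambda>x. C * cmod (F x))" using assms(1) by auto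
  show "(\<lambda>x. F x * g x) \<in> borel_measurable lborel" by measurable
  show "AE x in lborel. norm (F x * g x) \<le> norm (C * cmod (F x))"
  proof (rule AE_I2)
    fix x
    have "C \<ge> 0" using assms(3)[of x] norm_ge_zero order_trans by blast
    then show "norm (F x * g x) \<le> norm (C * cmod (F x))"
      using mult_left_mono[OF assms(3)[of x], of "cmod (F x)"] by (simp add: norm_mult mult.commute)
  qed
qed

lemma trig_poly_bounded: "trig_poly c f \<Longrightarrow> f \<in> borel_measurable borel \<and> (\<exists>C. \<forall>x. cmod (f x) \<le> C)"
proof (induction rule: trig_poly.induct)
  case (texp k a)
  then show ?case by (auto simp: norm_mult)
next
  case (add f g)
  then show ?case by (auto intro!: exI norm_triangle_mono)
qed

lemma integral_trig_poly_0:
  fixes F :: "real^'n \<Rightarrow> complex"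
  assumes F: "integrable lborel F"
    and 0: "\<And>k. k \<in> int_lattice \<Longrightarrow> (LINT x|lborel. F x * texp c k x) = 0"
    and p: "trig_poly c p"
  shows "(LINT x|lborel. F x * p x) = 0"
  using p
proof induction
  case (texp k a)
  have "(LINT x|lborel. F x * (a * texp c k x)) = a * (LINT x|lborel. F x * texp c k x)"
    by (subst integral_mult_right_zero[symmetric]) (simp add: mult_ac)
  then show ?case using 0[OF texp] by simp
next
  case (add f g)
  have "integrable lborel (\<lambda>x. F x * f x)" "integrable lborel (\<lambda>x. F x * g x)"
    using trig_poly_bounded[OF add.hyps(1)] trig_poly_bounded[OF add.hyps(2)] F
    by (auto intro: integrable_mult_bounded)
  then show ?case using add.IH by (simp add: distrib_left)
qed

lemma circle_map_continuous: "continuous_on S (circle_map c)"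
  unfolding circle_map_def by (intro continuous_intros)

lemma circle_map_measurable [measurable]: "circle_map c \<in> borel_measurable borel"
  by (intro borel_measurable_continuous_onI circle_map_continuous)

lemma integral_circle_continuous_0:
  fixes F :: "real^'n \<Rightarrow> complex" and g :: "complex^'n \<Rightarrow> real"
  assumes F: "integrable lborel F"
    and 0: "\<And>k. k \<in> int_lattice \<Longrightarrow> (LINT x|lborel. F x * texp c k x) = 0"
    and g: "continuous_on UNIV g"
  shows "(LINT x|lborel. F x * complex_of_real (g (circle_map c x))) = 0"
proof -
  \<comment> \<open>A compact ball around the torus.\<close>
  define S :: "(complex^'n) set" where "S = cball 0 (real CARD('n))"
  have S: "circle_map c x \<in> S" for x
  proof -
    have "norm (circle_map c x) \<le> (\<Sum>j\<in>UNIV. norm (circle_map c x $ j))"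
      unfolding norm_vec_def by (rule L2_set_le_sum) simp
    then show ?thesis by (simp add: S_def circle_map_def)
  qed
  have "compact S" by (simp add: S_def)
  have gm[measurable]: "g \<in> borel_measurable borel" using g by (rule borel_measurable_continuous_onI)
  have "compact (g ` S)" using \<open>compact S\<close> g compact_continuous_image continuous_on_subset by blast
  then obtain G where G: "\<And>z. z \<in> S \<Longrightarrow> \<bar>g z\<bar> \<le> G"
    by (metis bounded_iff compact_imp_bounded image_eqI real_norm_def)
  define M where "M = (LINT x|lborel. cmod (F x))"
  have M: "M \<ge> 0" by (simp add: M_def)
  have ig: "integrable lborel (\<lambda>x. F x * complex_of_real (g (circle_map c x)))"
    by (rule integrable_mult_bounded[OF F, where C=G]) (use G S in auto)
  have "cmod (LINT x|lborel. F x * complex_of_real (g (circle_map c x))) \<le> e * M" if e: "e > 0" for e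
  proof -
    obtain p where p: "real_polynomial_function p" "\<And>z. z \<in> S \<Longrightarrow> \<bar>g z - p z\<bar> < e"
      using Stone_Weierstrass_real_polynomial_function[OF \<open>compact S\<close> continuous_on_subset[OF g subset_UNIV] e] by blast
    have tp: "trig_poly c (\<lambda>x. complex_of_real (p (circle_map c x)))"
      by (rule trig_poly_real_polynomial) fact
    have ip: "integrable lborel (\<lambda>x. F x * complex_of_real (p (circle_map c x)))"
      using trig_poly_bounded[OF tp] F integrable_mult_bounded by blast
    have "(LINT x|lborel. F x * complex_of_real (g (circle_map c x)))
        = (LINT x|lborel. F x * complex_of_real (g (circle_map c x)) - F x * complex_of_real (p (circle_map c x)))"
      using integral_trig_poly_0[OF F 0 tp] ig ip by (subst Bochner_Integration.integral_diff) auto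
    also have "cmod \<dots> \<le> (LINT x|lborel. e * cmod (F x))"
    proof (rule Bochner_Integration.integral_norm_bound_integral)
      fix x
      have "norm (F x * complex_of_real (g (circle_map c x)) - F x * complex_of_real (p (circle_map c x)))
         = cmod (F x) * \<bar>g (circle_map c x) - p (circle_map c x)\<bar>"
        unfolding right_diff_distrib[symmetric] of_real_diff[symmetric] norm_mult norm_of_real by simp
      also have "\<dots> \<le> cmod (F x) * e" using p(2)[OF S, of x] by (intro mult_left_mono) auto
      finally show "norm (F x * complex_of_real (g (circle_map c x)) - F x * complex_of_real (p (circle_map c x))) \<le> e * cmod (F x)"
        by (simp add: mult.commute)
    qed (use ig ip F in auto)
    finally show ?thesis by (simp add: M_def)
  qed
  note le = this
  define a where "a = cmod (LINT x|lborel. F x * complex_of_real (g (circle_map c x)))"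
  have "a = 0"
  proof (rule ccontr)
    assume "a \<noteq> 0"
    then have a: "a > 0" by (simp add: a_def)
    have "a \<le> a / (M + 1) * M" using le[of "a / (M + 1)"] a M by (simp add: a_def)
    also have "\<dots> < a" using a M by (simp add: field_simps)
    finally show False by simp
  qed
  then show ?thesis by (simp add: a_def)
qed

text \<open>
  Only boundary points of the closed cell are identified with one another by the map to the torus.
\<close>

lemma circle_map_inj:
  assumes c: "c > 0" and x: "x \<in> box (\<chi> i. - c / 2) (\<chi> i. c / 2)"
    and y: "y \<in> cbox (\<chi> i. - c / 2) (\<chi> i. c / 2)" and eq: "circle_map c x = circle_map c y"
  shows "x = y"
proof -
  have "x $ j = y $ j" for j
  proof -
    have "cis (2 * pi / c * x $ j) = cis (2 * pi / c * y $ j)"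
      using eq by (simp add: circle_map_def vec_eq_iff)
    then have "sin (2 * pi / c * x $ j) = sin (2 * pi / c * y $ j) \<and> cos (2 * pi / c * x $ j) = cos (2 * pi / c * y $ j)"
      by (simp add: complex_eq_iff)
    then obtain m :: int where "2 * pi / c * x $ j = 2 * pi / c * y $ j + 2 * pi * of_int m"
      using sin_cos_eq_iff by auto
    then have "2 * pi * (x $ j) = 2 * pi * (y $ j + c * of_int m)"
      using c by (simp add: field_simps)
    then have m: "x $ j = y $ j + c * of_int m" by (simp only: mult_cancel_left) simp
    moreover have "\<bar>x $ j - y $ j\<bar> < c"
    proof -
      have "- c / 2 < x $ j" "x $ j < c / 2" "- c / 2 \<le> y $ j" "y $ j \<le> c / 2"
        using x y by (auto simp: mem_box_cart)
      then show ?thesis unfolding abs_less_iff by (intro conjI) linarith+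
    qed
    ultimately have "c * \<bar>of_int m\<bar> < c" using c by (simp add: abs_mult)
    then have "\<bar>of_int m :: real\<bar> < 1" using c by simp
    then have "m = 0" by linarith
    then show ?thesis using m by simp
  qed
  then show ?thesis by (simp add: vec_eq_iff)
qed

text \<open>
  The sets over which \<open>F\<close> has integral \<open>0\<close> form a Dynkin system, so they include all Borel sets, in
  particular those where \<open>F\<close> is positive or negative.
\<close>

lemma AE_0_if_open_integrals_0:
  fixes F :: "'a::euclidean_space \<Rightarrow> real"
  assumes F: "integrable lborel F" and 0: "\<And>U. open U \<Longrightarrow> (LINT x|lborel. indicator U x * F x) = 0"
  shows "AE x in lborel. F x = 0"
proof -
  have [measurable]: "F \<in> borel_measurable borel" using borel_measurable_integrable[OF F] by simp
  have int: "integrable lborel (\<lambda>x. indicator A x * F x)" if "A \<in> sets borel" for A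
    using integrable_mult_indicator[OF _ F, of A] that by simp
  have all: "(LINT x|lborel. indicator A x * F x) = 0" if "A \<in> sets borel" for A
  proof -
    have "A \<in> sigma_sets UNIV (Collect open)" using that by (simp add: borel_def)
    have st: "Int_stable (Collect open :: 'a set set)" by (auto simp: Int_stable_def)
    have sub: "Collect open \<subseteq> Pow (UNIV :: 'a set)" by simp
    from st sub \<open>A \<in> sigma_sets UNIV (Collect open)\<close> show ?thesis
    proof (induction rule: sigma_sets_induct_disjoint)
      case (basic A)
      then show ?case by (auto intro: 0)
    next
      case empty
      then show ?case by simp
    next
      case (compl A)
      have A: "A \<in> sets borel" using compl(1) by (simp add: borel_def)
      have "(LINT x|lborel. indicator (UNIV - A) x * F x) = (LINT x|lborel. F x - indicator A x * F x)"
        by (intro Bochner_Integration.integral_cong) (auto simp: indicator_def)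
      also have "\<dots> = (LINT x|lborel. F x) - (LINT x|lborel. indicator A x * F x)"
        using F int[OF A] by (rule Bochner_Integration.integral_diff)
      finally show ?case using compl(2) 0[of UNIV] by simp
    next
      case (union A)
      have A: "range A \<subseteq> sets borel" using union(2) by (auto simp: borel_def)
      have "set_integrable lborel (\<Union>i. A i) F"
        unfolding set_integrable_def using int[of "\<Union>i. A i"] A by auto
      then have "set_lebesgue_integral lborel (\<Union>i. A i) F = (\<Sum>i. set_lebesgue_integral lborel (A i) F)"
        using A union(1) by (intro lebesgue_integral_countable_add) (auto simp: disjoint_family_on_def)
      moreover have "set_lebesgue_integral lborel (A i) F = 0" for i
        using union(3)[of i] by (simp add: set_lebesgue_integral_def)
      ultimately have "set_lebesgue_integral lborel (\<Union>i. A i) F = 0"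
        by simp
      then show ?case by (simp add: set_lebesgue_integral_def)
    qed
  qed
  have "AE x in lborel. indicator {x. F x > 0} x * F x = 0"
  proof (subst integral_nonneg_eq_0_iff_AE[symmetric])
    show "integrable lborel (\<lambda>x. indicator {x. F x > 0} x * F x)"
      using int[of "{x. F x > 0}"] by simp
    show "AE x in lborel. 0 \<le> indicator {x. F x > 0} x * F x" by (auto simp: indicator_def)
    show "(LINT x|lborel. indicator {x. F x > 0} x * F x) = 0"
      using all[of "{x. F x > 0}"] by simp
  qed
  moreover have "AE x in lborel. indicator {x. F x < 0} x * - F x = 0"
  proof (subst integral_nonneg_eq_0_iff_AE[symmetric])
    show "integrable lborel (\<lambda>x. indicator {x. F x < 0} x * - F x)"
      using int[of "{x. F x < 0}"] by simp
    show "AE x in lborel. 0 \<le> indicator {x. F x < 0} x * - F x" by (auto simp: indicator_def)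
    show "(LINT x|lborel. indicator {x. F x < 0} x * - F x) = 0"
      using all[of "{x. F x < 0}"] by simp
  qed
  ultimately show ?thesis
  proof eventually_elim
    case (elim x)
    then show ?case by (auto simp: indicator_def split: if_splits) 
  qed
qed

text \<open>
  A function orthogonal to all exponentials is orthogonal to all continuous functions on the torus.
  The indicator of an open subset \<open>W\<close> of the interior of the cell is a bounded pointwise limit of
  such functions on the cell: with \<open>C\<close> the compact image of the rest of the closed cell, take
  \<open>min 1 (m * infdist z C)\<close>. Points of \<open>W\<close> have a positive distance from \<open>C\<close> although opposite faces of
  the cell are glued, since interior points are not glued to anything.
\<close>

lemma texp_complete:
  fixes F :: "real^'n \<Rightarrow> complex"
  assumes c: "c > 0" and F: "integrable lborel F" and supp: "\<And>x. x \<notin> cell c \<Longrightarrow> F x = 0"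
    and 0: "\<And>k. k \<in> int_lattice \<Longrightarrow> (LINT x|lborel. F x * texp c k x) = 0"
  shows "AE x in lborel. F x = 0"
proof -
  have [measurable]: "F \<in> borel_measurable borel" using borel_measurable_integrable[OF F] by simp
  let ?B = "box (\<chi> i. - c / 2) (\<chi> i. c / 2) :: (real^'n) set"
  let ?Q = "cbox (\<chi> i. - c / 2) (\<chi> i. c / 2) :: (real^'n) set"
  have open_0: "(LINT x|lborel. indicator U x *\<^sub>R F x) = 0" if U: "open U" for U
  proof -
    define W where "W = U \<inter> ?B"
    have W: "open W" "W \<subseteq> ?B" using U by (auto simp: W_def)
    define C where "C = circle_map c ` (?Q - W)"
    have "compact (?Q - W)" using W by (intro compact_diff) auto
    then have C: "closed C" unfolding C_def
      by (intro compact_imp_closed compact_continuous_image circle_map_continuous)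
    \<comment> \<open>A corner of the closed cell; the distance to an empty set would be 0.\<close>
    have "(\<chi> i. c / 2) \<in> ?Q" "(\<chi> i. c / 2) \<notin> ?B" using c by (auto simp: mem_box_cart)
    then have Cne: "C \<noteq> {}" using W(2) by (auto simp: C_def)
    define g where "g m z = min 1 (real m * infdist z C)" for m z
    have gc: "continuous_on UNIV (g m)" for m
      unfolding g_def by (intro continuous_intros)
    have g01: "0 \<le> g m z" "g m z \<le> 1" for m z by (auto simp: g_def infdist_nonneg)
    have [measurable]: "g m \<in> borel_measurable borel" for m by (rule borel_measurable_continuous_onI[OF gc])
    have "(\<lambda>m. LINT x|lborel. F x * complex_of_real (g m (circle_map c x))) \<longlonglongrightarrow> (LINT x|lborel. indicator W x *\<^sub>R F x)"
    proof (rule integral_dominated_convergence[where w="\<lambda>x. cmod (F x)"])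
      show "AE x in lborel. (\<lambda>m. F x * complex_of_real (g m (circle_map c x))) \<longlonglongrightarrow> indicator W x *\<^sub>R F x"
      proof (rule AE_I2)
        fix x
        show "(\<lambda>m. F x * complex_of_real (g m (circle_map c x))) \<longlonglongrightarrow> indicator W x *\<^sub>R F x"
        proof (cases "x \<in> W")
          case True
          have "circle_map c x \<notin> C"
          proof
            assume "circle_map c x \<in> C"
            then obtain y where y: "y \<in> ?Q - W" "circle_map c x = circle_map c y" by (auto simp: C_def)
            then have "x = y" using circle_map_inj[OF c] True W(2) by blast
            then show False using y True by simp
          qed
          then have pos: "infdist (circle_map c x) C > 0"
            using in_closed_iff_infdist_zero[OF C Cne] infdist_nonneg by (metis less_eq_real_def)
          have "eventually (\<lambda>m. real m * infdist (circle_map c x) C > 1) sequentially"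
            using pos by real_asymp
          then have "eventually (\<lambda>m. g m (circle_map c x) = 1) sequentially"
            by eventually_elim (auto simp: g_def)
          then have "(\<lambda>m. g m (circle_map c x)) \<longlonglongrightarrow> 1" by (rule tendsto_eventually)
          then have "(\<lambda>m. F x * complex_of_real (g m (circle_map c x))) \<longlonglongrightarrow> F x * complex_of_real 1"
            by (intro tendsto_intros)
          then show ?thesis using True by simp
        next
          case False
          have "F x * complex_of_real (g m (circle_map c x)) = 0" for m
          proof (cases "x \<in> cell c")
            case True
            then have "circle_map c x \<in> C" using False cell_subset_cbox[of c] by (auto simp: C_def)
            then show ?thesis by (simp add: g_def infdist_zero)
          qed (simp add: supp)
          then have "(\<lambda>m. F x * complex_of_real (g m (circle_map c x))) = (\<lambda>m. 0)" by blast
          then show ?thesis using False by simp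
        qed
      qed
      show "AE x in lborel. norm (F x * complex_of_real (g m (circle_map c x))) \<le> cmod (F x)" for m
        using g01 by (intro AE_I2) (simp add: norm_mult mult_left_le)
    qed (use F W in \<open>auto\<close>)
    moreover have "(LINT x|lborel. F x * complex_of_real (g m (circle_map c x))) = 0" for m
      by (rule integral_circle_continuous_0[OF F 0 gc])
    ultimately have "(LINT x|lborel. indicator W x *\<^sub>R F x) = 0" by (simp add: LIMSEQ_const_iff)
    moreover have "(LINT x|lborel. indicator W x *\<^sub>R F x) = (LINT x|lborel. indicator U x *\<^sub>R F x)"
    proof (rule integral_cong_AE)
      show "AE x in lborel. indicator W x *\<^sub>R F x = indicator U x *\<^sub>R F x"
        using cell_AE_box[of c, where 'n='n]
      proof eventually_elim
        case (elim x)
        then show ?case using supp[of x] by (auto simp: W_def indicator_def)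
      qed
    qed (use W U in auto)
    ultimately show ?thesis by simp
  qed
  have "AE x in lborel. Re (F x) = 0"
  proof (rule AE_0_if_open_integrals_0)
    fix U :: "(real^'n) set" assume U: "open U"
    have "integrable lborel (\<lambda>x. indicator U x *\<^sub>R F x)"
      using integrable_mult_indicator[OF _ F, of U] U by simp
    from integral_Re[OF this] show "(LINT x|lborel. indicator U x * Re (F x)) = 0"
      using open_0[OF U] by simp
  qed (use F in auto)
  moreover have "AE x in lborel. Im (F x) = 0"
  proof (rule AE_0_if_open_integrals_0)
    fix U :: "(real^'n) set" assume U: "open U"
    have "integrable lborel (\<lambda>x. indicator U x *\<^sub>R F x)"
      using integrable_mult_indicator[OF _ F, of U] U by simp
    from integral_Im[OF this] show "(LINT x|lborel. indicator U x * Im (F x)) = 0"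
      using open_0[OF U] by simp
  qed (use F in auto)
  ultimately show ?thesis by eventually_elim (simp add: complex_eq_iff)
qed

lemma square_integrable_indicator_bounded:
  assumes "A \<in> sets borel" "emeasure lborel A < \<infinity>" "g \<in> borel_measurable borel" "\<And>x. cmod (g x) \<le> C"
  shows "square_integrable (\<lambda>x. indicator A x *\<^sub>R g x)"
proof (rule square_integrableI)
  show "(\<lambda>x. indicator A x *\<^sub>R g x) \<in> borel_measurable borel" using assms by measurable
  have "(\<integral>\<^sup>+x. ennreal ((cmod (indicator A x *\<^sub>R g x))\<^sup>2) \<partial>lborel) \<le> (\<integral>\<^sup>+x. ennreal (C\<^sup>2) * indicator A x \<partial>lborel)"
    using assms(4) by (intro nn_integral_mono) (auto simp: indicator_def intro!: power_mono)
  also have "\<dots> < \<infinity>" using assms by (simp add: nn_integral_cmult_indicator ennreal_mult_less_top)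
  finally show "(\<integral>\<^sup>+x. ennreal ((cmod (indicator A x *\<^sub>R g x))\<^sup>2) \<partial>lborel) < \<infinity>" .
qed

lemma emeasure_cell_finite: "emeasure lborel (cell c :: (real^'n) set) < \<infinity>"
proof (cases "c \<ge> 0")
  case False
  then have "cell c = ({} :: (real^'n) set)"
  proof (intro equals0I)
    fix x :: "real^'n" assume "x \<in> cell c"
    then have "- c / 2 \<le> x $ undefined" "x $ undefined < c / 2" by (auto simp: cell_def)
    then show False using False by linarith
  qed
  then show ?thesis by simp
qed (simp add: emeasure_cell)

lemma texp_complete_cell:
  fixes g :: "real^'n \<Rightarrow> complex"
  assumes c: "c > 0" and g: "square_integrable g"
    and 0: "\<And>k. k \<in> int_lattice \<Longrightarrow> (LINT x|lborel. g x * cnj (indicator (cell c) x *\<^sub>R texp c k x)) = 0"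
  shows "AE x in lborel. x \<in> cell c \<longrightarrow> g x = 0"
proof -
  let ?F = "\<lambda>x. g x * cnj (indicator (cell c) x *\<^sub>R 1)"
  have "AE x in lborel. ?F x = 0"
  proof (rule texp_complete[OF c])
    show "integrable lborel ?F"
      by (intro square_integrable_mult_integrable g square_integrable_indicator_bounded[where C=1])
         (auto simp: emeasure_cell_finite[simplified])
    fix k :: "real^'n" assume k: "k \<in> int_lattice"
    have "cnj (texp c (- k) x) = texp c k x" for x by (simp add: cnj_texp)
    then show "(LINT x|lborel. ?F x * texp c k x) = 0"
      using 0[OF int_lattice_minus[OF k]] by (simp add: mult_ac scaleR_conv_of_real)
  qed (simp add: indicator_def)
  then show ?thesis by eventually_elim auto
qed

lemma tendsto_scale_l2:
  fixes x :: "'a::euclidean_space l2"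
  assumes "(X \<longlongrightarrow> x) F"
  shows "((\<lambda>n. scale_l2 c (X n)) \<longlongrightarrow> scale_l2 c x) F"
proof -
  have "((\<lambda>n. cmod c * norm (X n - x)) \<longlongrightarrow> cmod c * 0) F"
    by (intro tendsto_intros) (use assms in \<open>simp add: LIM_zero tendsto_norm_zero\<close>)
  then have "((\<lambda>n. norm (scale_l2 c (X n) - scale_l2 c x)) \<longlongrightarrow> 0) F"
    unfolding l2.scale_right_diff_distrib[symmetric] norm_scale_l2 by simp
  then show ?thesis by (rule LIM_zero_cancel[OF tendsto_norm_zero_cancel])
qed

lemma closed_subspace_closure_span: "closed_subspace (closure (l2.span S))"
proof -
  have "l2.subspace (closure (l2.span S))"
    unfolding l2.subspace_def
  proof (intro conjI ballI allI)
    show "0 \<in> closure (l2.span S)" using closure_subset l2.span_zero by blast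
  next
    fix x y assume "x \<in> closure (l2.span S)" "y \<in> closure (l2.span S)"
    then obtain X Y where "\<And>n. X n \<in> l2.span S" "X \<longlonglongrightarrow> x" "\<And>n. Y n \<in> l2.span S" "Y \<longlonglongrightarrow> y"
      unfolding closure_sequential by blast
    then show "x + y \<in> closure (l2.span S)" unfolding closure_sequential
      by (intro exI[of _ "\<lambda>n. X n + Y n"]) (auto intro: l2.span_add tendsto_add)
  next
    fix c x assume "x \<in> closure (l2.span S)"
    then obtain X where "\<And>n. X n \<in> l2.span S" "X \<longlonglongrightarrow> x" unfolding closure_sequential by blast
    then show "scale_l2 c x \<in> closure (l2.span S)" unfolding closure_sequential
      by (intro exI[of _ "\<lambda>n. scale_l2 c (X n)"]) (auto intro: l2.span_scale tendsto_scale_l2)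
  qed
  then show ?thesis by (simp add: closed_subspace_def)
qed

lemma norm_minus_orthonormal_sum:
  assumes J: "finite J" and on: "\<And>i j. i \<in> J \<Longrightarrow> j \<in> J \<Longrightarrow> cinner (b i) (b j) = (if i = j then 1 else 0)"
  shows "(norm (f - (\<Sum>i\<in>J. scale_l2 (a i) (b i))))\<^sup>2
    = (norm f)\<^sup>2 - (\<Sum>i\<in>J. (cmod (cinner f (b i)))\<^sup>2) + (\<Sum>i\<in>J. (cmod (cinner f (b i) - a i))\<^sup>2)"
proof -
  define s where "s = (\<Sum>i\<in>J. scale_l2 (a i) (b i))"
  define d where "d i = cinner f (b i)" for i
  have fs: "cinner f s = (\<Sum>i\<in>J. cnj (a i) * d i)"
    by (simp add: s_def cinner_sum_right cinner_scale_right d_def)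
  have sf: "cinner s f = (\<Sum>i\<in>J. a i * cnj (d i))"
    by (subst cinner_commute) (simp add: fs)
  have "cinner s s = (\<Sum>i\<in>J. \<Sum>j\<in>J. a i * (cnj (a j) * cinner (b i) (b j)))"
    by (simp add: s_def cinner_sum_right cinner_sum_left cinner_scale_right cinner_scale_left sum_distrib_left)
       (subst sum.swap, simp add: mult_ac)
  also have "\<dots> = (\<Sum>i\<in>J. \<Sum>j\<in>J. if i = j then a i * cnj (a j) else 0)"
    by (intro sum.cong refl) (simp add: on)
  also have "\<dots> = (\<Sum>i\<in>J. a i * cnj (a i))" using J by (simp cong: sum.cong)
  finally have ss: "cinner s s = (\<Sum>i\<in>J. a i * cnj (a i))" .
  have "cinner (f - s) (f - s) = cinner f f - cinner f s - cinner s f + cinner s s"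
    by (simp add: cinner_minus_left cinner_minus_right)
  then have "complex_of_real ((norm (f - s))\<^sup>2) = cinner f f - cinner f s - cinner s f + cinner s s"
    by (simp only: cinner_self)
  also have "\<dots> = complex_of_real ((norm f)\<^sup>2) - (\<Sum>i\<in>J. d i * cnj (d i)) + (\<Sum>i\<in>J. (d i - a i) * cnj (d i - a i))"
    unfolding fs sf ss unfolding cinner_self
    by (simp add: algebra_simps sum.distrib sum_subtractf)
  also have "\<dots> = complex_of_real ((norm f)\<^sup>2 - (\<Sum>i\<in>J. (cmod (d i))\<^sup>2) + (\<Sum>i\<in>J. (cmod (d i - a i))\<^sup>2))"
    unfolding complex_norm_square[symmetric] by simp
  finally show ?thesis unfolding s_def d_def of_real_eq_iff .
qed

text \<open>
  The squared distance of \<open>f\<close> from a finite combination of the orthonormal vectors is smallest for the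
  Fourier coefficients, and is then \<open>\<parallel>f\<parallel>\<^sup>2\<close> minus the partial sum of their squares. Nonnegativity bounds
  the sums from above; density of the span makes the bound sharp.
\<close>

lemma parseval_orthonormal:
  fixes b :: "'i \<Rightarrow> 'a::euclidean_space l2"
  assumes on: "\<And>i j. i \<in> I \<Longrightarrow> j \<in> I \<Longrightarrow> cinner (b i) (b j) = (if i = j then 1 else 0)"
    and f: "f \<in> closure (l2.span (b ` I))"
  shows "((\<lambda>i. (cmod (cinner f (b i)))\<^sup>2) has_sum (norm f)\<^sup>2) I"
proof -
  let ?g = "\<lambda>i. (cmod (cinner f (b i)))\<^sup>2"
  have bessel: "sum ?g J \<le> (norm f)\<^sup>2" if "finite J" "J \<subseteq> I" for J
    using norm_minus_orthonormal_sum[OF that(1), of b f "\<lambda>i. cinner f (b i)"] on that(2)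
    by (simp add: subset_iff) (metis (no_types, lifting) diff_ge_0_iff_ge zero_le_power2)
  have bdd: "bdd_above (sum ?g ` {F. F \<subseteq> I \<and> finite F})"
    using bessel by (intro bdd_aboveI[of _ "(norm f)\<^sup>2"]) auto
  have "(norm f)\<^sup>2 \<le> (SUP F\<in>{F. F \<subseteq> I \<and> finite F}. sum ?g F) + e" if e: "e > 0" for e
  proof -
    obtain q where q: "q \<in> l2.span (b ` I)" "dist q f < sqrt e"
      using f e unfolding closure_approachable by (meson real_sqrt_gt_0_iff)
    obtain t r where t: "finite t" "t \<subseteq> b ` I" "q = (\<Sum>a\<in>t. scale_l2 (r a) a)"
      using q(1) unfolding l2.span_explicit by blast
    obtain J where J: "J \<subseteq> I" "finite J" "t = b ` J"
      using finite_subset_image[OF t(1,2)] by blast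
    have "inj_on b J"
    proof (rule inj_onI)
      fix i j assume "i \<in> J" "j \<in> J" "b i = b j"
      then have "cinner (b i) (b j) = 1" using on[of i i] J(1) by auto
      then show "i = j" using on[of i j] subsetD[OF J(1) \<open>i \<in> J\<close>] subsetD[OF J(1) \<open>j \<in> J\<close>]
        by (metis zero_neq_one)
    qed
    then have q': "q = (\<Sum>i\<in>J. scale_l2 (r (b i)) (b i))"
      unfolding t(3) J(3) by (rule sum.reindex[unfolded o_def])
    have "(norm (f - q))\<^sup>2 \<ge> (norm f)\<^sup>2 - sum ?g J"
    proof -
      have onJ: "cinner (b i) (b j) = (if i = j then 1 else 0)" if "i \<in> J" "j \<in> J" for i j
        using J(1) that by (intro on) auto
      show ?thesis unfolding q'
        by (subst norm_minus_orthonormal_sum[OF J(2) onJ]) (auto intro: sum_nonneg)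
    qed
    moreover have "(norm (f - q))\<^sup>2 \<le> e"
      using q(2) e power_mono[of "norm (f - q)" "sqrt e" 2] by (simp add: dist_norm norm_minus_commute)
    moreover have "sum ?g J \<le> (SUP F\<in>{F. F \<subseteq> I \<and> finite F}. sum ?g F)"
      by (rule cSUP_upper[OF _ bdd]) (use J in auto)
    ultimately show ?thesis by linarith
  qed
  then have "(norm f)\<^sup>2 \<le> (SUP F\<in>{F. F \<subseteq> I \<and> finite F}. sum ?g F)" by (rule field_le_epsilon)
  moreover have "(SUP F\<in>{F. F \<subseteq> I \<and> finite F}. sum ?g F) \<le> (norm f)\<^sup>2"
    by (rule cSUP_least) (use bessel in auto)
  ultimately have "(SUP F\<in>{F. F \<subseteq> I \<and> finite F}. sum ?g F) = (norm f)\<^sup>2" by simp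
  then show ?thesis
    using nonneg_bdd_above_has_sum[of I ?g] bdd by (simp add: conj_commute)
qed

text \<open>
  The difference of \<open>f\<close> and its projection onto the closed span of the exponentials is orthogonal to
  them, so it vanishes on the cell by completeness; it is orthogonal to the projection and, having
  disjoint support, to \<open>f\<close>. Hence it is \<open>0\<close> and the abstract Parseval identity applies.
\<close>

lemma parseval_cell:
  fixes f :: "(real^'n) l2"
  assumes c: "c > 0" and supp: "AE x in lborel. x \<notin> cell c \<longrightarrow> rep_l2 f x = 0"
  shows "((\<lambda>k. (cmod (LINT x|lborel. rep_l2 f x * cnj (texp c k x)))\<^sup>2) has_sum (c ^ CARD('n) * (norm f)\<^sup>2)) int_lattice"
proof -
  define a where "a = 1 / sqrt (c ^ CARD('n))"
  have a: "a > 0" "a\<^sup>2 = 1 / c ^ CARD('n)" using c by (auto simp: a_def power_divide)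
  define u where "u k = (\<lambda>x. indicator (cell c) x *\<^sub>R texp c k x)" for k :: "real^'n"
  have um [measurable]: "u k \<in> borel_measurable borel" for k unfolding u_def by measurable
  have usq: "square_integrable (u k)" for k
    unfolding u_def by (rule square_integrable_indicator_bounded[where C=1]) (auto simp: emeasure_cell_finite[simplified])
  define b where "b k = scale_l2 (of_real a) (abs_l2 (u k))" for k
  have cb: "cinner h (abs_l2 (u k)) = (LINT x|lborel. rep_l2 h x * cnj (u k x))" for h k
    by (rule cinner_eqI) (auto intro: rep_abs_l2 usq)
  have on: "cinner (b k) (b l) = (if k = l then 1 else 0)" if "k \<in> int_lattice" "l \<in> int_lattice" for k l
  proof -
    have "cinner (abs_l2 (u k)) (abs_l2 (u l)) = (LINT x|lborel. u k x * cnj (u l x))"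
      by (rule cinner_eqI) (auto intro: rep_abs_l2 usq)
    also have "\<dots> = (LINT x|lborel. indicator (cell c) x *\<^sub>R texp c (k - l) x)"
      by (intro Bochner_Integration.integral_cong refl)
         (auto simp: u_def indicator_def cnj_texp texp_add_freq[symmetric])
    also have "\<dots> = (if k = l then of_real (c ^ CARD('n)) else 0)"
      using integral_texp_cell[OF c int_lattice_diff[OF that]] by simp
    finally have "cinner (b k) (b l) = of_real (a\<^sup>2) * (if k = l then of_real (c ^ CARD('n)) else 0)"
      by (simp add: b_def cinner_scale_left cinner_scale_right power2_eq_square)
    then show ?thesis using c by (simp add: a(2) of_real_mult[symmetric] del: of_real_power of_real_divide of_real_mult)
  qed
  let ?V = "closure (l2.span (b ` int_lattice))"
  obtain p where p: "p \<in> ?V" "\<And>v. v \<in> ?V \<Longrightarrow> cinner (f - p) v = 0"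
    using closed_subspace_projection[OF closed_subspace_closure_span] by blast
  define r where "r = f - p"
  have bV: "b k \<in> ?V" if "k \<in> int_lattice" for k
    by (rule subsetD[OF closure_subset], rule l2.span_base) (use that in simp)
  have "AE x in lborel. x \<in> cell c \<longrightarrow> rep_l2 r x = 0"
  proof (rule texp_complete_cell[OF c])
    fix k :: "real^'n" assume "k \<in> int_lattice"
    from p(2)[OF bV[OF this]] have "cinner r (abs_l2 (u k)) = 0"
      using a by (simp add: r_def b_def cinner_scale_right)
    then show "(LINT x|lborel. rep_l2 r x * cnj (indicator (cell c) x *\<^sub>R texp c k x)) = 0"
      unfolding cb by (simp add: u_def)
  qed simp
  then have "AE x in lborel. rep_l2 r x * cnj (rep_l2 f x) = 0"
    using supp by eventually_elim auto
  then have "cinner r f = 0"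
    unfolding cinner_rep by (subst integral_cong_AE[where g="\<lambda>x. 0"]) auto
  moreover have "cinner r p = 0" using p by (simp add: r_def)
  ultimately have "cinner r r = 0" by (simp add: r_def cinner_minus_right)
  then have "f = p" by (simp add: cinner_self r_def)
  then have "f \<in> ?V" using p by simp
  from parseval_orthonormal[OF on this]
  have s: "((\<lambda>k. (cmod (cinner f (b k)))\<^sup>2) has_sum (norm f)\<^sup>2) int_lattice" .
  have "cinner f (b k) = of_real a * (LINT x|lborel. rep_l2 f x * cnj (texp c k x))" for k
  proof -
    have "cinner f (abs_l2 (u k)) = (LINT x|lborel. rep_l2 f x * cnj (texp c k x))"
      unfolding cb using supp by (intro integral_cong_AE) (auto simp: u_def indicator_def)
    then show ?thesis by (simp add: b_def cinner_scale_right)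
  qed
  then have "(cmod (LINT x|lborel. rep_l2 f x * cnj (texp c k x)))\<^sup>2 = c ^ CARD('n) * (cmod (cinner f (b k)))\<^sup>2" for k
    using a c by (simp add: norm_mult power_mult_distrib)
  then show ?thesis using has_sum_cmult_right[OF s, of "c ^ CARD('n)"] by simp
qed

text \<open>
  Exponentials cut off to the cells of a tiling. This form of separability shows below that frame
  generators are countable.
\<close>

lemma exists_countable_total:
  "\<exists>D :: (real^'n) l2 set. countable D \<and> (\<forall>f. (\<forall>d\<in>D. cinner f d = 0) \<longrightarrow> f = 0)"
proof -
  define u where "u k = (\<lambda>x. indicator (cell 1) x *\<^sub>R texp 1 k x)" for k :: "real^'n"
  have [measurable]: "u k \<in> borel_measurable borel" for k unfolding u_def by measurable
  have usq: "square_integrable (u k)" for k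
    unfolding u_def by (rule square_integrable_indicator_bounded[where C=1]) (auto simp: emeasure_cell_finite[simplified])
  let ?D = "(\<lambda>(l, k). translate l (abs_l2 (u k))) ` (int_lattice \<times> int_lattice)"
  have "f = 0" if f: "\<forall>d\<in>?D. cinner f d = 0" for f
  proof -
    have "AE x in lborel. x - l \<in> cell 1 \<longrightarrow> rep_l2 f x = 0" if l: "l \<in> int_lattice" for l
    proof -
      have "AE x in lborel. x \<in> cell 1 \<longrightarrow> rep_l2 f (x + l) = 0"
      proof (rule texp_complete_cell)
        show "square_integrable (\<lambda>x. rep_l2 f (x + l))"
          using square_integrable_translate[OF square_integrable_rep, of f "- l"] by simp
        fix k :: "real^'n" assume k: "k \<in> int_lattice"
        have "AE x in lborel. rep_l2 (translate l (abs_l2 (u k))) x = u k (x - l)"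
          using rep_translate[of l "abs_l2 (u k)"] AE_translate[OF rep_abs_l2[OF usq[of k]], of "- l"]
          by eventually_elim simp
        then have "cinner f (translate l (abs_l2 (u k))) = (LINT x|lborel. rep_l2 f x * cnj (u k (x - l)))"
          by (intro cinner_eqI) auto
        also have "\<dots> = (LINT x|lborel. rep_l2 f (x + l) * cnj (u k x))"
          using integral_translate[of "\<lambda>x. rep_l2 f x * cnj (u k (x - l))" l] by simp
        finally show "(LINT x|lborel. rep_l2 f (x + l) * cnj (indicator (cell 1) x *\<^sub>R texp 1 k x)) = 0"
          using f l k by (force simp: u_def)
      qed simp
      from AE_translate[OF this, of "- l"] show ?thesis by simp
    qed
    then have "AE x in lborel. \<forall>l\<in>int_lattice. x - l \<in> cell 1 \<longrightarrow> rep_l2 f x = 0"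
      by (subst AE_ball_countable) simp_all
    then have "AE x in lborel. rep_l2 f x = 0"
    proof eventually_elim
      case (elim x)
      then show ?case using cell_exists[of 1 x] by auto
    qed
    then show "f = 0" using rep_zero by (intro l2_eqI) auto
  qed
  then show ?thesis by (intro exI[of _ ?D]) auto
qed

section \<open>Linear substitutions\<close>

lemma matrix_inv_inverse:
  assumes "invertible (A :: real^'n^'n)"
  shows matrix_inv_right: "A ** matrix_inv A = mat 1" and matrix_inv_left: "matrix_inv A ** A = mat 1"
  using someI_ex[OF assms[unfolded invertible_def]] unfolding matrix_inv_def by auto

lemma matrix_vector_measurable [measurable]: "(*v) (M :: real^'n^'m) \<in> borel_measurable borel"
  by (intro borel_measurable_continuous_onI matrix_vector_mult_linear_continuous_on)

text \<open>
  Uniqueness of translation-invariant measures. For a cell \<open>F\<close> of volume \<open>1\<close>, the integral of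
  \<open>indicator F y * indicator E (M *v x + y)\<close> over \<open>x\<close> and \<open>y\<close> is the image measure of \<open>E\<close> when evaluated
  with the inner integral over \<open>x\<close>, and a constant times the Lebesgue measure of \<open>E\<close> when evaluated in
  the other order. The constant is the volume of a preimage of a cell, hence finite, and it is
  positive because the image measure is not zero.
\<close>

lemma lborel_linear_image:
  fixes M :: "real^'n^'n"
  assumes inv: "invertible M"
  obtains \<kappa> where "\<kappa> > 0" "distr lborel borel ((*v) M) = density lborel (\<lambda>_. ennreal \<kappa>)"
proof -
  have r: "M *v (matrix_inv M *v y) = y" and l: "matrix_inv M *v (M *v y) = y" for y
    using inv by (simp_all add: matrix_vector_mul_assoc matrix_inv_left matrix_inv_right)
  let ?F = "cell 1 :: (real^'n) set"
  define K where "K = (\<integral>\<^sup>+x. indicator ?F (- (M *v x)) \<partial>lborel)"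
  have pair: "pair_sigma_finite (lborel :: (real^'n) measure) (lborel :: (real^'n) measure)"
    by (intro pair_sigma_finite.intro sigma_finite_lborel)
  have eq: "emeasure (distr lborel borel ((*v) M)) E = K * emeasure lborel E" if [measurable]: "E \<in> sets borel" for E
  proof -
    have "emeasure (distr lborel borel ((*v) M)) E = (\<integral>\<^sup>+x. indicator E (M *v x) \<partial>lborel)"
      by (simp add: nn_integral_distr[symmetric, of "(*v) M" _ borel "indicator E"])
    also have "\<dots> = (\<integral>\<^sup>+y. (\<integral>\<^sup>+x. indicator ?F y * indicator E (M *v x + y) \<partial>lborel) \<partial>lborel)"
    proof -
      have "(\<integral>\<^sup>+x. indicator E (M *v x + y) \<partial>lborel) = (\<integral>\<^sup>+x. indicator E (M *v x) \<partial>lborel)" for y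
        using nn_integral_translate[of "\<lambda>x. indicator E (M *v x)" "matrix_inv M *v y"]
        by (simp add: matrix_vector_right_distrib r)
      then show ?thesis using emeasure_cell[of 1, where 'n='n] by (simp add: nn_integral_cmult nn_integral_multc)
    qed
    also have "\<dots> = (\<integral>\<^sup>+x. (\<integral>\<^sup>+y. indicator ?F y * indicator E (M *v x + y) \<partial>lborel) \<partial>lborel)"
      by (rule pair_sigma_finite.Fubini'[OF pair]) measurable
    also have "\<dots> = (\<integral>\<^sup>+x. (\<integral>\<^sup>+y. indicator ?F (y - M *v x) * indicator E y \<partial>lborel) \<partial>lborel)"
    proof (rule nn_integral_cong)
      fix x
      show "(\<integral>\<^sup>+y. indicator ?F y * indicator E (M *v x + y) \<partial>lborel) = (\<integral>\<^sup>+y. indicator ?F (y - M *v x) * indicator E y \<partial>lborel)"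
        using nn_integral_translate[of "\<lambda>y. indicator ?F (y - M *v x) * indicator E y" "M *v x"]
        by (simp add: add.commute)
    qed
    also have "\<dots> = (\<integral>\<^sup>+y. (\<integral>\<^sup>+x. indicator ?F (y - M *v x) * indicator E y \<partial>lborel) \<partial>lborel)"
      by (rule pair_sigma_finite.Fubini'[OF pair]) measurable
    also have "\<dots> = (\<integral>\<^sup>+y. K * indicator E y \<partial>lborel)"
    proof (rule nn_integral_cong)
      fix y
      have "(\<integral>\<^sup>+x. indicator ?F (y - M *v x) \<partial>lborel) = K"
        using nn_integral_translate[of "\<lambda>x. indicator ?F (y - M *v x)" "matrix_inv M *v y"]
        by (simp add: matrix_vector_right_distrib r K_def)
      then show "(\<integral>\<^sup>+x. indicator ?F (y - M *v x) * indicator E y \<partial>lborel) = K * indicator E y"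
        by (simp add: nn_integral_multc)
    qed
    finally show ?thesis by (simp add: nn_integral_cmult)
  qed
  have "K \<noteq> 0"
  proof
    assume "K = 0"
    then have "emeasure (distr lborel borel ((*v) M)) UNIV = 0" using eq[of UNIV] by simp
    then show False by (simp add: emeasure_distr)
  qed
  moreover have "K < \<infinity>"
  proof -
    have "bounded ?F" using cell_subset_cbox[of 1] bounded_subset bounded_cbox by blast
    then have "bounded ((\<lambda>y. matrix_inv M *v (- y)) ` ?F)"
      by (intro bounded_linear_image bounded_linear_compose[of "(*v) (matrix_inv M)" uminus]
           matrix_vector_mul_bounded_linear bounded_linear_minus bounded_linear_ident)
    moreover have "{x. - (M *v x) \<in> ?F} \<subseteq> (\<lambda>y. matrix_inv M *v (- y)) ` ?F"
    proof
      fix x assume "x \<in> {x. - (M *v x) \<in> ?F}"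
      then show "x \<in> (\<lambda>y. matrix_inv M *v (- y)) ` ?F"
        by (intro image_eqI[of _ _ "- (M *v x)"]) (auto simp: l)
    qed
    ultimately have "bounded {x. - (M *v x) \<in> ?F}" using bounded_subset by blast
    then have "emeasure lborel {x. - (M *v x) \<in> ?F} < \<infinity>" by (rule emeasure_bounded_finite)
    moreover have "K = emeasure lborel {x. - (M *v x) \<in> ?F}"
    proof -
      have "K = (\<integral>\<^sup>+x. indicator {x. - (M *v x) \<in> ?F} x \<partial>lborel)"
        unfolding K_def by (intro nn_integral_cong) (simp add: indicator_def)
      then show ?thesis by simp
    qed
    ultimately show ?thesis by simp
  qed
  ultimately have K: "K = ennreal (enn2real K)" "enn2real K > 0"
    by (auto simp: enn2real_positive_iff less_top zero_less_iff_neq_zero)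
  have "distr lborel borel ((*v) M) = density lborel (\<lambda>_. ennreal (enn2real K))"
    by (rule measure_eqI) (auto simp: eq emeasure_density_const K(1)[symmetric])
  with K(2) that show ?thesis by blast
qed

text \<open>
  This is \<open>1 / \<bar>det M\<bar>\<close>, the ratio of the image of Lebesgue measure to Lebesgue measure.
\<close>

definition jacobian :: "real^'n^'n \<Rightarrow> real" where
  "jacobian M = (SOME \<kappa>. \<kappa> > 0 \<and> distr lborel borel ((*v) M) = density lborel (\<lambda>_. ennreal \<kappa>))"

lemma jacobian:
  assumes "invertible M"
  shows "jacobian M > 0" "distr lborel borel ((*v) M) = density lborel (\<lambda>_. ennreal (jacobian M))"
  using someI_ex[of "\<lambda>\<kappa>. \<kappa> > 0 \<and> distr lborel borel ((*v) M) = density lborel (\<lambda>_. ennreal \<kappa>)"]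
    lborel_linear_image[OF assms] unfolding jacobian_def by blast+

lemma nn_integral_linear:
  fixes M :: "real^'n^'n" and h :: "real^'n \<Rightarrow> ennreal"
  assumes M: "invertible M" and [measurable]: "h \<in> borel_measurable borel"
  shows "(\<integral>\<^sup>+x. h (M *v x) \<partial>lborel) = ennreal (jacobian M) * (\<integral>\<^sup>+x. h x \<partial>lborel)"
proof -
  have "(\<integral>\<^sup>+x. h (M *v x) \<partial>lborel) = (\<integral>\<^sup>+x. h x \<partial>distr lborel borel ((*v) M))"
    by (simp add: nn_integral_distr)
  then show ?thesis by (simp add: jacobian[OF M] nn_integral_density nn_integral_cmult)
qed

lemma integral_linear:
  fixes M :: "real^'n^'n" and h :: "real^'n \<Rightarrow> complex"
  assumes M: "invertible M" and [measurable]: "h \<in> borel_measurable borel"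
  shows "(LINT x|lborel. h (M *v x)) = of_real (jacobian M) * (LINT x|lborel. h x)"
proof -
  have "(LINT x|lborel. h (M *v x)) = (LINT x|distr lborel borel ((*v) M). h x)"
    by (simp add: integral_distr)
  also have "\<dots> = (LINT x|lborel. jacobian M *\<^sub>R h x)"
    unfolding jacobian(2)[OF M] using jacobian(1)[OF M] by (intro integral_density) auto
  finally show ?thesis by (simp add: scaleR_conv_of_real)
qed

lemma AE_linear_image:
  fixes M :: "real^'n^'n"
  assumes M: "invertible M" and P: "AE x in lborel. P x"
  shows "AE x in lborel. P (M *v x)"
proof -
  have "AE x in density lborel (\<lambda>_. ennreal (jacobian M)). P x"
    using P by (subst AE_density) auto
  then have "AE x in distr lborel borel ((*v) M). P x" unfolding jacobian(2)[OF M] .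
  then show ?thesis by (rule AE_distrD[rotated]) simp
qed

section \<open>Plancherel's theorem\<close>

definition supported_in :: "'a::euclidean_space set \<Rightarrow> 'a l2 \<Rightarrow> bool" where
  "supported_in S f \<longleftrightarrow> (AE x in lborel. x \<notin> S \<longrightarrow> rep_l2 f x = 0)"

definition cut :: "'a::euclidean_space set \<Rightarrow> 'a l2 \<Rightarrow> 'a l2" where
  "cut S f = abs_l2 (\<lambda>x. indicator S x *\<^sub>R rep_l2 f x)"

lemma square_integrable_cut: 
  assumes "S \<in> sets borel" shows "square_integrable (\<lambda>x. indicator S x *\<^sub>R rep_l2 f x)"
proof (rule square_integrableI)
  have "(\<integral>\<^sup>+x. ennreal ((cmod (indicator S x *\<^sub>R rep_l2 f x))\<^sup>2) \<partial>lborel) \<le> (\<integral>\<^sup>+x. ennreal ((cmod (rep_l2 f x))\<^sup>2) \<partial>lborel)"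
    by (intro nn_integral_mono) (auto simp: indicator_def)
  also have "\<dots> < \<infinity>" by (simp add: norm_sq_nn_integral[symmetric] del: ennreal_power)
  finally show "(\<integral>\<^sup>+x. ennreal ((cmod (indicator S x *\<^sub>R rep_l2 f x))\<^sup>2) \<partial>lborel) < \<infinity>" .
qed (use assms in measurable)

lemma rep_cut: "S \<in> sets borel \<Longrightarrow> AE x in lborel. rep_l2 (cut S f) x = indicator S x *\<^sub>R rep_l2 f x"
  unfolding cut_def by (intro rep_abs_l2 square_integrable_cut)

lemma supported_in_cut: "S \<in> sets borel \<Longrightarrow> supported_in S (cut S f)"
  unfolding supported_in_def using rep_cut[of S f] by auto

lemma norm_sq_dist_nn: "ennreal ((dist f g)\<^sup>2) = (\<integral>\<^sup>+x. ennreal ((cmod (rep_l2 f x - rep_l2 g x))\<^sup>2) \<partial>lborel)"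
  unfolding dist_norm nn_integral_norm_minus ..

lemma l2_dominated_convergence:
  fixes f :: "'a::euclidean_space l2"
  assumes lim: "AE x in lborel. (\<lambda>n. rep_l2 (F n) x) \<longlonglongrightarrow> rep_l2 f x"
    and le: "\<And>n. AE x in lborel. cmod (rep_l2 (F n) x) \<le> cmod (rep_l2 f x)"
  shows "F \<longlonglongrightarrow> f"
proof -
  have "(\<lambda>n. LINT x|lborel. (cmod (rep_l2 (F n - f) x))\<^sup>2) \<longlonglongrightarrow> (LINT x|(lborel :: 'a measure). 0)"
  proof (rule integral_dominated_convergence[where w="\<lambda>x. 4 * (cmod (rep_l2 f x))\<^sup>2"])
    show "integrable lborel (\<lambda>x. 4 * (cmod (rep_l2 f x))\<^sup>2)"
      using square_integrable_rep[of f] by (auto simp: square_integrable_def)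
    have "AE x in lborel. \<forall>n. rep_l2 (F n - f) x = rep_l2 (F n) x - rep_l2 f x"
      by (subst AE_all_countable) (use rep_minus in blast)
    with lim show "AE x in lborel. (\<lambda>n. (cmod (rep_l2 (F n - f) x))\<^sup>2) \<longlonglongrightarrow> 0"
    proof eventually_elim
      case (elim x)
      then have "(\<lambda>n. (cmod (rep_l2 (F n) x - rep_l2 f x))\<^sup>2) \<longlonglongrightarrow> (cmod (rep_l2 f x - rep_l2 f x))\<^sup>2"
        by (intro tendsto_intros)
      then show ?case using elim by simp
    qed
    show "AE x in lborel. norm ((cmod (rep_l2 (F n - f) x))\<^sup>2) \<le> 4 * (cmod (rep_l2 f x))\<^sup>2" for n
      using rep_minus[of "F n" f] le[of n]
    proof eventually_elim
      case (elim x)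
      then have "cmod (rep_l2 (F n - f) x) \<le> 2 * cmod (rep_l2 f x)"
        using norm_triangle_ineq4[of "rep_l2 (F n) x" "rep_l2 f x"] by simp
      then have "(cmod (rep_l2 (F n - f) x))\<^sup>2 \<le> (2 * cmod (rep_l2 f x))\<^sup>2" by (intro power_mono) auto
      then show ?case by (simp add: power_mult_distrib)
    qed
  qed auto
  then have "(\<lambda>n. sqrt ((norm (F n - f))\<^sup>2)) \<longlonglongrightarrow> sqrt 0"
    unfolding norm_sq_integral by (intro tendsto_real_sqrt) simp
  then show ?thesis using LIM_zero_cancel tendsto_norm_zero_cancel by force
qed

abbreviation cut_cell :: "nat \<Rightarrow> (real^'n) l2 \<Rightarrow> (real^'n) l2" where
  "cut_cell m \<equiv> cut (cell (real (Suc m)))"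

lemma eventually_in_cell: "eventually (\<lambda>m. (x :: real^'n) \<in> cell (real (Suc m))) sequentially"
proof -
  obtain N :: nat where N: "2 * norm x < real N" using reals_Archimedean2 by blast
  have "x \<in> cell (real (Suc m))" if "m \<ge> N" for m
  proof -
    have "\<bar>x $ i\<bar> < real (Suc m) / 2" for i
    proof -
      have "real N \<le> real m" using that by simp
      then show ?thesis using component_le_norm_cart[of x i] N by simp
    qed
    then have "- (real (Suc m) / 2) < x $ i \<and> x $ i < real (Suc m) / 2" for i
      unfolding abs_less_iff by (metis minus_less_iff)
    then show ?thesis unfolding cell_def mem_Collect_eq
      by (metis less_imp_le minus_divide_left)
  qed
  then show ?thesis by (auto simp: eventually_sequentially)
qed

lemma cut_cell_tendsto: "(\<lambda>m. cut_cell m f) \<longlonglongrightarrow> f"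
proof (rule l2_dominated_convergence)
  have "AE x in lborel. \<forall>m. rep_l2 (cut_cell m f) x = indicator (cell (real (Suc m))) x *\<^sub>R rep_l2 f x"
    by (subst AE_all_countable) (auto intro: rep_cut)
  then show "AE x in lborel. (\<lambda>n. rep_l2 (cut_cell n f) x) \<longlonglongrightarrow> rep_l2 f x"
  proof eventually_elim
    case (elim x)
    note cut = this
    have "eventually (\<lambda>m. rep_l2 (cut_cell m f) x = rep_l2 f x) sequentially"
      using eventually_in_cell[of x]
    proof eventually_elim
      case (elim m)
      then show ?case using cut by (simp del: of_nat_Suc)
    qed
    then show ?case by (rule tendsto_eventually)
  qed
  show "AE x in lborel. cmod (rep_l2 (cut_cell n f) x) \<le> cmod (rep_l2 f x)" for n
    using rep_cut[of "cell (real (Suc n))" f] by (auto simp: indicator_def)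
qed

text \<open>
  On a set of finite measure square-integrable functions are integrable, so the Fourier integral
  is available for them.
\<close>

lemma integrable_supported:
  fixes f :: "(real^'n) l2"
  assumes "supported_in (cell c) f" shows "integrable lborel (rep_l2 f)"
proof -
  have "integrable lborel (\<lambda>x. rep_l2 f x * cnj (indicator (cell c) x *\<^sub>R 1))"
    by (intro square_integrable_mult_integrable square_integrable_rep square_integrable_indicator_bounded[where C=1])
       (auto simp: emeasure_cell_finite[simplified])
  then show ?thesis
    using assms by (subst integrable_cong_AE[where g="\<lambda>x. rep_l2 f x * cnj (indicator (cell c) x *\<^sub>R 1)"])
       (auto simp: supported_in_def indicator_def)
qed

lemma fourier_kernel: "exp (- (\<i> * complex_of_real t)) = cis (- t)"
  by (simp add: cis_conv_exp)

lemma fourier_integral_cis: "fourier_integral f \<xi> = (LINT x|lborel. f x * cis (- (x \<bullet> \<xi>)))"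
  unfolding fourier_integral_def fourier_kernel ..

lemma fourier_integral_cong_AE:
  assumes "AE x in lborel. f x = g x" "f \<in> borel_measurable borel" "g \<in> borel_measurable borel"
  shows "fourier_integral f \<xi> = fourier_integral g \<xi>"
  unfolding fourier_integral_cis using assms by (intro integral_cong_AE) auto

lemma fourier_integral_measurable [measurable]:
  fixes f :: "'a::euclidean_space \<Rightarrow> complex"
  assumes [measurable]: "f \<in> borel_measurable borel"
  shows "fourier_integral f \<in> borel_measurable borel"
proof -
  have "(\<lambda>\<xi>. LINT x|lborel. f x * cis (- (x \<bullet> \<xi>))) \<in> borel_measurable (lborel :: 'a measure)"
    by (rule sigma_finite_measure.borel_measurable_lebesgue_integral[OF sigma_finite_lborel]) measurable
  then show ?thesis unfolding fourier_integral_cis[abs_def] by simp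
qed

lemma integrable_fourier_integrand:
  fixes f :: "'a::euclidean_space \<Rightarrow> complex"
  assumes "integrable lborel f"
  shows "integrable lborel (\<lambda>x. f x * cis (- (x \<bullet> \<xi>)))"
  by (rule integrable_mult_bounded[OF assms, where C=1]) auto

text \<open>
  The dual lattice of the cell has the cell of side \<open>2\<pi>/c\<close> as fundamental domain. For every shift \<open>\<alpha>\<close>
  in it, the values of the Fourier integral on \<open>\<alpha>\<close> plus the dual lattice are the Fourier coefficients
  of \<open>f\<close> times a character, so by Parseval's identity their squares have a sum that does not depend
  on \<open>\<alpha>\<close>. Integrating over \<open>\<alpha>\<close> gives the integral over the whole space.
\<close>

lemma plancherel_cell:
  fixes f :: "(real^'n) l2"
  assumes c: "c > 0" and supp: "supported_in (cell c) f"
  shows "(\<integral>\<^sup>+\<xi>. ennreal ((cmod (fourier_integral (rep_l2 f) \<xi>))\<^sup>2) \<partial>lborel) = ennreal ((2 * pi) ^ CARD('n) * (norm f)\<^sup>2)"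
proof -
  define c' where "c' = 2 * pi / c"
  have c': "c' > 0" using c by (simp add: c'_def)
  have inner: "(\<integral>\<^sup>+k. ennreal ((cmod (fourier_integral (rep_l2 f) (\<alpha> + c' *\<^sub>R k)))\<^sup>2) \<partial>count_space int_lattice)
      = ennreal (c ^ CARD('n) * (norm f)\<^sup>2)" for \<alpha> :: "real^'n"
  proof -
    let ?u = "\<lambda>x. rep_l2 f x * cis (- (x \<bullet> \<alpha>))"
    have sq: "square_integrable ?u"
      using square_integrable_rep[of f] by (auto simp: square_integrable_def norm_mult)
    define g where "g = abs_l2 ?u"
    have g: "AE x in lborel. rep_l2 g x = rep_l2 f x * cis (- (x \<bullet> \<alpha>))"
      unfolding g_def by (rule rep_abs_l2[OF sq])
    have "ennreal ((norm g)\<^sup>2) = ennreal ((norm f)\<^sup>2)"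
      unfolding norm_sq_nn_integral using g by (intro nn_integral_cong_AE) (auto simp: norm_mult)
    then have ng: "(norm g)\<^sup>2 = (norm f)\<^sup>2" by (simp del: ennreal_power)
    have "AE x in lborel. x \<notin> cell c \<longrightarrow> rep_l2 g x = 0"
      using g supp unfolding supported_in_def by eventually_elim auto
    from parseval_cell[OF c this]
    have "((\<lambda>k. (cmod (LINT x|lborel. rep_l2 g x * cnj (texp c k x)))\<^sup>2) has_sum (c ^ CARD('n) * (norm f)\<^sup>2)) int_lattice"
      by (simp add: ng)
    moreover have "(LINT x|lborel. rep_l2 g x * cnj (texp c k x)) = fourier_integral (rep_l2 f) (\<alpha> + c' *\<^sub>R k)" for k
      unfolding fourier_integral_cis
    proof (rule integral_cong_AE)
      show "AE x in lborel. rep_l2 g x * cnj (texp c k x) = rep_l2 f x * cis (- (x \<bullet> (\<alpha> + c' *\<^sub>R k)))"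
        using g
      proof eventually_elim
        case (elim x)
        have "cis (- (x \<bullet> (\<alpha> + c' *\<^sub>R k))) = cis (- (x \<bullet> \<alpha>)) * cis (- (c' * (k \<bullet> x)))"
          unfolding cis_mult by (simp add: inner_add_right inner_commute)
        then show ?case using elim by (simp add: texp_def cis_cnj c'_def)
      qed
    qed auto
    ultimately show ?thesis
      using c by (subst (asm) has_sum_nonneg_iff_nn_integral) auto
  qed
  have "(\<integral>\<^sup>+\<xi>. ennreal ((cmod (fourier_integral (rep_l2 f) \<xi>))\<^sup>2) \<partial>lborel)
     = (\<integral>\<^sup>+\<alpha>. ennreal (c ^ CARD('n) * (norm f)\<^sup>2) * indicator (cell c' :: (real^'n) set) \<alpha> \<partial>lborel)"
    by (subst nn_integral_tiling[OF c']) (simp_all only: inner, measurable)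
  also have "\<dots> = ennreal (c ^ CARD('n) * (norm f)\<^sup>2) * ennreal (c' ^ CARD('n))"
    using emeasure_cell[of c', where 'n='n] c' by (simp add: nn_integral_cmult_indicator)
  also have "\<dots> = ennreal ((c * c') ^ CARD('n) * (norm f)\<^sup>2)"
    using c c' by (subst ennreal_mult[symmetric]) (auto simp: power_mult_distrib mult_ac)
  also have "c * c' = 2 * pi" using c by (simp add: c'_def)
  finally show ?thesis .
qed

lemma square_integrable_fourier_integral:
  fixes f :: "(real^'n) l2"
  assumes "c > 0" "supported_in (cell c) f"
  shows "square_integrable (fourier_integral (rep_l2 f))"
  by (rule square_integrableI) (simp_all add: plancherel_cell[OF assms] del: ennreal_power ennreal_mult')

definition fourier0 :: "(real^'n) l2 \<Rightarrow> (real^'n) l2" where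
  "fourier0 f = abs_l2 (fourier_integral (rep_l2 f))"

lemma rep_fourier0:
  assumes "c > 0" "supported_in (cell c) f"
  shows "AE \<xi> in lborel. rep_l2 (fourier0 f) \<xi> = fourier_integral (rep_l2 f) \<xi>"
  unfolding fourier0_def by (rule rep_abs_l2[OF square_integrable_fourier_integral[OF assms]])

lemma norm_fourier0:
  fixes f :: "(real^'n) l2"
  assumes "c > 0" "supported_in (cell c) f"
  shows "(norm (fourier0 f))\<^sup>2 = (2 * pi) ^ CARD('n) * (norm f)\<^sup>2"
proof -
  have "ennreal ((norm (fourier0 f))\<^sup>2) = ennreal ((2 * pi) ^ CARD('n) * (norm f)\<^sup>2)"
    unfolding norm_sq_nn_integral plancherel_cell[OF assms, symmetric]
    using rep_fourier0[OF assms] by (intro nn_integral_cong_AE) auto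
  then show ?thesis by (simp del: ennreal_power)
qed

lemma cell_mono: "c \<le> d \<Longrightarrow> cell c \<subseteq> (cell d :: (real^'n) set)"
proof
  fix x :: "real^'n" assume "c \<le> d" "x \<in> cell c"
  then have "- d / 2 \<le> x $ i \<and> x $ i < d / 2" for i 
    by (auto simp: cell_def) (smt (verit) divide_right_mono minus_divide_left, smt (verit))
  then show "x \<in> cell d" by (simp add: cell_def)
qed

lemma supported_in_mono: "supported_in S f \<Longrightarrow> S \<subseteq> T \<Longrightarrow> supported_in T f"
  unfolding supported_in_def by (erule eventually_mono) auto

lemma supported_in_add:
  assumes "supported_in S f" "supported_in S g"
  shows "supported_in S (f + g)"
  using assms rep_plus[of f g] unfolding supported_in_def by eventually_elim auto

lemma supported_in_minus:
  assumes "supported_in S f" "supported_in S g"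
  shows "supported_in S (f - g)"
  using assms rep_minus[of f g] unfolding supported_in_def by eventually_elim auto

lemma supported_in_scale:
  assumes "supported_in S f" shows "supported_in S (scale_l2 a f)"
  using assms rep_scale[of a f] unfolding supported_in_def by eventually_elim auto

lemma fourier_integral_add:
  fixes f g :: "'a::euclidean_space l2"
  assumes "integrable lborel (rep_l2 f)" "integrable lborel (rep_l2 g)"
  shows "fourier_integral (rep_l2 (f + g)) \<xi> = fourier_integral (rep_l2 f) \<xi> + fourier_integral (rep_l2 g) \<xi>"
proof -
  have "fourier_integral (rep_l2 (f + g)) \<xi> = fourier_integral (\<lambda>x. rep_l2 f x + rep_l2 g x) \<xi>"
    by (rule fourier_integral_cong_AE[OF rep_plus]) auto
  also have "\<dots> = fourier_integral (rep_l2 f) \<xi> + fourier_integral (rep_l2 g) \<xi>"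
    unfolding fourier_integral_cis distrib_right
    by (rule Bochner_Integration.integral_add) (intro integrable_fourier_integrand assms)+
  finally show ?thesis .
qed

lemma fourier_integral_scale:
  "fourier_integral (rep_l2 (scale_l2 a f)) \<xi> = a * fourier_integral (rep_l2 f) \<xi>"
proof -
  have "fourier_integral (rep_l2 (scale_l2 a f)) \<xi> = fourier_integral (\<lambda>x. a * rep_l2 f x) \<xi>"
    by (rule fourier_integral_cong_AE[OF rep_scale]) auto
  then show ?thesis unfolding fourier_integral_cis by (simp add: mult.assoc)
qed

lemma fourier0_add:
  fixes f g :: "(real^'n) l2"
  assumes c: "c > 0" and fg: "supported_in (cell c) f" "supported_in (cell c) g"
  shows "fourier0 (f + g) = fourier0 f + fourier0 g"
  using rep_fourier0[OF c supported_in_add[OF fg]] rep_fourier0[OF c fg(1)] rep_fourier0[OF c fg(2)]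
    rep_plus[of "fourier0 f" "fourier0 g"]
  by (intro l2_eqI, eventually_elim)
     (simp add: fourier_integral_add[OF integrable_supported[OF fg(1)] integrable_supported[OF fg(2)]])

lemma fourier0_scale:
  fixes f :: "(real^'n) l2"
  assumes c: "c > 0" and f: "supported_in (cell c) f"
  shows "fourier0 (scale_l2 a f) = scale_l2 a (fourier0 f)"
  using rep_fourier0[OF c supported_in_scale[OF f]] rep_fourier0[OF c f]
    rep_scale[of a "fourier0 f"]
  by (intro l2_eqI, eventually_elim) (simp add: fourier_integral_scale)

lemma fourier0_minus:
  fixes f g :: "(real^'n) l2"
  assumes c: "c > 0" and fg: "supported_in (cell c) f" "supported_in (cell c) g"
  shows "fourier0 (f - g) = fourier0 f - fourier0 g"
  using fourier0_add[OF c supported_in_minus[OF fg] fg(2)] by simp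

lemma supported_in_cut_cell: "supported_in (cell (real (Suc m))) (cut_cell m f)"
  by (rule supported_in_cut) simp

lemma fourier0_cut_convergent:
  fixes f :: "(real^'n) l2"
  shows "convergent (\<lambda>m. fourier0 (cut_cell m f))"
proof (rule Cauchy_convergent, rule metric_CauchyI)
  fix e :: real assume e: "e > 0"
  let ?C = "sqrt ((2 * pi) ^ CARD('n))"
  have C: "?C > 0" by simp
  have "Cauchy (\<lambda>m. cut_cell m f)" using cut_cell_tendsto[of f] LIMSEQ_imp_Cauchy by blast
  then obtain N where N: "\<And>m n. m \<ge> N \<Longrightarrow> n \<ge> N \<Longrightarrow> dist (cut_cell m f) (cut_cell n f) < e / ?C"
    using metric_CauchyD[of _ "e / ?C"] e C by (metis divide_pos_pos)
  have "dist (fourier0 (cut_cell m f)) (fourier0 (cut_cell n f)) = ?C * dist (cut_cell m f) (cut_cell n f)" for m n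
  proof -
    define c where "c = real (Suc (max m n))"
    have c: "c > 0" "supported_in (cell c) (cut_cell m f)" "supported_in (cell c) (cut_cell n f)"
      unfolding c_def by (simp, (rule supported_in_mono[OF supported_in_cut_cell cell_mono], simp)+)
    have "(norm (fourier0 (cut_cell m f - cut_cell n f)))\<^sup>2 = (?C * norm (cut_cell m f - cut_cell n f))\<^sup>2"
      by (subst norm_fourier0[OF c(1) supported_in_minus[OF c(2,3)]]) (simp add: power_mult_distrib)
    then have "norm (fourier0 (cut_cell m f - cut_cell n f)) = ?C * norm (cut_cell m f - cut_cell n f)"
      by (rule power2_eq_imp_eq) auto
    then show ?thesis by (simp only: dist_norm fourier0_minus[OF c])
  qed
  then show "\<exists>M. \<forall>m\<ge>M. \<forall>n\<ge>M. dist (fourier0 (cut_cell m f)) (fourier0 (cut_cell n f)) < e"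
    using N C by (intro exI[of _ N]) (simp add: pos_less_divide_eq mult.commute)
qed

definition fourier_ext :: "(real^'n) l2 \<Rightarrow> (real^'n) l2" where
  "fourier_ext f = lim (\<lambda>m. fourier0 (cut_cell m f))"

lemma fourier_ext_tendsto: "(\<lambda>m. fourier0 (cut_cell m f)) \<longlonglongrightarrow> fourier_ext f"
  unfolding fourier_ext_def using fourier0_cut_convergent convergent_LIMSEQ_iff by blast

lemma cut_add:
  assumes "S \<in> sets borel" shows "cut S (f + g) = cut S f + cut S g"
  using rep_cut[OF assms, of "f + g"] rep_cut[OF assms, of f] rep_cut[OF assms, of g]
    rep_plus[of f g] rep_plus[of "cut S f" "cut S g"]
  by (intro l2_eqI, eventually_elim) (simp add: scaleR_right_distrib)

lemma cut_scale:
  assumes "S \<in> sets borel" shows "cut S (scale_l2 a f) = scale_l2 a (cut S f)"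
  using rep_cut[OF assms, of "scale_l2 a f"] rep_cut[OF assms, of f] rep_scale[of a f] rep_scale[of a "cut S f"]
  by (intro l2_eqI, eventually_elim) simp

lemma fourier_ext_add: "fourier_ext (f + g) = fourier_ext f + fourier_ext g"
proof -
  have "fourier0 (cut_cell m (f + g)) = fourier0 (cut_cell m f) + fourier0 (cut_cell m g)" for m
    unfolding cut_add[OF cell_measurable]
    by (rule fourier0_add[where c="real (Suc m)"]) (auto simp: supported_in_cut)
  then have "(\<lambda>m. fourier0 (cut_cell m (f + g))) \<longlonglongrightarrow> fourier_ext f + fourier_ext g"
    using fourier_ext_tendsto[of f] fourier_ext_tendsto[of g] by (simp add: tendsto_add)
  then show ?thesis using fourier_ext_tendsto LIMSEQ_unique by blast
qed

lemma fourier_ext_scale: "fourier_ext (scale_l2 a f) = scale_l2 a (fourier_ext f)"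
proof -
  have "fourier0 (cut_cell m (scale_l2 a f)) = scale_l2 a (fourier0 (cut_cell m f))" for m
    unfolding cut_scale[OF cell_measurable]
    by (rule fourier0_scale[where c="real (Suc m)"]) (auto simp: supported_in_cut)
  then have "(\<lambda>m. fourier0 (cut_cell m (scale_l2 a f))) \<longlonglongrightarrow> scale_l2 a (fourier_ext f)"
    using fourier_ext_tendsto[of f] by (simp add: tendsto_scale_l2)
  then show ?thesis using fourier_ext_tendsto LIMSEQ_unique by blast
qed

lemma norm_fourier_ext: 
  fixes f :: "(real^'n) l2"
  shows "(norm (fourier_ext f))\<^sup>2 = (2 * pi) ^ CARD('n) * (norm f)\<^sup>2"
proof -
  have 1: "(\<lambda>m. (norm (fourier0 (cut_cell m f)))\<^sup>2) \<longlonglongrightarrow> (norm (fourier_ext f))\<^sup>2"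
    by (intro tendsto_intros fourier_ext_tendsto)
  have "(norm (fourier0 (cut_cell m f)))\<^sup>2 = (2 * pi) ^ CARD('n) * (norm (cut_cell m f))\<^sup>2" for m
    by (rule norm_fourier0[OF _ supported_in_cut_cell]) simp
  then have 2: "(\<lambda>m. (2 * pi) ^ CARD('n) * (norm (cut_cell m f))\<^sup>2) \<longlonglongrightarrow> (norm (fourier_ext f))\<^sup>2"
    using 1 by (simp only:)
  have "(\<lambda>m. (2 * pi) ^ CARD('n) * (norm (cut_cell m f))\<^sup>2) \<longlonglongrightarrow> (2 * pi) ^ CARD('n) * (norm f)\<^sup>2"
    by (intro tendsto_intros cut_cell_tendsto)
  from LIMSEQ_unique[OF 2 this] show ?thesis .
qed

lemma continuous_fourier_ext: "continuous_on UNIV (fourier_ext :: (real^'n) l2 \<Rightarrow> _)"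
proof -
  let ?C = "sqrt ((2 * pi) ^ CARD('n))"
  have "dist (fourier_ext f) (fourier_ext g) = ?C * dist f g" for f g :: "(real^'n) l2"
  proof -
    have "fourier_ext (f - g) = fourier_ext f - fourier_ext g"
      using fourier_ext_add[of "f - g" g] by simp
    moreover have "norm (fourier_ext (f - g)) = ?C * norm (f - g)"
      by (rule power2_eq_imp_eq) (auto simp: norm_fourier_ext power_mult_distrib)
    ultimately show ?thesis by (simp add: dist_norm)
  qed
  then have "?C-lipschitz_on UNIV (fourier_ext :: (real^'n) l2 \<Rightarrow> _)"
    by (intro lipschitz_onI) auto
  then show ?thesis by (rule lipschitz_on_continuous_on)
qed

text \<open>
  The Fourier integrals of the truncations converge pointwise by dominated convergence and in norm by
  construction; Fatou's lemma shows that both limits agree.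
\<close>

lemma fourier_ext_integrable:
  fixes f :: "(real^'n) l2"
  assumes f: "integrable lborel (rep_l2 f)"
  shows "AE \<xi> in lborel. rep_l2 (fourier_ext f) \<xi> = fourier_integral (rep_l2 f) \<xi>"
proof -
  let ?u = "fourier_integral (rep_l2 f)"
  have cutm: "fourier_integral (rep_l2 (cut_cell m f)) \<xi> = (LINT x|lborel. indicator (cell (real (Suc m))) x *\<^sub>R (rep_l2 f x * cis (- (x \<bullet> \<xi>))))" for m \<xi>
    by (subst fourier_integral_cong_AE[OF rep_cut]) (auto simp: fourier_integral_cis)
  have lim: "(\<lambda>m. fourier_integral (rep_l2 (cut_cell m f)) \<xi>) \<longlonglongrightarrow> ?u \<xi>" for \<xi>
    unfolding cutm unfolding fourier_integral_cis
  proof (rule integral_dominated_convergence[where w="\<lambda>x. cmod (rep_l2 f x)"])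
    show "AE x in lborel. (\<lambda>m. indicator (cell (real (Suc m))) x *\<^sub>R (rep_l2 f x * cis (- (x \<bullet> \<xi>)))) \<longlonglongrightarrow> rep_l2 f x * cis (- (x \<bullet> \<xi>))"
    proof (rule AE_I2)
      fix x
      have "eventually (\<lambda>m. indicator (cell (real (Suc m))) x *\<^sub>R (rep_l2 f x * cis (- (x \<bullet> \<xi>))) = rep_l2 f x * cis (- (x \<bullet> \<xi>))) sequentially"
        using eventually_in_cell[of x] by eventually_elim simp
      then show "(\<lambda>m. indicator (cell (real (Suc m))) x *\<^sub>R (rep_l2 f x * cis (- (x \<bullet> \<xi>)))) \<longlonglongrightarrow> rep_l2 f x * cis (- (x \<bullet> \<xi>))"
        by (rule tendsto_eventually)
    qed
    show "AE x in lborel. norm (indicator (cell (real (Suc m))) x *\<^sub>R (rep_l2 f x * cis (- (x \<bullet> \<xi>)))) \<le> cmod (rep_l2 f x)" for m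
      by (intro AE_I2) (auto simp: norm_mult indicator_def)
  qed (use f in auto)
  have "AE \<xi> in lborel. \<forall>m. rep_l2 (fourier0 (cut_cell m f)) \<xi> = fourier_integral (rep_l2 (cut_cell m f)) \<xi>"
    by (subst AE_all_countable, rule allI, rule rep_fourier0[OF _ supported_in_cut_cell]) simp
  then have limAE: "AE \<xi> in lborel. (\<lambda>m. rep_l2 (fourier0 (cut_cell m f)) \<xi>) \<longlonglongrightarrow> ?u \<xi>"
    by eventually_elim (simp only: lim)
  have le: "square_integrable ?u \<and> norm (abs_l2 ?u - fourier_ext f) \<le> e" if e: "e > 0" for e
  proof -
    obtain N where "\<And>m. m \<ge> N \<Longrightarrow> dist (fourier0 (cut_cell m f)) (fourier_ext f) < e"
      using metric_LIMSEQ_D[OF fourier_ext_tendsto e] by blast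
    then show ?thesis
      by (intro l2_fatou[OF _ limAE, where N=N]) (auto simp: dist_norm less_imp_le)
  qed
  have sq: "square_integrable ?u" using le[of 1] by simp
  have "norm (abs_l2 ?u - fourier_ext f) \<le> 0" by (rule field_le_epsilon) (use le in auto)
  then have "fourier_ext f = abs_l2 ?u" by simp
  then show ?thesis using rep_abs_l2[OF sq] by simp
qed

lemma l2_continuous_ext:
  fixes F G :: "(real^'n) l2 \<Rightarrow> 'b::t2_space"
  assumes "continuous_on UNIV F" "continuous_on UNIV G"
    and eq: "\<And>f c. c > 0 \<Longrightarrow> supported_in (cell c) f \<Longrightarrow> F f = G f"
  shows "F f = G f"
proof -
  have "(\<lambda>m. F (cut_cell m f)) \<longlonglongrightarrow> F f" "(\<lambda>m. G (cut_cell m f)) \<longlonglongrightarrow> G f"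
    using assms(1,2) cut_cell_tendsto[of f] by (auto intro: continuous_on_tendsto_compose)
  moreover have "F (cut_cell m f) = G (cut_cell m f)" for m
    by (rule eq[OF _ supported_in_cut_cell]) simp
  ultimately show ?thesis using LIMSEQ_unique by auto
qed

text \<open>
  The extension satisfies the two requirements in the definition of the transform, and they determine
  it, since functions with bounded support are integrable and dense.
\<close>

lemma fourier_eq_ext: "fourier = (fourier_ext :: (real^'n) l2 \<Rightarrow> _)"
  unfolding fourier_def
proof (rule the_equality)
  show "continuous_on UNIV (fourier_ext :: (real^'n) l2 \<Rightarrow> _) \<and>
     (\<forall>f. integrable lborel (rep_l2 f) \<longrightarrow>
        (AE \<xi> in lborel. rep_l2 (fourier_ext f :: (real^'n) l2) \<xi> = fourier_integral (rep_l2 f) \<xi>))"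
    using continuous_fourier_ext fourier_ext_integrable by blast
next
  fix F :: "(real^'n) l2 \<Rightarrow> (real^'n) l2"
  assume F: "continuous_on UNIV F \<and> (\<forall>f. integrable lborel (rep_l2 f) \<longrightarrow>
        (AE \<xi> in lborel. rep_l2 (F f) \<xi> = fourier_integral (rep_l2 f) \<xi>))"
  show "F = fourier_ext"
  proof
    fix f
    show "F f = fourier_ext f"
    proof (rule l2_continuous_ext[where F=F and G=fourier_ext])
      fix f :: "(real^'n) l2" and c :: real assume "supported_in (cell c) f"
      then have i: "integrable lborel (rep_l2 f)" by (rule integrable_supported)
      then show "F f = fourier_ext f"
        using F fourier_ext_integrable[OF i] by (intro l2_eqI) (auto elim: eventually_elim2)
    qed (use F continuous_fourier_ext in auto)
  qed
qed

lemma fourier_add: "fourier (f + g) = fourier f + fourier (g :: (real^'n) l2)"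
  and fourier_scale: "fourier (scale_l2 a f) = scale_l2 a (fourier (f :: (real^'n) l2))"
  and norm_fourier: "(norm (fourier f))\<^sup>2 = (2 * pi) ^ CARD('n) * (norm (f :: (real^'n) l2))\<^sup>2"
  and continuous_fourier: "continuous_on UNIV (fourier :: (real^'n) l2 \<Rightarrow> _)"
  and fourier_integrable: "integrable lborel (rep_l2 f) \<Longrightarrow> AE \<xi> in lborel. rep_l2 (fourier (f :: (real^'n) l2)) \<xi> = fourier_integral (rep_l2 f) \<xi>"
  unfolding fourier_eq_ext
  by (fact fourier_ext_add fourier_ext_scale norm_fourier_ext continuous_fourier_ext fourier_ext_integrable)+

lemma fourier_minus: "fourier (f - g) = fourier f - fourier (g :: (real^'n) l2)"
  using fourier_add[of "f - g" g] by simp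

lemma cinner_polar: "cinner f g = complex_of_real (((norm (f + g))\<^sup>2 - (norm (f - g))\<^sup>2) / 4)
   + \<i> * complex_of_real (((norm (scale_l2 (- \<i>) f + g))\<^sup>2 - (norm (scale_l2 (- \<i>) f - g))\<^sup>2) / 4)"
proof -
  have i: "(norm (p + q))\<^sup>2 - (norm (p - q))\<^sup>2 = 4 * Re (cinner p q)" for p q :: "'b::euclidean_space l2"
    unfolding inner_l2_def[symmetric] power2_norm_eq_inner by (simp add: inner_commute algebra_simps)
  show ?thesis unfolding i by (simp add: cinner_scale_left complex_eq_iff del: l2.scale_minus_left)
qed

text \<open>
  By polarisation from the identity for norms.
\<close>

lemma cinner_fourier: "cinner (fourier f) (fourier g) = of_real ((2 * pi) ^ CARD('n)) * cinner f (g :: (real^'n) l2)"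
  unfolding cinner_polar fourier_add[symmetric] fourier_minus[symmetric] fourier_scale[symmetric] norm_fourier
  by (simp add: field_simps)

section \<open>Fourier transforms of translates and dilates; surjectivity\<close>

definition modulate :: "real^'n \<Rightarrow> (real^'n) l2 \<Rightarrow> (real^'n) l2" where
  "modulate k f = abs_l2 (\<lambda>\<xi>. cis (- (k \<bullet> \<xi>)) * rep_l2 f \<xi>)"

lemma rep_modulate: "AE \<xi> in lborel. rep_l2 (modulate k f) \<xi> = cis (- (k \<bullet> \<xi>)) * rep_l2 f \<xi>"
  unfolding modulate_def
  by (rule rep_abs_l2) (use square_integrable_rep[of f] in \<open>auto simp: square_integrable_def norm_mult\<close>)

lemma lipschitz_continuous_l2:
  fixes F :: "'a::euclidean_space l2 \<Rightarrow> 'b::euclidean_space l2"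
  assumes "\<And>f g. (\<integral>\<^sup>+x. ennreal ((cmod (rep_l2 (F f) x - rep_l2 (F g) x))\<^sup>2) \<partial>lborel)
     \<le> ennreal K * (\<integral>\<^sup>+x. ennreal ((cmod (rep_l2 f x - rep_l2 g x))\<^sup>2) \<partial>lborel)" "K \<ge> 0"
  shows "continuous_on UNIV F"
proof -
  have "dist (F f) (F g) \<le> sqrt K * dist f g" for f g
  proof -
    have "ennreal ((dist (F f) (F g))\<^sup>2) \<le> ennreal (K * (dist f g)\<^sup>2)"
      using assms(1)[of f g] assms(2) unfolding norm_sq_dist_nn[symmetric] by (simp add: ennreal_mult)
    then have "(dist (F f) (F g))\<^sup>2 \<le> (sqrt K * dist f g)\<^sup>2"
      using assms(2) by (simp add: power_mult_distrib del: ennreal_power)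
    then show ?thesis by (rule power2_le_imp_le) (use assms(2) in auto)
  qed
  then have "(sqrt K)-lipschitz_on UNIV F" using assms(2) by (intro lipschitz_onI) auto
  then show ?thesis by (rule lipschitz_on_continuous_on)
qed

lemma continuous_modulate: "continuous_on UNIV (modulate k)"
proof (rule lipschitz_continuous_l2[where K=1])
  fix f g
  have "cmod (cis t * a - cis t * b) = cmod (a - b)" for t a b
    unfolding right_diff_distrib[symmetric] by (simp add: norm_mult)
  then show "(\<integral>\<^sup>+x. ennreal ((cmod (rep_l2 (modulate k f) x - rep_l2 (modulate k g) x))\<^sup>2) \<partial>lborel)
     \<le> ennreal 1 * (\<integral>\<^sup>+x. ennreal ((cmod (rep_l2 f x - rep_l2 g x))\<^sup>2) \<partial>lborel)"
    using rep_modulate[of k f] rep_modulate[of k g]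
    by (simp, intro nn_integral_mono_AE) auto
qed simp

lemma continuous_translate: "continuous_on UNIV (translate k)"
proof (rule lipschitz_continuous_l2[where K=1])
  fix f g :: "'a l2"
  have "(\<integral>\<^sup>+x. ennreal ((cmod (rep_l2 (translate k f) x - rep_l2 (translate k g) x))\<^sup>2) \<partial>lborel)
    = (\<integral>\<^sup>+x. ennreal ((cmod (rep_l2 f (x - k) - rep_l2 g (x - k)))\<^sup>2) \<partial>lborel)"
    using rep_translate[of k f] rep_translate[of k g] by (intro nn_integral_cong_AE) auto
  also have "\<dots> = (\<integral>\<^sup>+x. ennreal ((cmod (rep_l2 f x - rep_l2 g x))\<^sup>2) \<partial>lborel)"
    using nn_integral_translate[of "\<lambda>x. ennreal ((cmod (rep_l2 f x - rep_l2 g x))\<^sup>2)" "- k"] by simp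
  finally show "(\<integral>\<^sup>+x. ennreal ((cmod (rep_l2 (translate k f) x - rep_l2 (translate k g) x))\<^sup>2) \<partial>lborel)
     \<le> ennreal 1 * (\<integral>\<^sup>+x. ennreal ((cmod (rep_l2 f x - rep_l2 g x))\<^sup>2) \<partial>lborel)" by simp
qed simp

lemma integrable_cong_AE_l2:
  assumes "AE x in lborel. rep_l2 f x = g x" "integrable lborel g"
  shows "integrable lborel (rep_l2 f)"
  using assms borel_measurable_integrable[OF assms(2)] by (subst integrable_cong_AE[where g=g]) auto

lemma fourier_translate:
  fixes k :: "real^'n"
  shows "fourier (translate k f) = modulate k (fourier f)"
proof (rule l2_continuous_ext[where F="\<lambda>f. fourier (translate k f)" and G="\<lambda>f. modulate k (fourier f)"])
  show "continuous_on UNIV (\<lambda>f. fourier (translate k f))"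
    by (rule continuous_on_compose2[OF continuous_fourier continuous_translate]) auto
  show "continuous_on UNIV (\<lambda>f. modulate k (fourier f))"
    by (rule continuous_on_compose2[OF continuous_modulate continuous_fourier]) auto
  fix f :: "(real^'n) l2" and c :: real assume "supported_in (cell c) f"
  then have i: "integrable lborel (rep_l2 f)" by (rule integrable_supported)
  have it: "integrable lborel (rep_l2 (translate k f))"
    by (rule integrable_cong_AE_l2[OF rep_translate])
       (use i integrable_translate_iff[of "rep_l2 f" "- k"] in simp)
  have fe: "fourier_integral (rep_l2 (translate k f)) \<xi> = cis (- (k \<bullet> \<xi>)) * fourier_integral (rep_l2 f) \<xi>" for \<xi>
  proof -
    have "fourier_integral (rep_l2 (translate k f)) \<xi> = (LINT x|lborel. rep_l2 f (x - k) * cis (- (x \<bullet> \<xi>)))"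
      by (subst fourier_integral_cong_AE[OF rep_translate]) (auto simp: fourier_integral_cis)
    also have "\<dots> = (LINT x|lborel. rep_l2 f x * cis (- ((x + k) \<bullet> \<xi>)))"
      using integral_translate[of "\<lambda>x. rep_l2 f (x - k) * cis (- (x \<bullet> \<xi>))" k] by simp
    also have "\<dots> = (LINT x|lborel. cis (- (k \<bullet> \<xi>)) * (rep_l2 f x * cis (- (x \<bullet> \<xi>))))"
      by (intro Bochner_Integration.integral_cong refl) (simp add: inner_add_left cis_mult mult_ac)
    finally show ?thesis by (simp add: fourier_integral_cis)
  qed
  show "fourier (translate k f) = modulate k (fourier f)"
    using fourier_integrable[OF i] fourier_integrable[OF it] rep_modulate[of k "fourier f"]
    by (intro l2_eqI, eventually_elim) (simp add: fe)
qed

lemma invertible_transpose: "invertible (M :: real^'n^'n) \<Longrightarrow> invertible (transpose M)"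
  unfolding invertible_def by (metis matrix_transpose_mul transpose_mat)

lemma square_integrable_linear:
  fixes f :: "(real^'n) l2" and M :: "real^'n^'n"
  assumes M: "invertible M"
  shows "square_integrable (\<lambda>x. rep_l2 f (M *v x))"
proof (rule square_integrableI)
  have "(\<integral>\<^sup>+x. ennreal ((cmod (rep_l2 f (M *v x)))\<^sup>2) \<partial>lborel) = ennreal (jacobian M) * ennreal ((norm f)\<^sup>2)"
    by (subst nn_integral_linear[OF M, of "\<lambda>x. ennreal ((cmod (rep_l2 f x))\<^sup>2)"]) (auto simp: norm_sq_nn_integral[symmetric])
  then show "(\<integral>\<^sup>+x. ennreal ((cmod (rep_l2 f (M *v x)))\<^sup>2) \<partial>lborel) < \<infinity>"
    by (simp add: ennreal_mult_less_top del: ennreal_power)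
qed measurable

text \<open>
  A dilation without its normalising factor; inverses and compositions of such operators need no
  bookkeeping of constants.
\<close>

definition lcomp :: "real^'n^'n \<Rightarrow> (real^'n) l2 \<Rightarrow> (real^'n) l2" where
  "lcomp M f = abs_l2 (\<lambda>x. rep_l2 f (M *v x))"

lemma rep_lcomp:
  "invertible M \<Longrightarrow> AE x in lborel. rep_l2 (lcomp M f) x = rep_l2 f (M *v x)"
  unfolding lcomp_def by (intro rep_abs_l2 square_integrable_linear)

lemma rep_dilate:
  "invertible M \<Longrightarrow> AE x in lborel. rep_l2 (dilate M f) x = complex_of_real (sqrt \<bar>det M\<bar>) * rep_l2 f (M *v x)"
  unfolding dilate_def by (intro rep_abs_l2 square_integrable_scale square_integrable_linear)

lemma dilate_eq_lcomp:
  "invertible M \<Longrightarrow> dilate M f = scale_l2 (complex_of_real (sqrt \<bar>det M\<bar>)) (lcomp M f)"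
  using rep_dilate[of M f] rep_lcomp[of M f] rep_scale[of "complex_of_real (sqrt \<bar>det M\<bar>)" "lcomp M f"]
  by (intro l2_eqI) auto

lemma cinner_lcomp:
  assumes M: "invertible M"
  shows "cinner (lcomp M f) (lcomp M g) = of_real (jacobian M) * cinner f g"
proof -
  have "cinner (lcomp M f) (lcomp M g) = (LINT x|lborel. rep_l2 f (M *v x) * cnj (rep_l2 g (M *v x)))"
    by (rule cinner_eqI[OF rep_lcomp[OF M] rep_lcomp[OF M]]) measurable
  also have "\<dots> = of_real (jacobian M) * cinner f g"
    using integral_linear[OF M, of "\<lambda>x. rep_l2 f x * cnj (rep_l2 g x)"] by (simp add: cinner_rep)
  finally show ?thesis .
qed

lemma continuous_lcomp:
  assumes M: "invertible M"
  shows "continuous_on UNIV (lcomp M)"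
proof (rule lipschitz_continuous_l2[where K="jacobian M"])
  fix f g
  have "(\<integral>\<^sup>+x. ennreal ((cmod (rep_l2 (lcomp M f) x - rep_l2 (lcomp M g) x))\<^sup>2) \<partial>lborel)
    = (\<integral>\<^sup>+x. ennreal ((cmod (rep_l2 f (M *v x) - rep_l2 g (M *v x)))\<^sup>2) \<partial>lborel)"
    using rep_lcomp[OF M, of f] rep_lcomp[OF M, of g] by (intro nn_integral_cong_AE) auto
  also have "\<dots> = ennreal (jacobian M) * (\<integral>\<^sup>+x. ennreal ((cmod (rep_l2 f x - rep_l2 g x))\<^sup>2) \<partial>lborel)"
    by (rule nn_integral_linear[OF M]) measurable
  finally show "(\<integral>\<^sup>+x. ennreal ((cmod (rep_l2 (lcomp M f) x - rep_l2 (lcomp M g) x))\<^sup>2) \<partial>lborel)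
    \<le> ennreal (jacobian M) * (\<integral>\<^sup>+x. ennreal ((cmod (rep_l2 f x - rep_l2 g x))\<^sup>2) \<partial>lborel)" by simp
qed (use jacobian(1)[OF M] in simp)

lemma lcomp_lcomp:
  assumes M: "invertible M" and N: "invertible N"
  shows "lcomp M (lcomp N f) = lcomp (N ** M) f"
proof -
  have "invertible (N ** M)" using M N by (simp add: invertible_mult)
  then show ?thesis
    using rep_lcomp[OF M, of "lcomp N f"] AE_linear_image[OF M rep_lcomp[OF N, of f]] rep_lcomp[of "N ** M" f]
    by (intro l2_eqI) (auto simp: matrix_vector_mul_assoc)
qed

lemma lcomp_id [simp]: "lcomp (mat 1) f = f"
  unfolding lcomp_def by simp

lemma matrix_inv_invertible: "invertible (M :: real^'n^'n) \<Longrightarrow> invertible (matrix_inv M)"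
  using matrix_inv_left matrix_inv_right unfolding invertible_def by blast

lemma lcomp_inv:
  assumes "invertible M"
  shows "lcomp M (lcomp (matrix_inv M) f) = f" "lcomp (matrix_inv M) (lcomp M f) = f"
  using assms by (simp_all add: lcomp_lcomp matrix_inv_invertible matrix_inv_left matrix_inv_right)

lemma inner_transpose: "(M *v x) \<bullet> y = x \<bullet> (transpose M *v y)" for M :: "real^'n^'n"
  by (metis dot_lmul_matrix inner_commute vector_transpose_matrix)

lemma fourier_lcomp:
  fixes M :: "real^'n^'n"
  assumes M: "invertible M"
  shows "fourier (lcomp M f) = scale_l2 (of_real (jacobian M)) (lcomp (matrix_inv (transpose M)) (fourier f))"
proof (rule l2_continuous_ext[where F="\<lambda>f. fourier (lcomp M f)"
      and G="\<lambda>f. scale_l2 (of_real (jacobian M)) (lcomp (matrix_inv (transpose M)) (fourier f))"])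
  let ?N = "matrix_inv (transpose M)"
  have N: "invertible ?N" by (intro matrix_inv_invertible invertible_transpose M)
  have MN: "transpose M *v (?N *v \<xi>) = \<xi>" for \<xi>
    using invertible_transpose[OF M] by (simp add: matrix_vector_mul_assoc matrix_inv_right)
  show "continuous_on UNIV (\<lambda>f. fourier (lcomp M f))"
    by (rule continuous_on_compose2[OF continuous_fourier continuous_lcomp[OF M]]) auto
  have "continuous_on UNIV (scale_l2 c)" for c
    unfolding continuous_on by (auto intro: tendsto_scale_l2)
  then show "continuous_on UNIV (\<lambda>f. scale_l2 (of_real (jacobian M)) (lcomp ?N (fourier f)))"
    by (rule continuous_on_compose2)
       (rule continuous_on_compose2[OF continuous_lcomp[OF N] continuous_fourier], auto)
  fix f :: "(real^'n) l2" and c :: real assume "supported_in (cell c) f"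
  then have i: "integrable lborel (rep_l2 f)" by (rule integrable_supported)
  have "integrable lborel (\<lambda>x. rep_l2 f (M *v x))"
  proof -
    have "integrable (distr lborel borel ((*v) M)) (rep_l2 f)"
      unfolding jacobian(2)[OF M] using i jacobian(1)[OF M] by (subst integrable_density) auto
    then show ?thesis by (subst (asm) integrable_distr_eq) auto
  qed
  then have il: "integrable lborel (rep_l2 (lcomp M f))"
    by (rule integrable_cong_AE_l2[OF rep_lcomp[OF M]])
  have fe: "fourier_integral (rep_l2 (lcomp M f)) \<xi> = of_real (jacobian M) * fourier_integral (rep_l2 f) (?N *v \<xi>)" for \<xi>
  proof -
    have fe: "fourier_integral (rep_l2 (lcomp M f)) \<xi> = (LINT x|lborel. rep_l2 f (M *v x) * cis (- (x \<bullet> \<xi>)))"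
      by (subst fourier_integral_cong_AE[OF rep_lcomp[OF M]]) (auto simp: fourier_integral_cis)
    also have "\<dots> = (LINT x|lborel. rep_l2 f (M *v x) * cis (- ((M *v x) \<bullet> (?N *v \<xi>))))"
      by (simp only: inner_transpose MN)
    also have "\<dots> = of_real (jacobian M) * fourier_integral (rep_l2 f) (?N *v \<xi>)"
      unfolding fourier_integral_cis
      by (rule integral_linear[OF M, of "\<lambda>x. rep_l2 f x * cis (- (x \<bullet> (?N *v \<xi>)))"]) measurable
    finally show ?thesis .
  qed
  show "fourier (lcomp M f) = scale_l2 (of_real (jacobian M)) (lcomp ?N (fourier f))"
    using fourier_integrable[OF il] AE_linear_image[OF N fourier_integrable[OF i]] rep_lcomp[OF N, of "fourier f"]
      rep_scale[of "of_real (jacobian M)" "lcomp ?N (fourier f)"]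
    by (intro l2_eqI, eventually_elim) (simp add: fe)
qed

definition conj_l2 :: "'a::euclidean_space l2 \<Rightarrow> 'a l2" where
  "conj_l2 f = abs_l2 (\<lambda>x. cnj (rep_l2 f x))"

lemma rep_conj: "AE x in lborel. rep_l2 (conj_l2 f) x = cnj (rep_l2 f x)"
  unfolding conj_l2_def
  by (rule rep_abs_l2) (use square_integrable_rep[of f] in \<open>auto simp: square_integrable_def\<close>)

lemma continuous_conj_l2: "continuous_on UNIV conj_l2"
proof (rule lipschitz_continuous_l2[where K=1])
  fix f g :: "'a l2"
  have "cmod (cnj a - cnj b) = cmod (a - b)" for a b
    by (metis complex_cnj_diff complex_mod_cnj)
  then show "(\<integral>\<^sup>+x. ennreal ((cmod (rep_l2 (conj_l2 f) x - rep_l2 (conj_l2 g) x))\<^sup>2) \<partial>lborel)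
     \<le> ennreal 1 * (\<integral>\<^sup>+x. ennreal ((cmod (rep_l2 f x - rep_l2 g x))\<^sup>2) \<partial>lborel)"
    using rep_conj[of f] rep_conj[of g] by (simp, intro nn_integral_mono_AE) auto
qed simp

lemma norm_conj_l2: "norm (conj_l2 f) = norm f"
proof -
  have "ennreal ((norm (conj_l2 f))\<^sup>2) = ennreal ((norm f)\<^sup>2)"
    unfolding norm_sq_nn_integral using rep_conj[of f] by (intro nn_integral_cong_AE) auto
  then have "(norm (conj_l2 f))\<^sup>2 = (norm f)\<^sup>2" by (simp del: ennreal_power)
  then show ?thesis by (rule power2_eq_imp_eq) auto
qed

lemma supported_in_conj: 
  assumes "supported_in S f" shows "supported_in S (conj_l2 f)"
  using assms rep_conj[of f] unfolding supported_in_def by eventually_elim auto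

text \<open>
  For functions with bounded support this is Fubini's theorem for the double integral of
  \<open>f x * cnj (g \<xi>) * cis (- (x \<bullet> \<xi>))\<close>; both sides are continuous in \<open>f\<close> and in \<open>g\<close>.
\<close>

lemma fourier_adjoint:
  fixes f g :: "(real^'n) l2"
  shows "cinner (fourier f) g = cinner f (conj_l2 (fourier (conj_l2 g)))"
proof -
  have base: "cinner (fourier f) g = cinner f (conj_l2 (fourier (conj_l2 g)))"
    if f: "supported_in (cell c) f" and g: "supported_in (cell d) g" for f g :: "(real^'n) l2" and c d
  proof -
    note iF = integrable_supported[OF f]
    note iG = integrable_supported[OF supported_in_conj[OF g]]
    have "cinner (fourier f) g = (LINT \<xi>|lborel. (LINT x|lborel. rep_l2 f x * cis (- (x \<bullet> \<xi>))) * cnj (cnj (rep_l2 (conj_l2 g) \<xi>)))"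
      by (rule cinner_eqI)
         (use fourier_integrable[OF iF] rep_conj[of g] in \<open>auto simp: fourier_integral_cis[symmetric] elim: eventually_mono\<close>)
    also have "\<dots> = (LINT \<xi>|lborel. LINT x|lborel. rep_l2 f x * rep_l2 (conj_l2 g) \<xi> * cis (- (x \<bullet> \<xi>)))"
      by (intro Bochner_Integration.integral_cong refl) (simp only: complex_cnj_cnj integral_mult_left_zero[symmetric], simp only: mult_ac)
    also have "\<dots> = (LINT x|lborel. LINT \<xi>|lborel. rep_l2 f x * rep_l2 (conj_l2 g) \<xi> * cis (- (x \<bullet> \<xi>)))"
    proof (rule lborel_pair.Fubini_integral)
      have p: "integrable (lborel \<Otimes>\<^sub>M lborel) (\<lambda>(x, \<xi>). rep_l2 f x * rep_l2 (conj_l2 g) \<xi>)"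
      proof (rule lborel_pair.Fubini_integrable)
        show "integrable lborel (\<lambda>x. LINT \<xi>|lborel. norm (case (x, \<xi>) of (x, \<xi>) \<Rightarrow> rep_l2 f x * rep_l2 (conj_l2 g) \<xi>))"
          using iF by (simp add: norm_mult)
        show "AE x in lborel. integrable lborel (\<lambda>\<xi>. case (x, \<xi>) of (x, \<xi>) \<Rightarrow> rep_l2 f x * rep_l2 (conj_l2 g) \<xi>)"
          using iG by simp
      qed measurable
      show "integrable (lborel \<Otimes>\<^sub>M lborel) (\<lambda>(x, \<xi>). rep_l2 f x * rep_l2 (conj_l2 g) \<xi> * cis (- (x \<bullet> \<xi>)))"
        by (rule Bochner_Integration.integrable_bound[OF p]) (auto simp: norm_mult)
    qed
    also have "\<dots> = (LINT x|lborel. rep_l2 f x * cnj (cnj (LINT \<xi>|lborel. rep_l2 (conj_l2 g) \<xi> * cis (- (\<xi> \<bullet> x)))))"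
      by (intro Bochner_Integration.integral_cong refl) (simp only: complex_cnj_cnj integral_mult_right_zero[symmetric] inner_commute mult.assoc)
    also have "\<dots> = cinner f (conj_l2 (fourier (conj_l2 g)))"
      unfolding fourier_integral_cis[symmetric]
      by (rule cinner_eqI[symmetric])
         (use fourier_integrable[OF iG] rep_conj[of "fourier (conj_l2 g)"] in \<open>auto elim: eventually_elim2\<close>)
    finally show ?thesis .
  qed
  have cl: "continuous_on UNIV (\<lambda>f. cinner (F f) g)" "continuous_on UNIV (\<lambda>f. cinner g (F f))"
    if "continuous_on UNIV F" for F :: "(real^'n) l2 \<Rightarrow> (real^'n) l2" and g
    using that unfolding continuous_on by (auto intro: tendsto_cinner)
  have cc: "continuous_on UNIV (\<lambda>g :: (real^'n) l2. conj_l2 (fourier (conj_l2 g)))"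
    by (rule continuous_on_compose2[OF continuous_conj_l2 continuous_on_compose2[OF continuous_fourier continuous_conj_l2]]) auto
  have half: "cinner (fourier f) g = cinner f (conj_l2 (fourier (conj_l2 g)))"
    if f: "supported_in (cell c) f" for f g :: "(real^'n) l2" and c
  proof (rule l2_continuous_ext[where F="\<lambda>g. cinner (fourier f) g" and G="\<lambda>g. cinner f (conj_l2 (fourier (conj_l2 g)))"])
    show "continuous_on UNIV (\<lambda>g. cinner (fourier f) g)" by (rule cl(2)[OF continuous_on_id])
    show "continuous_on UNIV (\<lambda>g. cinner f (conj_l2 (fourier (conj_l2 g))))" by (rule cl(2)[OF cc])
  qed (rule base[OF f])
  show ?thesis
  proof (rule l2_continuous_ext[where F="\<lambda>f. cinner (fourier f) g" and G="\<lambda>f. cinner f (conj_l2 (fourier (conj_l2 g)))"])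
    show "continuous_on UNIV (\<lambda>f. cinner (fourier f) g)" by (rule cl(1)[OF continuous_fourier])
    show "continuous_on UNIV (\<lambda>f. cinner f (conj_l2 (fourier (conj_l2 g))))" by (rule cl(1)[OF continuous_on_id])
  qed (rule half)
qed

text \<open>
  The candidate for the preimage is the adjoint at \<open>g\<close>, divided by \<open>(2\<pi>)\<^sup>n\<close>. Its norm is known because
  the adjoint is, up to conjugations, the transform itself. The distance from its image to \<open>g\<close> is
  then computed to be \<open>0\<close>.
\<close>

lemma fourier_surj:
  fixes g :: "(real^'n) l2"
  obtains f where "fourier f = g"
proof -
  define C where "C = (2 * pi) ^ CARD('n)"
  have C: "C > 0" by (simp add: C_def)
  define h where "h = conj_l2 (fourier (conj_l2 g))"
  have h: "(norm h)\<^sup>2 = C * (norm g)\<^sup>2" by (simp add: h_def norm_conj_l2 norm_fourier C_def)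
  define f where "f = scale_l2 (of_real (1 / C)) h"
  have nf: "(norm f)\<^sup>2 = (norm g)\<^sup>2 / C"
  proof -
    have "(norm f)\<^sup>2 = (1 / C)\<^sup>2 * (norm h)\<^sup>2"
      using C by (simp add: f_def norm_scale_l2 power_mult_distrib norm_divide power_divide)
    then show ?thesis using C by (simp add: h power2_eq_square[of "1 / C"])
  qed
  have "cinner (fourier f) g = cinner f h" by (simp add: fourier_adjoint h_def)
  also have "\<dots> = of_real ((norm g)\<^sup>2)"
    using C by (simp add: f_def cinner_scale_left cinner_self h del: of_real_power)
  finally have i: "fourier f \<bullet> g = (norm g)\<^sup>2" by (simp add: inner_l2_def)
  have "(norm (fourier f - g))\<^sup>2 = (norm (fourier f))\<^sup>2 - 2 * (fourier f \<bullet> g) + (norm g)\<^sup>2"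
    unfolding power2_norm_eq_inner by (simp add: inner_commute algebra_simps)
  also have "\<dots> = 0"
    using C unfolding i norm_fourier C_def[symmetric] nf by simp
  finally show ?thesis using that[of f] by simp
qed

section \<open>Periodisation and frame sums\<close>

abbreviation ft :: "(real^'n) l2 \<Rightarrow> real^'n \<Rightarrow> complex" where
  "ft f \<equiv> rep_l2 (fourier f)"

lemma finite_int_lattice_bounded: "finite {s :: real^'n. s \<in> int_lattice \<and> (\<forall>i. \<bar>s $ i\<bar> \<le> R)}"
proof (rule finite_subset)
  let ?m = "\<lceil>R\<rceil>"
  show "{s :: real^'n. s \<in> int_lattice \<and> (\<forall>i. \<bar>s $ i\<bar> \<le> R)} \<subseteq> (\<lambda>f. \<chi> i. of_int (f i)) ` (\<Pi>\<^sub>E i\<in>UNIV. {- ?m..?m})"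
  proof
    fix s :: "real^'n" assume s: "s \<in> {s. s \<in> int_lattice \<and> (\<forall>i. \<bar>s $ i\<bar> \<le> R)}"
    then have "\<forall>i. \<exists>z. s $ i = of_int z" by (auto simp: int_lattice_def Ints_def)
    then obtain f where f: "\<And>i. s $ i = of_int (f i)" by metis
    have "f i \<in> {- ?m..?m}" for i
    proof -
      have "\<bar>of_int (f i)\<bar> \<le> R" using s f by auto
      then show ?thesis by (simp add: abs_le_iff) linarith
    qed
    then show "s \<in> (\<lambda>f. \<chi> i. of_int (f i)) ` (\<Pi>\<^sub>E i\<in>UNIV. {- ?m..?m})"
      by (intro image_eqI[of _ _ f]) (auto simp: vec_eq_iff f)
  qed
  show "finite ((\<lambda>f. \<chi> i. of_int (f i)) ` (\<Pi>\<^sub>E i\<in>(UNIV :: 'n set). {- ?m..?m}) :: (real^'n) set)"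
    by (intro finite_imageI finite_PiE) auto
qed

definition tile :: "real^'n \<Rightarrow> (real^'n) set" where
  "tile m = {\<xi>. \<xi> - (2 * pi) *\<^sub>R m \<in> cell (2 * pi)}"

lemma tile_measurable [measurable]: "tile m \<in> sets borel"
  unfolding tile_def by measurable

lemma bounded_tile: "bounded (tile m)"
proof -
  have "tile m = (\<lambda>x. (2 * pi) *\<^sub>R m + x) ` cell (2 * pi)"
    by (auto simp: tile_def image_iff intro!: bexI[of _ "_ - (2 * pi) *\<^sub>R m"])
  then show ?thesis by (simp add: bounded_translation bounded_cell)
qed

lemma tile_unique:
  assumes "\<xi> \<in> tile m" "\<xi> + (2 * pi) *\<^sub>R t \<in> tile l" "m \<in> int_lattice" "l \<in> int_lattice" "t \<in> int_lattice"
  shows "t = l - m"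
proof -
  have eq: "(\<xi> - (2 * pi) *\<^sub>R m) + (2 * pi) *\<^sub>R (t - (l - m)) = \<xi> + (2 * pi) *\<^sub>R t - (2 * pi) *\<^sub>R l"
    by (simp add: algebra_simps)
  have "(\<xi> - (2 * pi) *\<^sub>R m) + (2 * pi) *\<^sub>R (t - (l - m)) \<in> cell (2 * pi)"
    unfolding eq using assms(2) by (simp add: tile_def)
  then have "t - (l - m) = 0"
    using assms by (intro cell_unique[of "t - (l - m)" "\<xi> - (2 * pi) *\<^sub>R m"]) (auto simp: tile_def int_lattice_diff)
  then show ?thesis by simp
qed

lemma tile_shift: "\<xi> \<in> tile m \<Longrightarrow> \<xi> + (2 * pi) *\<^sub>R t \<in> tile (m + t)"
  by (simp add: tile_def algebra_simps)

lemma AE_all_tiles: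
  assumes "\<And>m :: real^'n. m \<in> int_lattice \<Longrightarrow> AE \<xi> in lborel. \<xi> \<in> tile m \<longrightarrow> P \<xi>"
  shows "AE \<xi> in lborel. P \<xi>"
proof -
  have "AE \<xi> in lborel. \<forall>m\<in>int_lattice. \<xi> \<in> tile m \<longrightarrow> P \<xi>"
    by (subst AE_ball_countable) (use assms in auto)
  then show ?thesis
  proof eventually_elim
    case (elim \<xi>)
    then show ?case using cell_exists[of "2 * pi" \<xi>] by (auto simp: tile_def)
  qed
qed

text \<open>
  The finitely many lattice vectors that move the cell of side \<open>a\<close> so as to meet the cell of side \<open>b\<close>;
  they are the indices of all lattice sums over test functions.
\<close>

definition overlaps :: "real \<Rightarrow> real \<Rightarrow> real \<Rightarrow> (real^'n) set" where
  "overlaps w a b = {s \<in> int_lattice. \<exists>\<xi>\<in>cell a. \<xi> + w *\<^sub>R s \<in> cell b}"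

lemma finite_overlaps: 
  assumes "w > 0" shows "finite (overlaps w a b :: (real^'n) set)"
proof (rule finite_subset[OF _ finite_int_lattice_bounded[of "(\<bar>a\<bar> + \<bar>b\<bar>) / w"]])
  show "overlaps w a b \<subseteq> {s :: real^'n. s \<in> int_lattice \<and> (\<forall>i. \<bar>s $ i\<bar> \<le> (\<bar>a\<bar> + \<bar>b\<bar>) / w)}"
  proof
    fix s :: "real^'n" assume "s \<in> overlaps w a b"
    then obtain \<xi> where s: "s \<in> int_lattice" "\<xi> \<in> cell a" "\<xi> + w *\<^sub>R s \<in> cell b" by (auto simp: overlaps_def)
    have "\<bar>s $ i\<bar> \<le> (\<bar>a\<bar> + \<bar>b\<bar>) / w" for i
    proof -
      have "- a / 2 \<le> \<xi> $ i" "\<xi> $ i < a / 2" "- b / 2 \<le> \<xi> $ i + w * s $ i" "\<xi> $ i + w * s $ i < b / 2"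
        using s(2,3) unfolding cell_def by auto
      then have "\<bar>w * s $ i\<bar> \<le> \<bar>a\<bar> + \<bar>b\<bar>" by linarith
      then show ?thesis using assms by (simp add: abs_mult field_simps)
    qed
    then show "s \<in> {s. s \<in> int_lattice \<and> (\<forall>i. \<bar>s $ i\<bar> \<le> (\<bar>a\<bar> + \<bar>b\<bar>) / w)}" using s(1) by simp
  qed
qed

lemma overlaps_subset: "overlaps w a b \<subseteq> int_lattice"
  by (auto simp: overlaps_def)

text \<open>
  Such functions serve as Fourier transforms: for them all periodisations are finite sums.
\<close>

definition test_function :: "(real^'n \<Rightarrow> complex) \<Rightarrow> bool" where
  "test_function u \<longleftrightarrow> u \<in> borel_measurable borel \<and> (\<exists>C. \<forall>x. cmod (u x) \<le> C) \<and> (\<exists>c. \<forall>x. x \<notin> cell c \<longrightarrow> u x = 0)"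

lemma test_functionE:
  assumes "test_function u"
  obtains C c where "C \<ge> 0" "\<And>x. cmod (u x) \<le> C" "\<And>x. x \<notin> cell c \<Longrightarrow> u x = 0" "u \<in> borel_measurable borel"
proof -
  obtain C c where "\<And>x. cmod (u x) \<le> C" "\<And>x. x \<notin> cell c \<Longrightarrow> u x = 0" "u \<in> borel_measurable borel"
    using assms by (auto simp: test_function_def)
  then show ?thesis using that[of C c] norm_ge_zero order_trans by blast
qed

text \<open>
  Bounded supports are admitted because every bounded set lies in some cell centred at the origin.
\<close>

lemma test_functionI:
  assumes "u \<in> borel_measurable borel" "\<And>x. cmod (u x) \<le> C" "bounded E" "\<And>x. x \<notin> E \<Longrightarrow> u x = 0"
  shows "test_function u"
proof -
  obtain c where "E \<subseteq> cell c" using bounded_subset_cell[OF assms(3)] .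
  then show ?thesis unfolding test_function_def using assms by blast
qed

lemma test_function_square_integrable:
  assumes "test_function u" shows "square_integrable u"
proof -
  obtain C c where u: "\<And>x. cmod (u x) \<le> C" "\<And>x. x \<notin> cell c \<Longrightarrow> u x = 0" "u \<in> borel_measurable borel"
    using test_functionE[OF assms] by metis
  have "square_integrable (\<lambda>x. indicator (cell c) x *\<^sub>R u x)"
    by (rule square_integrable_indicator_bounded[where C=C]) (use u emeasure_cell_finite in auto)
  moreover have "(\<lambda>x. indicator (cell c) x *\<^sub>R u x) = u" using u(2) by (auto simp: indicator_def)
  ultimately show ?thesis by simp
qed

lemma cinner_translate_fourier:
  fixes f \<phi> :: "(real^'n) l2"
  assumes u: "u \<in> borel_measurable borel" "AE \<xi> in lborel. ft f \<xi> = u \<xi>"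
  shows "of_real ((2 * pi) ^ CARD('n)) * cinner f (translate k \<phi>) = (LINT \<xi>|lborel. u \<xi> * cnj (ft \<phi> \<xi>) * texp (2 * pi) k \<xi>)"
proof -
  have "of_real ((2 * pi) ^ CARD('n)) * cinner f (translate k \<phi>) = cinner (fourier f) (modulate k (fourier \<phi>))"
    by (simp only: cinner_fourier[symmetric] fourier_translate)
  also have "\<dots> = (LINT \<xi>|lborel. u \<xi> * cnj (cis (- (k \<bullet> \<xi>)) * ft \<phi> \<xi>))"
    by (rule cinner_eqI[OF u(2) rep_modulate u(1)]) measurable
  also have "\<dots> = (LINT \<xi>|lborel. u \<xi> * cnj (ft \<phi> \<xi>) * texp (2 * pi) k \<xi>)"
    by (intro Bochner_Integration.integral_cong refl) (simp add: texp_def cis_cnj mult_ac)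
  finally show ?thesis .
qed

text \<open>
  The \<open>2\<pi>\<close>-periodisation of \<open>u * cnj v\<close>.
\<close>

definition bracket :: "(real^'n \<Rightarrow> complex) \<Rightarrow> (real^'n \<Rightarrow> complex) \<Rightarrow> real^'n \<Rightarrow> complex" where
  "bracket u v \<xi> = (LINT s|count_space int_lattice. u (\<xi> + (2 * pi) *\<^sub>R s) * cnj (v (\<xi> + (2 * pi) *\<^sub>R s)))"

lemma bracket_measurable [measurable]:
  assumes [measurable]: "u \<in> borel_measurable borel" "v \<in> borel_measurable borel"
  shows "bracket u v \<in> borel_measurable borel"
  unfolding bracket_def[abs_def] by (rule measurable_integral_count_space) auto

lemma bracket_eq_sum:
  assumes "\<And>x. x \<notin> cell c \<Longrightarrow> u x = 0" "\<xi> \<in> cell (2 * pi)"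
  shows "bracket u v \<xi> = (\<Sum>s\<in>overlaps (2 * pi) (2 * pi) c. u (\<xi> + (2 * pi) *\<^sub>R s) * cnj (v (\<xi> + (2 * pi) *\<^sub>R s)))"
  unfolding bracket_def
proof (rule integral_count_space_finite_subset)
  fix s :: "real^'a" assume "s \<in> int_lattice" "s \<notin> overlaps (2 * pi) (2 * pi) c"
  then have "\<xi> + (2 * pi) *\<^sub>R s \<notin> cell c" using assms(2) by (auto simp: overlaps_def)
  then show "u (\<xi> + (2 * pi) *\<^sub>R s) * cnj (v (\<xi> + (2 * pi) *\<^sub>R s)) = 0" by (simp add: assms(1))
qed (auto simp: overlaps_subset finite_overlaps)

lemma square_integrable_mult_bounded:
  assumes "square_integrable f" "g \<in> borel_measurable borel" "\<And>x. cmod (g x) \<le> C"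
  shows "square_integrable (\<lambda>x. g x * f x)"
proof (rule square_integrableI)
  have C: "C \<ge> 0" using assms(3)[of undefined] norm_ge_zero order_trans by blast
  have [measurable]: "f \<in> borel_measurable borel" "g \<in> borel_measurable borel"
    using assms by (auto simp: square_integrable_def)
  show "(\<lambda>x. g x * f x) \<in> borel_measurable borel" by measurable
  have "(\<integral>\<^sup>+x. ennreal ((cmod (g x * f x))\<^sup>2) \<partial>lborel) \<le> (\<integral>\<^sup>+x. ennreal (C\<^sup>2) * ennreal ((cmod (f x))\<^sup>2) \<partial>lborel)"
    by (intro nn_integral_mono) 
       (auto simp: norm_mult power_mult_distrib ennreal_mult[symmetric] intro!: ennreal_leI mult_right_mono power_mono assms
          simp del: ennreal_power)
  also have "\<dots> = ennreal (C\<^sup>2) * (\<integral>\<^sup>+x. ennreal ((cmod (f x))\<^sup>2) \<partial>lborel)"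
    by (rule nn_integral_cmult) measurable
  also have "\<dots> < \<infinity>"
    using assms(1) by (auto simp: square_integrable_def integrable_iff_bounded ennreal_mult_less_top simp del: ennreal_power)
  finally show "(\<integral>\<^sup>+x. ennreal ((cmod (g x * f x))\<^sup>2) \<partial>lborel) < \<infinity>" .
qed

lemma square_integrable_sum:
  "(\<And>i. i \<in> I \<Longrightarrow> square_integrable (f i)) \<Longrightarrow> square_integrable (\<lambda>x. \<Sum>i\<in>I. f i x)"
  by (induction I rule: infinite_finite_induct) (auto simp: square_integrable_zero square_integrable_add)

lemma square_integrable_cnj: "square_integrable f \<Longrightarrow> square_integrable (\<lambda>x. cnj (f x))"
  by (auto simp: square_integrable_def)

lemma square_integrable_bracket:
  assumes u: "test_function u" and v: "square_integrable v"
  shows "square_integrable (\<lambda>\<xi>. indicator (cell (2 * pi)) \<xi> *\<^sub>R bracket u v \<xi>)"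
proof -
  obtain C c where u: "\<And>x. cmod (u x) \<le> C" "\<And>x. x \<notin> cell c \<Longrightarrow> u x = 0" "u \<in> borel_measurable borel"
    using test_functionE[OF u] by metis
  note [measurable] = u(3)
  have eq: "(\<lambda>\<xi>. indicator (cell (2 * pi)) \<xi> *\<^sub>R bracket u v \<xi>)
      = (\<lambda>\<xi>. complex_of_real (indicator (cell (2 * pi)) \<xi>) * (\<Sum>s\<in>overlaps (2 * pi) (2 * pi) c. u (\<xi> + (2 * pi) *\<^sub>R s) * cnj (v (\<xi> + (2 * pi) *\<^sub>R s))))"
  proof
    fix \<xi>
    show "indicator (cell (2 * pi)) \<xi> *\<^sub>R bracket u v \<xi> = complex_of_real (indicator (cell (2 * pi)) \<xi>) * (\<Sum>s\<in>overlaps (2 * pi) (2 * pi) c. u (\<xi> + (2 * pi) *\<^sub>R s) * cnj (v (\<xi> + (2 * pi) *\<^sub>R s)))"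
      using bracket_eq_sum[of c u \<xi> v] u(2) by (cases "\<xi> \<in> cell (2 * pi)") auto
  qed
  show ?thesis unfolding eq
  proof (rule square_integrable_mult_bounded[where C=1], rule square_integrable_sum)
    fix s
    have "square_integrable (\<lambda>\<xi>. cnj (v (\<xi> + (2 * pi) *\<^sub>R s)))"
      using square_integrable_translate[OF v, of "- (2 * pi) *\<^sub>R s"] by (intro square_integrable_cnj) simp
    then show "square_integrable (\<lambda>\<xi>. u (\<xi> + (2 * pi) *\<^sub>R s) * cnj (v (\<xi> + (2 * pi) *\<^sub>R s)))"
      by (rule square_integrable_mult_bounded[where C=C]) (use u in auto)
  qed (auto simp: indicator_def)
qed

text \<open>
  By Plancherel's identity the inner products of \<open>f\<close> with the translates of \<open>\<phi>\<close> are, up to a constant,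
  the Fourier coefficients on the cell of side \<open>2\<pi>\<close> of the periodisation, to which Parseval's
  identity applies.
\<close>

lemma nn_integral_bracket:
  fixes f \<phi> :: "(real^'n) l2"
  assumes u: "test_function u" and f: "AE \<xi> in lborel. ft f \<xi> = u \<xi>"
  shows "(\<integral>\<^sup>+k. ennreal ((cmod (cinner f (translate k \<phi>)))\<^sup>2) \<partial>count_space int_lattice)
    = ennreal (1 / (2 * pi) ^ CARD('n)) * (\<integral>\<^sup>+\<xi>\<in>cell (2 * pi). ennreal ((cmod (bracket u (ft \<phi>) \<xi>))\<^sup>2) \<partial>lborel)"
proof -
  have um [measurable]: "u \<in> borel_measurable borel" using u by (simp add: test_function_def)
  define P where "P = (2 * pi) ^ CARD('n)"
  have P: "P > 0" by (simp add: P_def)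
  \<comment> \<open>Conjugating the periodisation turns the phase into that of the Fourier coefficients.\<close>
  define g where "g = abs_l2 (\<lambda>\<xi>. cnj (indicator (cell (2 * pi)) \<xi> *\<^sub>R bracket u (ft \<phi>) \<xi>))"
  have g: "AE \<xi> in lborel. rep_l2 g \<xi> = cnj (indicator (cell (2 * pi)) \<xi> *\<^sub>R bracket u (ft \<phi>) \<xi>)"
    unfolding g_def
    by (intro rep_abs_l2 square_integrable_cnj square_integrable_bracket u square_integrable_rep)
  have ce: "cmod (LINT \<xi>|lborel. rep_l2 g \<xi> * cnj (texp (2 * pi) k \<xi>)) = P * cmod (cinner f (translate k \<phi>))"
    if k: "k \<in> int_lattice" for k
  proof -
    have "(LINT \<xi>|lborel. u \<xi> * cnj (ft \<phi> \<xi>) * texp (2 * pi) k \<xi>) =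
      (LINT \<xi>|lborel. indicator (cell (2 * pi)) \<xi> *\<^sub>R (LINT s|count_space int_lattice.
         u (\<xi> + (2 * pi) *\<^sub>R s) * cnj (ft \<phi> (\<xi> + (2 * pi) *\<^sub>R s)) * texp (2 * pi) k (\<xi> + (2 * pi) *\<^sub>R s)))"
    proof (rule integral_tiling(1))
      show "integrable lborel (\<lambda>\<xi>. u \<xi> * cnj (ft \<phi> \<xi>) * texp (2 * pi) k \<xi>)"
        by (rule integrable_mult_bounded[OF square_integrable_mult_integrable[OF test_function_square_integrable[OF u] square_integrable_rep], where C=1]) auto
    qed auto
    also have "\<dots> = (LINT \<xi>|lborel. indicator (cell (2 * pi)) \<xi> *\<^sub>R (bracket u (ft \<phi>) \<xi> * texp (2 * pi) k \<xi>))"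
    proof (intro Bochner_Integration.integral_cong refl arg_cong2[where f=scaleR])
      fix \<xi>
      have "(LINT s|count_space int_lattice. u (\<xi> + (2 * pi) *\<^sub>R s) * cnj (ft \<phi> (\<xi> + (2 * pi) *\<^sub>R s)) * texp (2 * pi) k (\<xi> + (2 * pi) *\<^sub>R s))
        = (LINT s|count_space int_lattice. (u (\<xi> + (2 * pi) *\<^sub>R s) * cnj (ft \<phi> (\<xi> + (2 * pi) *\<^sub>R s))) * texp (2 * pi) k \<xi>)"
        by (intro Bochner_Integration.integral_cong refl) (simp add: texp_periodic k)
      then show "(LINT s|count_space int_lattice. u (\<xi> + (2 * pi) *\<^sub>R s) * cnj (ft \<phi> (\<xi> + (2 * pi) *\<^sub>R s)) * texp (2 * pi) k (\<xi> + (2 * pi) *\<^sub>R s))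
        = bracket u (ft \<phi>) \<xi> * texp (2 * pi) k \<xi>"
        by (simp add: bracket_def)
    qed
    also have "\<dots> = (LINT \<xi>|lborel. cnj (rep_l2 g \<xi> * cnj (texp (2 * pi) k \<xi>)))"
      by (rule integral_cong_AE) (use g in \<open>auto elim!: eventually_mono\<close>)
    also have "\<dots> = cnj (LINT \<xi>|lborel. rep_l2 g \<xi> * cnj (texp (2 * pi) k \<xi>))"
      by (rule Bochner_Integration.integral_cnj)
    finally have "of_real P * cinner f (translate k \<phi>) = cnj (LINT \<xi>|lborel. rep_l2 g \<xi> * cnj (texp (2 * pi) k \<xi>))"
      using cinner_translate_fourier[OF um f, of k \<phi>] by (simp add: P_def)
    then show ?thesis using P by (metis abs_of_pos complex_mod_cnj norm_mult norm_of_real)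
  qed
  have "AE \<xi> in lborel. \<xi> \<notin> cell (2 * pi) \<longrightarrow> rep_l2 g \<xi> = 0" using g by eventually_elim auto
  from parseval_cell[OF _ this]
  have "((\<lambda>k. (cmod (LINT \<xi>|lborel. rep_l2 g \<xi> * cnj (texp (2 * pi) k \<xi>)))\<^sup>2) has_sum (P * (norm g)\<^sup>2)) int_lattice"
    by (simp add: P_def)
  then have "((\<lambda>k. (P * cmod (cinner f (translate k \<phi>)))\<^sup>2) has_sum (P * (norm g)\<^sup>2)) int_lattice"
    by (subst (asm) has_sum_cong) (auto simp: ce)
  from has_sum_cmult_right[OF this, of "1 / P\<^sup>2"]
  have "((\<lambda>k. (cmod (cinner f (translate k \<phi>)))\<^sup>2) has_sum (1 / P * (norm g)\<^sup>2)) int_lattice"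
    using P by (simp add: power_mult_distrib power2_eq_square)
  then have "(\<integral>\<^sup>+k. ennreal ((cmod (cinner f (translate k \<phi>)))\<^sup>2) \<partial>count_space int_lattice) = ennreal (1 / P * (norm g)\<^sup>2)"
    using P by (subst (asm) has_sum_nonneg_iff_nn_integral) auto
  also have "\<dots> = ennreal (1 / P) * ennreal ((norm g)\<^sup>2)" using P by (subst ennreal_mult[symmetric]) simp_all
  also have "ennreal ((norm g)\<^sup>2) = (\<integral>\<^sup>+\<xi>\<in>cell (2 * pi). ennreal ((cmod (bracket u (ft \<phi>) \<xi>))\<^sup>2) \<partial>lborel)"
    unfolding norm_sq_nn_integral using g
    by (intro nn_integral_cong_AE) (auto elim!: eventually_mono simp: indicator_def)
  finally show ?thesis unfolding P_def .
qed

definition frame_sum :: "(real^'n) l2 set \<Rightarrow> (real^'n) l2 \<Rightarrow> ennreal" where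
  "frame_sum \<Phi> f = (\<integral>\<^sup>+i. ennreal ((cmod (cinner f (translate (fst i) (snd i))))\<^sup>2) \<partial>count_space (int_lattice \<times> \<Phi>))"

lemma frame_sum_iterated:
  assumes "countable \<Phi>"
  shows "frame_sum \<Phi> f = (\<integral>\<^sup>+\<phi>. \<integral>\<^sup>+k. ennreal ((cmod (cinner f (translate k \<phi>)))\<^sup>2) \<partial>count_space int_lattice \<partial>count_space \<Phi>)"
proof -
  interpret pair_sigma_finite "count_space int_lattice :: (real^'a) measure" "count_space \<Phi>"
    by (intro pair_sigma_finite.intro sigma_finite_measure_count_space_countable assms countable_int_lattice)
  have p: "count_space int_lattice \<Otimes>\<^sub>M count_space \<Phi> = count_space (int_lattice \<times> \<Phi>)"
    by (rule pair_measure_countable) (use assms in auto)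
  show ?thesis
    unfolding frame_sum_def p[symmetric]
    by (subst nn_integral_snd[symmetric]) (auto simp: p)
qed

lemma frame_sum_bracket:
  fixes f :: "(real^'n) l2"
  assumes "countable \<Phi>" and u: "test_function u" and f: "AE \<xi> in lborel. ft f \<xi> = u \<xi>"
  shows "frame_sum \<Phi> f = ennreal (1 / (2 * pi) ^ CARD('n)) *
    (\<integral>\<^sup>+\<xi>\<in>cell (2 * pi). (\<integral>\<^sup>+\<phi>. ennreal ((cmod (bracket u (ft \<phi>) \<xi>))\<^sup>2) \<partial>count_space \<Phi>) \<partial>lborel)"
proof -
  have um [measurable]: "u \<in> borel_measurable borel" using u by (simp add: test_function_def)
  have "frame_sum \<Phi> f = (\<integral>\<^sup>+\<phi>. ennreal (1 / (2 * pi) ^ CARD('n)) *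
     (\<integral>\<^sup>+\<xi>. ennreal ((cmod (bracket u (ft \<phi>) \<xi>))\<^sup>2) * indicator (cell (2 * pi)) \<xi> \<partial>lborel) \<partial>count_space \<Phi>)"
    unfolding frame_sum_iterated[OF assms(1)] nn_integral_bracket[OF u f] ..
  also have "\<dots> = ennreal (1 / (2 * pi) ^ CARD('n)) * (\<integral>\<^sup>+\<phi>.
     (\<integral>\<^sup>+\<xi>. ennreal ((cmod (bracket u (ft \<phi>) \<xi>))\<^sup>2) * indicator (cell (2 * pi)) \<xi> \<partial>lborel) \<partial>count_space \<Phi>)"
    by (rule nn_integral_cmult) simp
  also have "(\<integral>\<^sup>+\<phi>. (\<integral>\<^sup>+\<xi>. ennreal ((cmod (bracket u (ft \<phi>) \<xi>))\<^sup>2) * indicator (cell (2 * pi)) \<xi> \<partial>lborel) \<partial>count_space \<Phi>)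
     = (\<integral>\<^sup>+\<xi>. (\<integral>\<^sup>+\<phi>. ennreal ((cmod (bracket u (ft \<phi>) \<xi>))\<^sup>2) * indicator (cell (2 * pi)) \<xi> \<partial>count_space \<Phi>) \<partial>lborel)"
    by (rule nn_integral_count_space_swap[OF assms(1)]) measurable
  also have "\<dots> = (\<integral>\<^sup>+\<xi>\<in>cell (2 * pi). (\<integral>\<^sup>+\<phi>. ennreal ((cmod (bracket u (ft \<phi>) \<xi>))\<^sup>2) \<partial>count_space \<Phi>) \<partial>lborel)"
    by (simp add: nn_integral_multc)
  finally show ?thesis .
qed

section \<open>Kernels of frame sums\<close>

lemma fourier_summable_iff:
  "fourier_summable \<Phi> \<xi> \<eta> \<longleftrightarrow> integrable (count_space \<Phi>) (\<lambda>\<phi>. ft \<phi> \<xi> * cnj (ft \<phi> \<eta>))"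
  unfolding fourier_summable_def summable_on_iff_abs_summable_on_complex abs_summable_equivalent
    Infinite_Set_Sum.abs_summable_on_def ..

text \<open>
  Both sides are \<open>0\<close> when the sum does not converge absolutely, which for complex terms is the same as
  not converging.
\<close>

lemma fourier_sum_eq:
  "fourier_sum \<Phi> \<xi> \<eta> = (LINT \<phi>|count_space \<Phi>. ft \<phi> \<xi> * cnj (ft \<phi> \<eta>))"
proof (cases "fourier_summable \<Phi> \<xi> \<eta>")
  case True
  then have "Infinite_Set_Sum.abs_summable_on (\<lambda>\<phi>. ft \<phi> \<xi> * cnj (ft \<phi> \<eta>)) \<Phi>"
    unfolding fourier_summable_iff Infinite_Set_Sum.abs_summable_on_def .
  from infsetsum_infsum[OF this] show ?thesis
    unfolding fourier_sum_def infsetsum_def by simp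
next
  case False
  then have "fourier_sum \<Phi> \<xi> \<eta> = 0"
    unfolding fourier_sum_def fourier_summable_def by (rule infsum_not_exists)
  moreover have "(LINT \<phi>|count_space \<Phi>. ft \<phi> \<xi> * cnj (ft \<phi> \<eta>)) = 0"
    using False unfolding fourier_summable_iff by (rule not_integrable_integral_eq)
  ultimately show ?thesis by simp
qed

text \<open>
  The value of the kernel on the diagonal, also known as the spectral function of the space generated
  by \<open>\<Phi>\<close>.
\<close>

definition spectral :: "(real^'n) l2 set \<Rightarrow> real^'n \<Rightarrow> ennreal" where
  "spectral \<Phi> \<xi> = (\<integral>\<^sup>+\<phi>. ennreal ((cmod (ft \<phi> \<xi>))\<^sup>2) \<partial>count_space \<Phi>)"

lemma spectral_measurable [measurable]:
  "countable \<Phi> \<Longrightarrow> spectral \<Phi> \<in> borel_measurable borel"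
  unfolding spectral_def[abs_def] by (rule measurable_nn_integral_count_space) auto

text \<open>
  By the inequality of the means, applied to each term, the kernel is controlled by its values on the
  diagonal.
\<close>

lemma fourier_sum_bound:
  assumes "spectral \<Phi> \<xi> \<le> 1" "spectral \<Phi> \<eta> \<le> 1"
  shows "fourier_summable \<Phi> \<xi> \<eta>" "cmod (fourier_sum \<Phi> \<xi> \<eta>) \<le> 1"
proof -
  have "(\<integral>\<^sup>+\<phi>. ennreal (cmod (ft \<phi> \<xi> * cnj (ft \<phi> \<eta>))) \<partial>count_space \<Phi>)
     \<le> (\<integral>\<^sup>+\<phi>. ennreal (1/2) * ennreal ((cmod (ft \<phi> \<xi>))\<^sup>2) + ennreal (1/2) * ennreal ((cmod (ft \<phi> \<eta>))\<^sup>2) \<partial>count_space \<Phi>)"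
  proof (rule nn_integral_mono)
    fix \<phi>
    have "a * b \<le> 1/2 * a\<^sup>2 + 1/2 * b\<^sup>2" for a b :: real
      using zero_le_power2[of "a - b"] by (simp add: power2_eq_square algebra_simps)
    then have "cmod (ft \<phi> \<xi> * cnj (ft \<phi> \<eta>)) \<le> 1/2 * (cmod (ft \<phi> \<xi>))\<^sup>2 + 1/2 * (cmod (ft \<phi> \<eta>))\<^sup>2"
      unfolding norm_mult complex_mod_cnj .
    then have "ennreal (cmod (ft \<phi> \<xi> * cnj (ft \<phi> \<eta>))) \<le> ennreal (1/2 * (cmod (ft \<phi> \<xi>))\<^sup>2 + 1/2 * (cmod (ft \<phi> \<eta>))\<^sup>2)"
      by (rule ennreal_leI)
    also have "\<dots> = ennreal (1/2) * ennreal ((cmod (ft \<phi> \<xi>))\<^sup>2) + ennreal (1/2) * ennreal ((cmod (ft \<phi> \<eta>))\<^sup>2)"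
    proof -
      have e: "ennreal (1/2 * a) = ennreal (1/2) * ennreal a" if "a \<ge> 0" for a
        using that by (intro ennreal_mult) auto
      show ?thesis unfolding e[OF zero_le_power2, symmetric] by (rule ennreal_plus) auto
    qed
    finally show "ennreal (cmod (ft \<phi> \<xi> * cnj (ft \<phi> \<eta>))) \<le> \<dots>" .
  qed
  also have "\<dots> = ennreal (1/2) * spectral \<Phi> \<xi> + ennreal (1/2) * spectral \<Phi> \<eta>"
    unfolding spectral_def by (subst nn_integral_add) (auto simp: nn_integral_cmult)
  also have "\<dots> \<le> ennreal (1/2) * 1 + ennreal (1/2) * 1"
    by (intro add_mono mult_left_mono assms) auto
  also have "\<dots> = ennreal 1" unfolding mult_1_right by (subst ennreal_plus[symmetric]) simp_all
  finally have le: "(\<integral>\<^sup>+\<phi>. ennreal (cmod (ft \<phi> \<xi> * cnj (ft \<phi> \<eta>))) \<partial>count_space \<Phi>) \<le> ennreal 1" .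
  show s: "fourier_summable \<Phi> \<xi> \<eta>"
    unfolding fourier_summable_iff by (rule integrableI_bounded) (use le in \<open>auto intro: le_less_trans\<close>)
  have "ennreal (cmod (fourier_sum \<Phi> \<xi> \<eta>)) \<le> ennreal 1"
    unfolding fourier_sum_eq using s unfolding fourier_summable_iff
    by (rule order_trans[OF integral_norm_bound_ennreal le])
  then show "cmod (fourier_sum \<Phi> \<xi> \<eta>) \<le> 1" by simp
qed

lemma fourier_sum_measurable:
  fixes \<Phi> :: "(real^'n) l2 set"
  assumes "countable \<Phi>" and [measurable]: "p \<in> borel \<rightarrow>\<^sub>M borel" "q \<in> borel \<rightarrow>\<^sub>M borel"
  shows "(\<lambda>\<xi>. fourier_sum \<Phi> (p \<xi>) (q \<xi>)) \<in> borel_measurable (borel :: 'a::euclidean_space measure)"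
  unfolding fourier_sum_eq by (rule measurable_integral_count_space[OF assms(1)]) measurable

lemma fourier_sum_diag:
  "fourier_summable \<Phi> \<xi> \<xi> \<Longrightarrow> spectral \<Phi> \<xi> = ennreal (Re (fourier_sum \<Phi> \<xi> \<xi>))"
  "Im (fourier_sum \<Phi> \<xi> \<xi>) = 0" "Re (fourier_sum \<Phi> \<xi> \<xi>) \<ge> 0"
proof -
  have eq: "fourier_sum \<Phi> \<xi> \<xi> = complex_of_real (LINT \<phi>|count_space \<Phi>. (cmod (ft \<phi> \<xi>))\<^sup>2)"
    unfolding fourier_sum_eq complex_norm_square[symmetric] by (rule integral_complex_of_real)
  show "Im (fourier_sum \<Phi> \<xi> \<xi>) = 0" "Re (fourier_sum \<Phi> \<xi> \<xi>) \<ge> 0" unfolding eq by auto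
  assume "fourier_summable \<Phi> \<xi> \<xi>"
  then have "integrable (count_space \<Phi>) (\<lambda>\<phi>. complex_of_real ((cmod (ft \<phi> \<xi>))\<^sup>2))"
    unfolding fourier_summable_iff complex_norm_square[symmetric] .
  from integrable_Re[OF this] have "integrable (count_space \<Phi>) (\<lambda>\<phi>. (cmod (ft \<phi> \<xi>))\<^sup>2)"
    unfolding Re_complex_of_real .
  then show "spectral \<Phi> \<xi> = ennreal (Re (fourier_sum \<Phi> \<xi> \<xi>))"
    unfolding spectral_def eq by (subst nn_integral_eq_integral) auto
qed

lemma fourier_sum_commute:
  fixes \<Phi> :: "(real^'n) l2 set"
  shows "fourier_sum \<Phi> \<eta> \<xi> = cnj (fourier_sum \<Phi> \<xi> \<eta>)"
  unfolding fourier_sum_eq by (subst Bochner_Integration.integral_cnj[symmetric]) (simp add: mult.commute)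

lemma exists_fourier_preimage:
  assumes "test_function u"
  obtains f where "AE \<xi> in lborel. ft f \<xi> = u \<xi>"
proof -
  have "square_integrable u" by (rule test_function_square_integrable[OF assms])
  moreover obtain f where "fourier f = abs_l2 u" using fourier_surj by blast
  ultimately show ?thesis using that[of f] rep_abs_l2[of u] by simp
qed

lemma norm_sq_ft:
  fixes f :: "(real^'n) l2"
  assumes "AE \<xi> in lborel. ft f \<xi> = u \<xi>"
  shows "ennreal ((norm f)\<^sup>2) = ennreal (1 / (2 * pi) ^ CARD('n)) * (\<integral>\<^sup>+\<xi>. ennreal ((cmod (u \<xi>))\<^sup>2) \<partial>lborel)"
proof -
  have "(\<integral>\<^sup>+\<xi>. ennreal ((cmod (u \<xi>))\<^sup>2) \<partial>lborel) = ennreal ((norm (fourier f))\<^sup>2)"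
    unfolding norm_sq_nn_integral using assms by (intro nn_integral_cong_AE) auto
  then have "ennreal (1 / (2 * pi) ^ CARD('n)) * (\<integral>\<^sup>+\<xi>. ennreal ((cmod (u \<xi>))\<^sup>2) \<partial>lborel)
     = ennreal (1 / (2 * pi) ^ CARD('n) * ((2 * pi) ^ CARD('n) * (norm f)\<^sup>2))"
    unfolding norm_fourier by (subst ennreal_mult) auto
  then show ?thesis by simp
qed

text \<open>
  Bessel's inequality at a function whose Fourier transform is the indicator of a set \<open>E\<close> inside a tile
  says that the integral of the spectral function over \<open>E\<close> is at most the measure of \<open>E\<close>: the
  periodisation over a single tile has only one term. Taking for \<open>E\<close> the part of the tile where the
  spectral function exceeds \<open>1\<close> shows that this part is a null set.
\<close>

lemma spectral_le_1:
  fixes \<Phi> :: "(real^'n) l2 set"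
  assumes cnt: "countable \<Phi>" and bessel: "\<And>f. frame_sum \<Phi> f \<le> ennreal ((norm f)\<^sup>2)"
  shows "AE \<xi> in lborel. spectral \<Phi> \<xi> \<le> 1"
proof -
  note [measurable] = spectral_measurable[OF cnt]
  define P where "P = (2 * pi) ^ CARD('n)"
  have P: "P > 0" by (simp add: P_def)
  show ?thesis
  proof (rule AE_all_tiles)
    fix s :: "real^'n" assume s: "s \<in> int_lattice"
    define E where "E = {\<xi> \<in> tile s. spectral \<Phi> \<xi> > 1}"
    have Em [measurable]: "E \<in> sets borel" unfolding E_def by measurable
    have Eb: "bounded E" by (rule bounded_subset[OF bounded_tile[of s]]) (auto simp: E_def)
    define u where "u = (\<lambda>\<xi>. complex_of_real (indicator E \<xi>))"
    have um [measurable]: "u \<in> borel_measurable borel" unfolding u_def by measurable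
    have tu: "test_function u"
      by (rule test_functionI[OF um _ Eb, where C=1]) (simp_all add: u_def indicator_def)
    obtain f where f: "AE \<xi> in lborel. ft f \<xi> = u \<xi>" using exists_fourier_preimage[OF tu] .
    have br: "bracket u (ft \<phi>) \<xi> = u (\<xi> + (2 * pi) *\<^sub>R s) * cnj (ft \<phi> (\<xi> + (2 * pi) *\<^sub>R s))"
      if "\<xi> \<in> cell (2 * pi)" for \<xi> \<phi>
      unfolding bracket_def
    proof (subst integral_count_space_finite_subset[of "{s}"])
      fix t :: "real^'n" assume t: "t \<in> int_lattice" "t \<notin> {s}"
      have "\<xi> + (2 * pi) *\<^sub>R t \<notin> E"
      proof
        assume "\<xi> + (2 * pi) *\<^sub>R t \<in> E"
        moreover have "\<xi> \<in> tile 0" using that by (simp add: tile_def)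
        ultimately have "t = s - 0" using t(1) s by (intro tile_unique) (auto simp: E_def)
        then show False using t(2) by simp
      qed
      then show "u (\<xi> + (2 * pi) *\<^sub>R t) * cnj (ft \<phi> (\<xi> + (2 * pi) *\<^sub>R t)) = 0" by (simp add: u_def)
    qed (use s in auto)
    have "frame_sum \<Phi> f = ennreal (1 / P) *
      (\<integral>\<^sup>+\<xi>\<in>cell (2 * pi). (\<integral>\<^sup>+\<phi>. ennreal ((cmod (bracket u (ft \<phi>) \<xi>))\<^sup>2) \<partial>count_space \<Phi>) \<partial>lborel)"
      unfolding P_def by (rule frame_sum_bracket[OF cnt tu f])
    also have "(\<integral>\<^sup>+\<xi>\<in>cell (2 * pi). (\<integral>\<^sup>+\<phi>. ennreal ((cmod (bracket u (ft \<phi>) \<xi>))\<^sup>2) \<partial>count_space \<Phi>) \<partial>lborel)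
      = (\<integral>\<^sup>+\<xi>. indicator E (\<xi> + (2 * pi) *\<^sub>R s) * spectral \<Phi> (\<xi> + (2 * pi) *\<^sub>R s) \<partial>lborel)"
    proof (rule nn_integral_cong)
      fix \<xi>
      show "(\<integral>\<^sup>+\<phi>. ennreal ((cmod (bracket u (ft \<phi>) \<xi>))\<^sup>2) \<partial>count_space \<Phi>) * indicator (cell (2 * pi)) \<xi>
        = indicator E (\<xi> + (2 * pi) *\<^sub>R s) * spectral \<Phi> (\<xi> + (2 * pi) *\<^sub>R s)"
      proof (cases "\<xi> \<in> cell (2 * pi)")
        case True
        have uv: "u x = of_real (indicator E x)" for x by (simp add: u_def)
        show ?thesis using True
          by (cases "\<xi> + (2 * pi) *\<^sub>R s \<in> E") (auto simp: br uv spectral_def)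
      next
        case False
        then have "\<xi> + (2 * pi) *\<^sub>R s \<notin> E" by (simp add: E_def tile_def)
        then show ?thesis using False by simp
      qed
    qed
    also have "\<dots> = (\<integral>\<^sup>+\<xi>. indicator E \<xi> * spectral \<Phi> \<xi> \<partial>lborel)"
      by (rule nn_integral_translate[of "\<lambda>\<xi>. indicator E \<xi> * spectral \<Phi> \<xi>"]) measurable
    finally have "ennreal (1 / P) * (\<integral>\<^sup>+\<xi>. indicator E \<xi> * spectral \<Phi> \<xi> \<partial>lborel) \<le> ennreal ((norm f)\<^sup>2)"
      using bessel[of f] by simp
    also have "\<dots> = ennreal (1 / P) * (\<integral>\<^sup>+\<xi>. ennreal ((cmod (u \<xi>))\<^sup>2) \<partial>lborel)"
      unfolding P_def by (rule norm_sq_ft[OF f])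
    also have "(\<integral>\<^sup>+\<xi>. ennreal ((cmod (u \<xi>))\<^sup>2) \<partial>lborel) = (\<integral>\<^sup>+\<xi>. indicator E \<xi> \<partial>lborel)"
      by (intro nn_integral_cong) (simp add: u_def indicator_def)
    finally have le: "(\<integral>\<^sup>+\<xi>. indicator E \<xi> * spectral \<Phi> \<xi> \<partial>lborel) \<le> (\<integral>\<^sup>+\<xi>. indicator E \<xi> \<partial>lborel)"
      using P by (subst (asm) ennreal_mult_le_mult_iff) auto
    have fin: "(\<integral>\<^sup>+\<xi>. indicator E \<xi> \<partial>lborel) \<noteq> \<infinity>"
    proof -
      show ?thesis using emeasure_bounded_finite[OF Eb] by simp
    qed
    have "(\<integral>\<^sup>+\<xi>. indicator E \<xi> * spectral \<Phi> \<xi> - indicator E \<xi> \<partial>lborel)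
       = (\<integral>\<^sup>+\<xi>. indicator E \<xi> * spectral \<Phi> \<xi> \<partial>lborel) - (\<integral>\<^sup>+\<xi>. indicator E \<xi> \<partial>lborel)"
      by (rule nn_integral_diff) (use fin in \<open>auto simp: E_def indicator_def\<close>)
    also have "\<dots> = 0"
      by (simp add: diff_eq_0_iff_ennreal) (use le fin in \<open>auto simp: top_unique less_top[symmetric]\<close>)
    finally have "AE \<xi> in lborel. indicator E \<xi> * spectral \<Phi> \<xi> - indicator E \<xi> = 0"
      by (subst (asm) nn_integral_0_iff_AE) auto
    then show "AE \<xi> in lborel. \<xi> \<in> tile s \<longrightarrow> spectral \<Phi> \<xi> \<le> 1"
    proof eventually_elim
      case (elim \<xi>)
      show ?case
      proof (intro impI, rule ccontr)
        assume "\<xi> \<in> tile s" "\<not> spectral \<Phi> \<xi> \<le> 1"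
        then have "\<xi> \<in> E" by (simp add: E_def)
        then show False using elim \<open>\<not> spectral \<Phi> \<xi> \<le> 1\<close>
          by (cases "spectral \<Phi> \<xi> = top") (auto simp: diff_eq_0_iff_ennreal)
      qed
    qed
  qed
qed

text \<open>
  The integrand of a quadratic form in \<open>u\<close> that couples the values of \<open>u\<close> at points congruent modulo
  \<open>2\<pi>\<close> times the integer lattice; \<open>N \<xi> t\<close> is the entry for the points \<open>\<xi>\<close> and \<open>\<xi> + 2\<pi>t\<close>.
\<close>

definition lattice_form :: "(real^'n \<Rightarrow> real^'n \<Rightarrow> complex) \<Rightarrow> (real^'n \<Rightarrow> complex) \<Rightarrow> real^'n \<Rightarrow> complex" where
  "lattice_form N u \<xi> = (LINT t|count_space int_lattice. cnj (u \<xi>) * u (\<xi> + (2 * pi) *\<^sub>R t) * N \<xi> t)"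

lemma lattice_form_measurable:
  assumes [measurable]: "\<And>t. (\<lambda>\<xi>. N \<xi> t) \<in> borel_measurable borel" "u \<in> borel_measurable borel"
  shows "lattice_form N u \<in> borel_measurable borel"
  unfolding lattice_form_def[abs_def] by (rule measurable_integral_count_space) auto

lemma lattice_integral_finite:
  fixes F :: "real^'n \<Rightarrow> complex" and u :: "real^'n \<Rightarrow> complex"
  assumes "\<And>x. x \<notin> cell c \<Longrightarrow> u x = 0" "\<xi> \<in> cell c"
  shows "(LINT t|count_space int_lattice. cnj (u \<xi>) * u (\<xi> + (2 * pi) *\<^sub>R t) * F t)
    = (\<Sum>t\<in>overlaps (2 * pi) c c. cnj (u \<xi>) * u (\<xi> + (2 * pi) *\<^sub>R t) * F t)"
proof (rule integral_count_space_finite_subset)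
  fix t :: "real^'n" assume "t \<in> int_lattice" "t \<notin> overlaps (2 * pi) c c"
  then have "\<xi> + (2 * pi) *\<^sub>R t \<notin> cell c" using assms(2) by (auto simp: overlaps_def)
  then show "cnj (u \<xi>) * u (\<xi> + (2 * pi) *\<^sub>R t) * F t = 0" by (simp add: assms(1))
qed (auto simp: overlaps_subset finite_overlaps)

lemma lattice_form_integrable:
  fixes u :: "real^'n \<Rightarrow> complex"
  assumes u: "test_function u"
    and K: "AE \<xi> in lborel. \<forall>t\<in>int_lattice. cmod (K \<xi> t) \<le> B"
    and [measurable]: "\<And>t. (\<lambda>\<xi>. K \<xi> t) \<in> borel_measurable borel"
  shows "integrable lborel (lattice_form K u)"
proof -
  obtain C c where u: "C \<ge> 0" "\<And>x. cmod (u x) \<le> C" "\<And>x. x \<notin> cell c \<Longrightarrow> u x = 0" "u \<in> borel_measurable borel"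
    using test_functionE[OF u] by metis
  note [measurable] = u(4)
  let ?S = "overlaps (2 * pi) c c :: (real^'n) set"
  show ?thesis
  proof (rule Bochner_Integration.integrable_bound)
    show "integrable lborel (\<lambda>\<xi>. indicator (cell c :: (real^'n) set) \<xi> *\<^sub>R (real (card ?S) * (C * C * B)))"
      using emeasure_cell_finite[of c, where 'n='n] by (intro integrable_scaleR_left) auto
    show "lattice_form K u \<in> borel_measurable lborel"
      by (simp, rule lattice_form_measurable) auto
    show "AE \<xi> in lborel. norm (lattice_form K u \<xi>)
       \<le> norm (indicator (cell c) \<xi> *\<^sub>R (real (card ?S) * (C * C * B)))"
      using K
    proof eventually_elim
      case (elim \<xi>)
      show ?case
      proof (cases "\<xi> \<in> cell c")
        case True
        have "cmod (\<Sum>t\<in>?S. cnj (u \<xi>) * u (\<xi> + (2 * pi) *\<^sub>R t) * K \<xi> t) \<le> real (card ?S) * (C * C * B)"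
        proof (rule order_trans[OF norm_sum], rule sum_bounded_above)
          fix t assume t: "t \<in> ?S"
          then have "cmod (K \<xi> t) \<le> B" using elim overlaps_subset by blast
          then show "cmod (cnj (u \<xi>) * u (\<xi> + (2 * pi) *\<^sub>R t) * K \<xi> t) \<le> C * C * B"
            unfolding norm_mult complex_mod_cnj using u(1,2) by (intro mult_mono) auto
        qed
        moreover have "lattice_form K u \<xi> = (\<Sum>t\<in>?S. cnj (u \<xi>) * u (\<xi> + (2 * pi) *\<^sub>R t) * K \<xi> t)"
          unfolding lattice_form_def by (rule lattice_integral_finite[OF u(3) True])
        ultimately show ?thesis using True by simp
      next
        case False
        then show ?thesis using u(3)[OF False] by (simp add: lattice_form_def)
      qed
    qed
  qed
qed

lemma lattice_form_combine:
  assumes "test_function u"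
  shows "lattice_form (\<lambda>\<xi> t. a \<xi> t + b \<xi> t - d \<xi> t) u \<xi> = lattice_form a u \<xi> + lattice_form b u \<xi> - lattice_form d u \<xi>"
proof -
  obtain c where u: "\<And>x. x \<notin> cell c \<Longrightarrow> u x = 0" using test_functionE[OF assms] by metis
  show ?thesis
  proof (cases "\<xi> \<in> cell c")
    case True
    have f: "(LINT t|count_space int_lattice. cnj (u \<xi>) * u (\<xi> + (2 * pi) *\<^sub>R t) * F t)
      = (\<Sum>t\<in>overlaps (2 * pi) c c. cnj (u \<xi>) * u (\<xi> + (2 * pi) *\<^sub>R t) * F t)" for F
      by (rule lattice_integral_finite[OF u True])
    show ?thesis unfolding lattice_form_def f[of "a \<xi>"] f[of "b \<xi>"] f[of "d \<xi>"] f[of "\<lambda>t. a \<xi> t + b \<xi> t - d \<xi> t"]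
      by (simp add: distrib_left right_diff_distrib sum.distrib sum_subtractf)
  qed (simp add: lattice_form_def u)
qed

definition gram :: "(real^'n) l2 set \<Rightarrow> (real^'n \<Rightarrow> complex) \<Rightarrow> real^'n \<Rightarrow> complex" where
  "gram \<Phi> = lattice_form (\<lambda>\<xi> t. fourier_sum \<Phi> \<xi> (\<xi> + (2 * pi) *\<^sub>R t))"

lemma gram_measurable:
  assumes "countable \<Phi>" "u \<in> borel_measurable borel"
  shows "gram \<Phi> u \<in> borel_measurable borel"
  unfolding gram_def
  by (intro lattice_form_measurable fourier_sum_measurable assms) measurable

lemma AE_spectral_lattice:
  fixes \<Phi> :: "(real^'n) l2 set"
  assumes "AE \<xi> in lborel. spectral \<Phi> \<xi> \<le> 1"
  shows "AE \<xi> in lborel. \<forall>t\<in>int_lattice. spectral \<Phi> (\<xi> + (2 * pi) *\<^sub>R t) \<le> 1"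
  by (subst AE_ball_countable) (use AE_translate[OF assms] in auto)

lemma norm_sq_sum_expand:
  "complex_of_real ((cmod (\<Sum>s\<in>S. a s))\<^sup>2) = (\<Sum>s\<in>S. \<Sum>t\<in>S. cnj (a s) * a t)"
proof -
  have "complex_of_real ((cmod (\<Sum>s\<in>S. a s))\<^sup>2) = (\<Sum>s\<in>S. cnj (a s)) * (\<Sum>t\<in>S. a t)"
    by (subst complex_norm_square) (simp add: mult.commute)
  then show ?thesis by (simp add: sum_product)
qed

text \<open>
  At a point \<open>\<xi>\<close> of the cell, let \<open>x s = \<xi> + 2\<pi>s\<close>. Expanding the squared modulus of the periodisation
  and summing over the generators gives the double sum over \<open>s\<close> and \<open>t\<close> of
  \<open>cnj (u (x s)) * u (x t) * fourier_sum \<Phi> (x s) (x t)\<close>. For fixed \<open>s\<close> the sum over \<open>t\<close> is the integrand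
  \<open>gram \<Phi> u\<close> at \<open>x s\<close>, so the sum over \<open>s\<close> periodises this integrand, and the integral over the cell
  becomes an integral over the whole space.
\<close>

lemma frame_sum_gram:
  fixes f :: "(real^'n) l2" and \<Phi> :: "(real^'n) l2 set"
  assumes cnt: "countable \<Phi>" and sp: "AE \<xi> in lborel. spectral \<Phi> \<xi> \<le> 1"
    and u: "test_function u" and f: "AE \<xi> in lborel. ft f \<xi> = u \<xi>"
  shows "integrable lborel (gram \<Phi> u)"
    and "frame_sum \<Phi> f = ennreal (1 / (2 * pi) ^ CARD('n) * Re (LINT \<xi>|lborel. gram \<Phi> u \<xi>))"
    and "Re (LINT \<xi>|lborel. gram \<Phi> u \<xi>) \<ge> 0"
proof -
  obtain c where uc: "\<And>x. x \<notin> cell c \<Longrightarrow> u x = 0" and um [measurable]: "u \<in> borel_measurable borel"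
    using test_functionE[OF u] by metis
  let ?w = "2 * pi"
  let ?S = "overlaps ?w ?w c :: (real^'n) set"
  have S: "finite ?S" "?S \<subseteq> int_lattice" by (auto simp: finite_overlaps overlaps_subset)
  note spl = AE_spectral_lattice[OF sp]
  have [measurable]: "(\<lambda>\<xi>. fourier_sum \<Phi> \<xi> (\<xi> + ?w *\<^sub>R t)) \<in> borel_measurable borel" for t
    by (rule fourier_sum_measurable[OF cnt]) measurable
  have K: "AE \<xi> in lborel. \<forall>t\<in>int_lattice. cmod (fourier_sum \<Phi> \<xi> (\<xi> + ?w *\<^sub>R t)) \<le> 1"
    using spl
  proof eventually_elim
    case (elim \<xi>)
    then show ?case using elim[rule_format, OF int_lattice_0] by (auto intro!: fourier_sum_bound)
  qed
  show int: "integrable lborel (gram \<Phi> u)"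
    unfolding gram_def by (rule lattice_form_integrable[OF u K]) measurable
  define R where "R \<xi> = (LINT \<phi>|count_space \<Phi>. (cmod (bracket u (ft \<phi>) \<xi>))\<^sup>2)" for \<xi>
  have R0: "R \<xi> \<ge> 0" for \<xi> by (simp add: R_def)
  have pt: "AE \<xi> in lborel. \<xi> \<in> cell ?w \<longrightarrow>
      (\<integral>\<^sup>+\<phi>. ennreal ((cmod (bracket u (ft \<phi>) \<xi>))\<^sup>2) \<partial>count_space \<Phi>) = ennreal (R \<xi>) \<and>
      (LINT s|count_space int_lattice. gram \<Phi> u (\<xi> + ?w *\<^sub>R s)) = of_real (R \<xi>)"
    using spl
  proof (eventually_elim, intro impI)
    fix \<xi> :: "real^'n"
    assume sp: "\<forall>t\<in>int_lattice. spectral \<Phi> (\<xi> + ?w *\<^sub>R t) \<le> 1" and \<xi>: "\<xi> \<in> cell ?w"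
    define x where "x s = \<xi> + ?w *\<^sub>R s" for s
    define a where "a \<phi> s = u (x s) * cnj (ft \<phi> (x s))" for \<phi> s
    have br: "bracket u (ft \<phi>) \<xi> = (\<Sum>s\<in>?S. a \<phi> s)" for \<phi>
      unfolding a_def x_def by (rule bracket_eq_sum[OF uc \<xi>])
    have su: "integrable (count_space \<Phi>) (\<lambda>\<phi>. ft \<phi> (x s) * cnj (ft \<phi> (x t)))" if "s \<in> ?S" "t \<in> ?S" for s t
      unfolding fourier_summable_iff[symmetric] x_def using sp that S(2) by (intro fourier_sum_bound) auto
    have aa: "cnj (a \<phi> s) * a \<phi> t = cnj (u (x s)) * u (x t) * (ft \<phi> (x s) * cnj (ft \<phi> (x t)))" for \<phi> s t
      by (simp add: a_def mult_ac)
    have ex: "complex_of_real ((cmod (bracket u (ft \<phi>) \<xi>))\<^sup>2) =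
        (\<Sum>s\<in>?S. \<Sum>t\<in>?S. cnj (u (x s)) * u (x t) * (ft \<phi> (x s) * cnj (ft \<phi> (x t))))" for \<phi>
      unfolding br norm_sq_sum_expand aa ..
    have i: "integrable (count_space \<Phi>) (\<lambda>\<phi>. complex_of_real ((cmod (bracket u (ft \<phi>) \<xi>))\<^sup>2))"
      unfolding ex by (intro Bochner_Integration.integrable_sum integrable_mult_right su)
    from integrable_Re[OF this] have ir: "integrable (count_space \<Phi>) (\<lambda>\<phi>. (cmod (bracket u (ft \<phi>) \<xi>))\<^sup>2)"
      unfolding Re_complex_of_real .
    have "of_real (R \<xi>) = (LINT \<phi>|count_space \<Phi>. complex_of_real ((cmod (bracket u (ft \<phi>) \<xi>))\<^sup>2))"
      unfolding R_def by (rule integral_complex_of_real[symmetric])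
    also have "\<dots> = (\<Sum>s\<in>?S. \<Sum>t\<in>?S. cnj (u (x s)) * u (x t) * fourier_sum \<Phi> (x s) (x t))"
      unfolding ex fourier_sum_eq
      by (subst Bochner_Integration.integral_sum, intro Bochner_Integration.integrable_sum integrable_mult_right su, assumption+)
         (intro sum.cong refl, subst Bochner_Integration.integral_sum, auto intro!: integrable_mult_right su)
    finally have R: "of_real (R \<xi>) = (\<Sum>s\<in>?S. \<Sum>t\<in>?S. cnj (u (x s)) * u (x t) * fourier_sum \<Phi> (x s) (x t))" .
    have u0: "u (x s) = 0" if "s \<in> int_lattice" "s \<notin> ?S" for s
      using that \<xi> by (intro uc) (auto simp: x_def overlaps_def)
    have g: "gram \<Phi> u (x s) = (\<Sum>t\<in>?S. cnj (u (x s)) * u (x t) * fourier_sum \<Phi> (x s) (x t))" if s: "s \<in> int_lattice" for s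
    proof -
      have xx: "x s + ?w *\<^sub>R t = x (s + t)" for t by (simp add: x_def algebra_simps)
      have "gram \<Phi> u (x s) = (\<Sum>t\<in>(\<lambda>t. t - s) ` ?S. cnj (u (x s)) * u (x s + ?w *\<^sub>R t) * fourier_sum \<Phi> (x s) (x s + ?w *\<^sub>R t))"
        unfolding gram_def lattice_form_def
      proof (rule integral_count_space_finite_subset)
        fix t :: "real^'n" assume t: "t \<in> int_lattice" "t \<notin> (\<lambda>t. t - s) ` ?S"
        have "s + t \<notin> ?S"
        proof
          assume "s + t \<in> ?S"
          then have "t \<in> (\<lambda>t. t - s) ` ?S" by (intro image_eqI[of _ _ "s + t"]) auto
          then show False using t(2) by contradiction
        qed
        then have "u (x (s + t)) = 0" using s t(1) by (intro u0 int_lattice_add)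
        then show "cnj (u (x s)) * u (x s + ?w *\<^sub>R t) * fourier_sum \<Phi> (x s) (x s + ?w *\<^sub>R t) = 0" unfolding xx by simp
      qed (use S s in \<open>auto intro: int_lattice_diff\<close>)
      also have "\<dots> = (\<Sum>t\<in>?S. cnj (u (x s)) * u (x t) * fourier_sum \<Phi> (x s) (x t))"
        unfolding xx by (subst sum.reindex) (auto simp: inj_on_def)
      finally show ?thesis .
    qed
    have "(LINT s|count_space int_lattice. gram \<Phi> u (\<xi> + ?w *\<^sub>R s)) = (\<Sum>s\<in>?S. gram \<Phi> u (x s))"
      unfolding x_def[symmetric]
    proof (rule integral_count_space_finite_subset[OF S])
      fix s :: "real^'n" assume "s \<in> int_lattice" "s \<notin> ?S"
      then show "gram \<Phi> u (x s) = 0" using g u0 by simp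
    qed
    also have "\<dots> = of_real (R \<xi>)" unfolding R by (rule sum.cong[OF refl], rule g) (use S(2) in auto)
    finally show "(\<integral>\<^sup>+\<phi>. ennreal ((cmod (bracket u (ft \<phi>) \<xi>))\<^sup>2) \<partial>count_space \<Phi>) = ennreal (R \<xi>) \<and>
      (LINT s|count_space int_lattice. gram \<Phi> u (\<xi> + ?w *\<^sub>R s)) = of_real (R \<xi>)"
      unfolding R_def using ir by (subst nn_integral_eq_integral) auto
  qed
  define H where "H = (\<lambda>\<xi>. indicator (cell ?w) \<xi> *\<^sub>R (LINT s|count_space int_lattice. gram \<Phi> u (\<xi> + ?w *\<^sub>R s)))"
  have gm: "gram \<Phi> u \<in> borel_measurable borel" by (rule gram_measurable[OF cnt um])
  have "(0::real) < ?w" by simp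
  note til = integral_tiling[OF this int gm]
  have HR: "AE \<xi> in lborel. Re (H \<xi>) = indicator (cell ?w) \<xi> * R \<xi>"
    using pt by eventually_elim (auto simp: H_def indicator_def)
  have iH: "integrable lborel (\<lambda>\<xi>. Re (H \<xi>))"
    unfolding H_def by (rule integrable_Re[OF til(2)])
  have Re: "Re (LINT \<xi>|lborel. gram \<Phi> u \<xi>) = (LINT \<xi>|lborel. Re (H \<xi>))"
    unfolding til(1) using integral_Re[OF til(2)] by (simp add: H_def)
  have "AE \<xi> in lborel. 0 \<le> Re (H \<xi>)" using HR by eventually_elim (simp add: R0)
  then have nn: "(\<integral>\<^sup>+\<xi>. ennreal (Re (H \<xi>)) \<partial>lborel) = ennreal (LINT \<xi>|lborel. Re (H \<xi>))"
    and nonneg: "(LINT \<xi>|lborel. Re (H \<xi>)) \<ge> 0"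
    using iH by (auto intro: nn_integral_eq_integral integral_nonneg_AE)
  show "Re (LINT \<xi>|lborel. gram \<Phi> u \<xi>) \<ge> 0" unfolding Re by (rule nonneg)
  have "frame_sum \<Phi> f = ennreal (1 / ?w ^ CARD('n)) *
    (\<integral>\<^sup>+\<xi>\<in>cell ?w. (\<integral>\<^sup>+\<phi>. ennreal ((cmod (bracket u (ft \<phi>) \<xi>))\<^sup>2) \<partial>count_space \<Phi>) \<partial>lborel)"
    by (rule frame_sum_bracket[OF cnt u f])
  also have "(\<integral>\<^sup>+\<xi>\<in>cell ?w. (\<integral>\<^sup>+\<phi>. ennreal ((cmod (bracket u (ft \<phi>) \<xi>))\<^sup>2) \<partial>count_space \<Phi>) \<partial>lborel)
     = (\<integral>\<^sup>+\<xi>. ennreal (Re (H \<xi>)) \<partial>lborel)"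
  proof (rule nn_integral_cong_AE)
    show "AE \<xi> in lborel. (\<integral>\<^sup>+\<phi>. ennreal ((cmod (bracket u (ft \<phi>) \<xi>))\<^sup>2) \<partial>count_space \<Phi>) * indicator (cell ?w) \<xi> = ennreal (Re (H \<xi>))"
      using pt HR by eventually_elim (auto simp: indicator_def)
  qed
  finally show "frame_sum \<Phi> f = ennreal (1 / ?w ^ CARD('n) * Re (LINT \<xi>|lborel. gram \<Phi> u \<xi>))"
    unfolding nn Re using nonneg by (subst ennreal_mult) auto
qed

section \<open>Orthogonal projections and shift-invariant spaces\<close>

definition proj :: "'a::euclidean_space l2 set \<Rightarrow> 'a l2 \<Rightarrow> 'a l2" where
  "proj V f = (SOME p. p \<in> V \<and> (\<forall>v\<in>V. cinner (f - p) v = 0))"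

lemma proj:
  assumes "closed_subspace V"
  shows proj_in: "proj V f \<in> V" and proj_orth: "v \<in> V \<Longrightarrow> cinner (f - proj V f) v = 0"
proof -
  obtain p where "p \<in> V" "\<And>v. v \<in> V \<Longrightarrow> cinner (f - p) v = 0"
    using closed_subspace_projection[OF assms, where f=f] by metis
  then have "\<exists>p. p \<in> V \<and> (\<forall>v\<in>V. cinner (f - p) v = 0)" by auto
  from someI_ex[OF this] show "proj V f \<in> V" "v \<in> V \<Longrightarrow> cinner (f - proj V f) v = 0"
    unfolding proj_def by auto
qed

lemma closed_subspace_diff: "closed_subspace V \<Longrightarrow> f \<in> V \<Longrightarrow> g \<in> V \<Longrightarrow> f - g \<in> V"
  and closed_subspace_add: "closed_subspace V \<Longrightarrow> f \<in> V \<Longrightarrow> g \<in> V \<Longrightarrow> f + g \<in> V"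
  and closed_subspace_scale: "closed_subspace V \<Longrightarrow> f \<in> V \<Longrightarrow> scale_l2 c f \<in> V"
  and closed_subspace_0: "closed_subspace V \<Longrightarrow> 0 \<in> V"
  unfolding closed_subspace_def
  by (auto intro: l2.subspace_diff l2.subspace_add l2.subspace_scale l2.subspace_0)

text \<open>
  Orthogonality characterises the projection: two candidates differ by an element of \<open>V\<close> that is
  orthogonal to \<open>V\<close>.
\<close>

lemma proj_eqI:
  assumes V: "closed_subspace V" and p: "p \<in> V" "\<And>v. v \<in> V \<Longrightarrow> cinner (f - p) v = 0"
  shows "proj V f = p"
proof -
  have d: "p - proj V f \<in> V" by (intro closed_subspace_diff V p proj_in)
  have "cinner (p - proj V f) (p - proj V f) = cinner (f - proj V f) (p - proj V f) - cinner (f - p) (p - proj V f)"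
    by (subst cinner_minus_left[symmetric]) simp
  also have "\<dots> = 0" using d p(2) proj_orth[OF V] by simp
  finally show ?thesis by (simp add: cinner_self)
qed

lemma proj_add: 
  assumes "closed_subspace V" shows "proj V (f + g) = proj V f + proj V g"
proof (rule proj_eqI[OF assms])
  fix v assume v: "v \<in> V"
  have "f + g - (proj V f + proj V g) = (f - proj V f) + (g - proj V g)" by simp
  then show "cinner (f + g - (proj V f + proj V g)) v = 0"
    using proj_orth[OF assms v] by (simp only: cinner_add_left) simp
qed (intro closed_subspace_add assms proj_in)

lemma proj_minus: 
  assumes "closed_subspace V" shows "proj V (f - g) = proj V f - proj V g"
  using proj_add[OF assms, of "f - g" g] by simp

lemma norm_proj_pythagoras:
  assumes "closed_subspace V"
  shows "(norm f)\<^sup>2 = (norm (proj V f))\<^sup>2 + (norm (f - proj V f))\<^sup>2"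
proof -
  have "cinner (proj V f) (f - proj V f) = 0"
    using proj_orth[OF assms proj_in[OF assms], of f f] cinner_commute[of "proj V f" "f - proj V f"] by simp
  from norm_sq_orthogonal_add[OF this] show ?thesis by simp
qed

lemma norm_proj_le:
  assumes "closed_subspace V" shows "norm (proj V f) \<le> norm f"
proof (rule power2_le_imp_le)
  show "(norm (proj V f))\<^sup>2 \<le> (norm f)\<^sup>2"
    using norm_proj_pythagoras[OF assms, of f] zero_le_power2[of "norm (f - proj V f)"] by linarith
qed simp

lemma proj_id: "closed_subspace V \<Longrightarrow> f \<in> V \<Longrightarrow> proj V f = f"
  by (rule proj_eqI) auto

lemma closed_subspace_orth_diff:
  assumes V: "closed_subspace V"
  shows "closed_subspace (orth_diff V U)"
proof -
  have "l2.subspace (orth_diff V U)"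
    unfolding l2.subspace_def orth_diff_def
    using closed_subspace_add[OF V] closed_subspace_scale[OF V] closed_subspace_0[OF V]
    by (simp add: cinner_add_left cinner_scale_left)
  moreover have "closed (orth_diff V U)"
    unfolding closed_sequential_limits
  proof (intro allI impI)
    fix X l assume X: "(\<forall>n. X n \<in> orth_diff V U) \<and> X \<longlonglongrightarrow> l"
    have "l \<in> V"
      using V X closed_sequentially[of V X l] by (auto simp: closed_subspace_def orth_diff_def)
    moreover have "cinner l g = 0" if "g \<in> U" for g
    proof -
      have "(\<lambda>n. cinner (X n) g) \<longlonglongrightarrow> cinner l g" using X by (intro tendsto_cinner) auto
      moreover have "cinner (X n) g = 0" for n using X that by (auto simp: orth_diff_def)
      ultimately show ?thesis by (simp add: LIMSEQ_const_iff)
    qed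
    ultimately show "l \<in> orth_diff V U" by (auto simp: orth_diff_def)
  qed
  ultimately show ?thesis by (simp add: closed_subspace_def)
qed

text \<open>
  The projection onto the orthogonal complement of \<open>U\<close> in \<open>V\<close> is the difference of the projections
  onto \<open>V\<close> and \<open>U\<close>.
\<close>

lemma orth_diff_pythagoras:
  assumes V: "closed_subspace V" and U: "closed_subspace U" and UV: "U \<subseteq> V"
  shows "(norm (proj V f))\<^sup>2 = (norm (proj U f))\<^sup>2 + (norm (proj (orth_diff V U) f))\<^sup>2"
proof -
  let ?W = "orth_diff V U"
  have W: "closed_subspace ?W" by (rule closed_subspace_orth_diff[OF V])
  have orth: "cinner (proj V f - proj U f) g = 0" if g: "g \<in> U" for g
  proof -
    have "cinner (proj V f - proj U f) g = cinner (f - proj U f) g - cinner (f - proj V f) g"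
      by (subst cinner_minus_left[symmetric]) simp
    then show ?thesis using g UV proj_orth[OF U g] proj_orth[OF V, of g] by auto
  qed
  have "proj ?W f = proj V f - proj U f"
  proof (rule proj_eqI[OF W])
    show "proj V f - proj U f \<in> ?W"
      using orth UV proj_in[OF U] by (auto simp: orth_diff_def intro!: closed_subspace_diff V proj_in)
    fix v assume v: "v \<in> ?W"
    have "cinner (proj U f) v = 0"
      using v proj_in[OF U, of f] cinner_commute[of "proj U f" v] by (auto simp: orth_diff_def)
    moreover have "cinner (f - proj V f) v = 0" using v by (intro proj_orth[OF V]) (auto simp: orth_diff_def)
    moreover have "f - (proj V f - proj U f) = (f - proj V f) + proj U f" by simp
    ultimately show "cinner (f - (proj V f - proj U f)) v = 0" by (simp only: cinner_add_left) simp
  qed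
  moreover have "cinner (proj U f) (proj V f - proj U f) = 0"
    using orth[OF proj_in[OF U, of f]] cinner_commute[of "proj U f"] by simp
  ultimately show ?thesis using norm_sq_orthogonal_add[of "proj U f" "proj ?W f"] by simp
qed

lemma cinner_translate: "cinner (translate k f) g = cinner f (translate (- k) g)"
proof -
  have "cinner (translate k f) g = (LINT x|lborel. rep_l2 f (x - k) * cnj (rep_l2 g x))"
    by (rule cinner_eqI[OF rep_translate]) auto
  also have "\<dots> = (LINT x|lborel. rep_l2 f x * cnj (rep_l2 g (x + k)))"
    using integral_translate[of "\<lambda>x. rep_l2 f (x - k) * cnj (rep_l2 g x)" k] by simp
  also have "\<dots> = cinner f (translate (- k) g)"
    by (rule cinner_eqI[symmetric]) (use rep_translate[of "- k" g] in auto)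
  finally show ?thesis .
qed

lemma translate_translate: "translate k (translate l f) = translate (k + l) f"
proof (rule l2_eqI)
  have "AE x in lborel. rep_l2 (translate l f) (x - k) = rep_l2 f (x - k - l)"
    using AE_translate[OF rep_translate[of l f], of "- k"] by simp
  then show "AE x in lborel. rep_l2 (translate k (translate l f)) x = rep_l2 (translate (k + l) f) x"
    using rep_translate[of k "translate l f"] rep_translate[of "k + l" f] by eventually_elim (simp add: diff_diff_add)
qed

lemma translate_0 [simp]: "translate 0 f = f"
  by (rule l2_eqI) (use rep_translate[of 0 f] in simp)

text \<open>
  This commutation rule makes the dilate of a space invariant under \<open>k\<close> once the space is invariant
  under \<open>M *v k\<close>.
\<close>

lemma translate_lcomp:
  assumes M: "invertible M"
  shows "translate k (lcomp M f) = lcomp M (translate (M *v k) f)"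
proof (rule l2_eqI)
  show "AE x in lborel. rep_l2 (translate k (lcomp M f)) x = rep_l2 (lcomp M (translate (M *v k) f)) x"
    using rep_translate[of k "lcomp M f"] AE_translate[OF rep_lcomp[OF M, of f], of "- k"]
      rep_lcomp[OF M, of "translate (M *v k) f"] AE_linear_image[OF M rep_translate[of "M *v k" f]]
    by eventually_elim (simp add: matrix_vector_mult_diff_distrib)
qed

text \<open>
  Invariance under \<open>k\<close> and \<open>- k\<close> gives equality of \<open>V\<close> with its translates.
\<close>

lemma shift_invariantI:
  assumes "closed_subspace V" "\<And>k f. k \<in> int_lattice \<Longrightarrow> f \<in> V \<Longrightarrow> translate k f \<in> V"
  shows "shift_invariant V"
  unfolding shift_invariant_def
proof (intro conjI ballI equalityI subsetI)
  fix k :: "real^'a" and f assume k: "k \<in> int_lattice" and f: "f \<in> V"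
  show "f \<in> translate k ` V"
    by (rule image_eqI[of _ _ "translate (- k) f"])
       (use k f assms(2) in \<open>auto simp: translate_translate int_lattice_minus\<close>)
qed (use assms in auto)

lemma shift_invariantD: "shift_invariant V \<Longrightarrow> k \<in> int_lattice \<Longrightarrow> f \<in> V \<Longrightarrow> translate k f \<in> V"
  unfolding shift_invariant_def by blast

lemma shift_invariant_orth_diff:
  assumes V: "shift_invariant V" and U: "shift_invariant U"
  shows "shift_invariant (orth_diff V U)"
proof (rule shift_invariantI)
  show "closed_subspace (orth_diff V U)"
    using V by (intro closed_subspace_orth_diff) (simp add: shift_invariant_def)
  fix k :: "real^'a" and f assume k: "k \<in> int_lattice" and f: "f \<in> orth_diff V U"
  show "translate k f \<in> orth_diff V U"
    unfolding orth_diff_def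
    using f k shift_invariantD[OF V k] shift_invariantD[OF U int_lattice_minus[OF k]]
    by (auto simp: orth_diff_def cinner_translate)
qed

section \<open>Frame generators as identities between quadratic forms\<close>

lemma frame_sum_cong:
  assumes "\<And>k \<phi>. k \<in> int_lattice \<Longrightarrow> \<phi> \<in> \<Phi> \<Longrightarrow> cmod (cinner f (translate k \<phi>)) = cmod (cinner g (translate k \<phi>))"
  shows "frame_sum \<Phi> f = frame_sum \<Phi> g"
  unfolding frame_sum_def by (intro nn_integral_cong) (auto simp: assms)

lemma has_sum_iff_frame_sum:
  assumes "S \<ge> 0"
  shows "((\<lambda>i. (cmod (cinner f (case i of (k, \<phi>) \<Rightarrow> translate k \<phi>)))\<^sup>2) has_sum S) (int_lattice \<times> \<Phi>)
    \<longleftrightarrow> frame_sum \<Phi> f = ennreal S"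
  unfolding frame_sum_def case_prod_beta
  by (subst has_sum_nonneg_iff_nn_integral) (simp_all add: assms)

lemma ntf_generator_iff:
  "ntf_generator \<Phi> V \<longleftrightarrow> shift_invariant V \<and> \<Phi> \<subseteq> V \<and> (\<forall>f\<in>V. frame_sum \<Phi> f = ennreal ((norm f)\<^sup>2))"
proof -
  have "(\<forall>i\<in>int_lattice \<times> \<Phi>. (case i of (k, \<phi>) \<Rightarrow> translate k \<phi>) \<in> V)" if "shift_invariant V" "\<Phi> \<subseteq> V"
    using shift_invariantD[OF that(1)] that(2) by auto
  then show ?thesis
    unfolding ntf_generator_def ntf_def has_sum_iff_frame_sum[OF zero_le_power2] by blast
qed

text \<open>
  Inner products with elements of \<open>V\<close> do not see the component of \<open>f\<close> orthogonal to \<open>V\<close>.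
\<close>

lemma frame_sum_proj:
  assumes "ntf_generator \<Phi> V"
  shows "frame_sum \<Phi> f = ennreal ((norm (proj V f))\<^sup>2)"
proof -
  have V: "closed_subspace V" "shift_invariant V" "\<Phi> \<subseteq> V"
    and e: "\<And>f. f \<in> V \<Longrightarrow> frame_sum \<Phi> f = ennreal ((norm f)\<^sup>2)"
    using assms by (auto simp: ntf_generator_iff shift_invariant_def)
  have "frame_sum \<Phi> f = frame_sum \<Phi> (proj V f)"
  proof (rule frame_sum_cong)
    fix k :: "real^'a" and \<phi> assume "k \<in> int_lattice" "\<phi> \<in> \<Phi>"
    then have "translate k \<phi> \<in> V" using V shift_invariantD by blast
    from proj_orth[OF V(1) this, of f] show "cmod (cinner f (translate k \<phi>)) = cmod (cinner (proj V f) (translate k \<phi>))"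
      by (simp add: cinner_minus_left)
  qed
  then show ?thesis using e[OF proj_in[OF V(1)]] by simp
qed

lemma frame_sum_le_norm: "ntf_generator \<Phi> V \<Longrightarrow> frame_sum \<Phi> f \<le> ennreal ((norm f)\<^sup>2)"
  unfolding frame_sum_proj
  by (intro ennreal_leI power_mono norm_proj_le) (auto simp: ntf_generator_iff shift_invariant_def)

lemma frame_sum_eq_0D:
  assumes "frame_sum \<Phi> f = 0" "\<phi> \<in> \<Phi>" shows "cinner f \<phi> = 0"
proof -
  have "AE i in count_space (int_lattice \<times> \<Phi>). ennreal ((cmod (cinner f (translate (fst i) (snd i))))\<^sup>2) = 0"
    using assms(1) unfolding frame_sum_def by (subst (asm) nn_integral_0_iff_AE) auto
  then have z: "\<forall>i\<in>int_lattice \<times> \<Phi>. ennreal ((cmod (cinner f (translate (fst i) (snd i))))\<^sup>2) = 0"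
    unfolding AE_count_space .
  have "(0, \<phi>) \<in> int_lattice \<times> \<Phi>" using assms(2) by simp
  from bspec[OF z this] show ?thesis by simp
qed

text \<open>
  For a generator \<open>\<phi>\<close>, the component of \<open>\<phi>\<close> orthogonal to \<open>V\<close> has frame sum \<open>0\<close>, so it is orthogonal
  to \<open>\<phi>\<close> and therefore to itself. Thus the identity alone puts the generators into \<open>V\<close>.
\<close>

lemma ntf_generatorI:
  assumes V: "shift_invariant V" and e: "\<And>f. frame_sum \<Phi> f = ennreal ((norm (proj V f))\<^sup>2)"
  shows "ntf_generator \<Phi> V"
proof -
  have cV: "closed_subspace V" using V by (simp add: shift_invariant_def)
  have "\<phi> \<in> V" if \<phi>: "\<phi> \<in> \<Phi>" for \<phi>
  proof -
    let ?r = "\<phi> - proj V \<phi>"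
    have "proj V ?r = 0" by (rule proj_eqI[OF cV]) (auto simp: closed_subspace_0[OF cV] proj_orth[OF cV])
    then have "frame_sum \<Phi> ?r = 0" unfolding e by simp
    from frame_sum_eq_0D[OF this \<phi>] have "cinner ?r \<phi> = 0" .
    moreover have "cinner ?r (proj V \<phi>) = 0" by (rule proj_orth[OF cV proj_in[OF cV]])
    ultimately have "cinner ?r ?r = 0" by (simp add: cinner_minus_right)
    then have "\<phi> = proj V \<phi>" by (simp add: cinner_self)
    then show ?thesis using proj_in[OF cV, of \<phi>] by simp
  qed
  then show ?thesis unfolding ntf_generator_iff using V e proj_id[OF cV] by auto
qed

text \<open>
  A convergent sum has countably many nonzero terms, so each element of a countable total set has a
  nonzero inner product with only countably many generators; a generator orthogonal to the total set
  is \<open>0\<close>.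
\<close>

lemma ntf_generator_countable:
  fixes \<Phi> :: "(real^'n) l2 set"
  assumes "ntf_generator \<Phi> V"
  shows "countable \<Phi>"
proof -
  obtain D :: "(real^'n) l2 set" where D': "countable D \<and> (\<forall>f. (\<forall>d\<in>D. cinner f d = 0) \<longrightarrow> f = 0)"
    using exists_countable_total by (rule exE)
  then have D: "countable D" "f = 0" if "\<And>d. d \<in> D \<Longrightarrow> cinner f d = 0" for f
    using that by simp_all
  have c: "countable {\<phi>\<in>\<Phi>. cinner d \<phi> \<noteq> 0}" for d
  proof -
    let ?g = "\<lambda>i. (cmod (cinner d (case i of (k, \<phi>) \<Rightarrow> translate k \<phi>)))\<^sup>2"
    have "(?g has_sum (norm (proj V d))\<^sup>2) (int_lattice \<times> \<Phi>)"
      by (subst has_sum_iff_frame_sum) (auto simp: frame_sum_proj[OF assms])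
    then have "?g summable_on (int_lattice \<times> \<Phi>)" by (rule has_sum_imp_summable)
    then have "Infinite_Sum.abs_summable_on ?g (int_lattice \<times> \<Phi>)"
      by (simp only: real_norm_def abs_power2)
    then have cA: "countable {i \<in> int_lattice \<times> \<Phi>. ?g i \<noteq> 0}" by (rule abs_summable_countable)
    have sub: "{\<phi>\<in>\<Phi>. cinner d \<phi> \<noteq> 0} \<subseteq> snd ` {i \<in> int_lattice \<times> \<Phi>. ?g i \<noteq> 0}"
    proof
      fix \<phi> assume "\<phi> \<in> {\<phi>\<in>\<Phi>. cinner d \<phi> \<noteq> 0}"
      then have "(0, \<phi>) \<in> {i \<in> int_lattice \<times> \<Phi>. ?g i \<noteq> 0}" by simp
      then show "\<phi> \<in> snd ` {i \<in> int_lattice \<times> \<Phi>. ?g i \<noteq> 0}" by (rule image_eqI[rotated]) simp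
    qed
    show ?thesis by (rule countable_subset[OF sub countable_image[OF cA]])
  qed
  have "\<Phi> \<subseteq> {0} \<union> (\<Union>d\<in>D. {\<phi>\<in>\<Phi>. cinner d \<phi> \<noteq> 0})"
  proof
    fix \<phi> assume \<phi>: "\<phi> \<in> \<Phi>"
    show "\<phi> \<in> {0} \<union> (\<Union>d\<in>D. {\<phi>\<in>\<Phi>. cinner d \<phi> \<noteq> 0})"
    proof (cases "\<exists>d\<in>D. cinner d \<phi> \<noteq> 0")
      case False
      then have "cinner \<phi> d = 0" if "d \<in> D" for d using that cinner_commute[of \<phi> d] by simp
      then have "\<phi> = 0" by (rule D(2))
      then show ?thesis by simp
    qed (use \<phi> in auto)
  qed
  moreover have "countable ({0} \<union> (\<Union>d\<in>D. {\<phi>\<in>\<Phi>. cinner d \<phi> \<noteq> 0}))"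
    using D' c by auto
  ultimately show ?thesis by (rule countable_subset)
qed

lemma frame_sum_parallelogram:
  "frame_sum \<Phi> (f + g) + frame_sum \<Phi> (f - g) = 2 * frame_sum \<Phi> f + 2 * frame_sum \<Phi> g"
proof -
  have p: "(cmod (a + b))\<^sup>2 + (cmod (a - b))\<^sup>2 = 2 * (cmod a)\<^sup>2 + 2 * (cmod b)\<^sup>2" for a b
    unfolding cmod_power2 by (simp add: power2_eq_square algebra_simps)
  let ?e = "\<lambda>i. translate (fst i) (snd i)"
  have "frame_sum \<Phi> (f + g) + frame_sum \<Phi> (f - g) = (\<integral>\<^sup>+i.
      ennreal ((cmod (cinner f (?e i) + cinner g (?e i)))\<^sup>2) +
      ennreal ((cmod (cinner f (?e i) - cinner g (?e i)))\<^sup>2) \<partial>count_space (int_lattice \<times> \<Phi>))"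
    unfolding frame_sum_def cinner_add_left cinner_minus_left by (rule nn_integral_add[symmetric]) auto
  also have "\<dots> = (\<integral>\<^sup>+i. 2 * ennreal ((cmod (cinner f (?e i)))\<^sup>2) +
      2 * ennreal ((cmod (cinner g (?e i)))\<^sup>2) \<partial>count_space (int_lattice \<times> \<Phi>))"
  proof (rule nn_integral_cong)
    fix i
    show "ennreal ((cmod (cinner f (?e i) + cinner g (?e i)))\<^sup>2) +
      ennreal ((cmod (cinner f (?e i) - cinner g (?e i)))\<^sup>2)
      = 2 * ennreal ((cmod (cinner f (?e i)))\<^sup>2) + 2 * ennreal ((cmod (cinner g (?e i)))\<^sup>2)"
      by (subst ennreal_plus[symmetric], simp, simp, subst p, subst ennreal_plus, simp, simp)
         (simp add: ennreal_mult del: ennreal_power)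
  qed
  also have "\<dots> = 2 * frame_sum \<Phi> f + 2 * frame_sum \<Phi> g"
    unfolding frame_sum_def by (subst nn_integral_add) (auto simp: nn_integral_cmult)
  finally show ?thesis .
qed

text \<open>
  Lower semicontinuity of the frame sum, by Fatou's lemma for the counting measure.
\<close>

lemma frame_sum_leI:
  assumes X: "X \<longlonglongrightarrow> f" and le: "\<And>n. frame_sum \<Phi> (X n) \<le> ennreal (b n)" and b: "b \<longlonglongrightarrow> B" "\<And>n. b n \<ge> 0"
  shows "frame_sum \<Phi> f \<le> ennreal B"
proof -
  have "frame_sum \<Phi> f = (\<integral>\<^sup>+i. liminf (\<lambda>n. ennreal ((cmod (cinner (X n) (translate (fst i) (snd i))))\<^sup>2)) \<partial>count_space (int_lattice \<times> \<Phi>))"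
    unfolding frame_sum_def
  proof (rule nn_integral_cong)
    fix i :: "(real^'a) \<times> (real^'a) l2"
    have "(\<lambda>n. ennreal ((cmod (cinner (X n) (translate (fst i) (snd i))))\<^sup>2)) \<longlonglongrightarrow> ennreal ((cmod (cinner f (translate (fst i) (snd i))))\<^sup>2)"
      by (intro tendsto_ennrealI tendsto_intros tendsto_cinner X)
    from lim_imp_Liminf[OF _ this]
    show "ennreal ((cmod (cinner f (translate (fst i) (snd i))))\<^sup>2) =
      liminf (\<lambda>n. ennreal ((cmod (cinner (X n) (translate (fst i) (snd i))))\<^sup>2))"
      by simp
  qed
  also have "\<dots> \<le> liminf (\<lambda>n. \<integral>\<^sup>+i. ennreal ((cmod (cinner (X n) (translate (fst i) (snd i))))\<^sup>2) \<partial>count_space (int_lattice \<times> \<Phi>))"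
    by (rule nn_integral_liminf) simp
  also have "\<dots> = liminf (\<lambda>n. frame_sum \<Phi> (X n))"
    unfolding frame_sum_def ..
  also have "\<dots> \<le> liminf (\<lambda>n. ennreal (b n))" by (intro Liminf_mono) (use le in auto)
  also have "\<dots> = ennreal B"
    by (intro lim_imp_Liminf tendsto_ennrealI b) simp
  finally show ?thesis .
qed

text \<open>
  Semicontinuity gives one inequality everywhere, so the defect \<open>r f\<close> is nonnegative. It satisfies the
  parallelogram law. Writing \<open>f = d + h\<close> with \<open>r d = 0\<close>, the law bounds \<open>r f\<close> by \<open>2 * r h\<close>, hence by
  \<open>2 * (norm h)\<^sup>2\<close>, which is arbitrarily small.
\<close>

lemma frame_sum_dense_ext:
  assumes W: "closed_subspace W"
    and D: "\<And>d. d \<in> D \<Longrightarrow> frame_sum \<Phi> d = ennreal ((norm (proj W d))\<^sup>2)"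
    and dense: "\<And>f. \<exists>X. (\<forall>n. X n \<in> D) \<and> X \<longlonglongrightarrow> f"
  shows "frame_sum \<Phi> f = ennreal ((norm (proj W f))\<^sup>2)"
proof -
  have tp: "(\<lambda>n. proj W (X n)) \<longlonglongrightarrow> proj W f" if "X \<longlonglongrightarrow> f" for X f
  proof -
    have "(\<lambda>n. norm (X n - f)) \<longlonglongrightarrow> 0" using that by (simp add: LIM_zero tendsto_norm_zero)
    then have "(\<lambda>n. norm (proj W (X n) - proj W f)) \<longlonglongrightarrow> 0"
      by (rule Lim_null_comparison[rotated]) (use norm_proj_le[OF W] in \<open>auto simp: proj_minus[OF W, symmetric]\<close>)
    then show ?thesis using LIM_zero_cancel tendsto_norm_zero_cancel by force
  qed
  have le: "frame_sum \<Phi> f \<le> ennreal ((norm (proj W f))\<^sup>2)" for f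
  proof -
    obtain X where X: "\<And>n. X n \<in> D" "X \<longlonglongrightarrow> f" using dense by blast
    show ?thesis
      by (rule frame_sum_leI[OF X(2), where b="\<lambda>n. (norm (proj W (X n)))\<^sup>2"])
         (use D X(1) in \<open>auto intro!: tendsto_intros tp X(2)\<close>)
  qed
  define q where "q f = enn2real (frame_sum \<Phi> f)" for f
  have q: "frame_sum \<Phi> f = ennreal (q f)" for f
    using le[of f] unfolding q_def by (simp add: le_less_trans[OF _ ennreal_less_top])
  have q0: "q f \<ge> 0" for f by (simp add: q_def)
  define r where "r f = (norm (proj W f))\<^sup>2 - q f" for f
  have r0: "r f \<ge> 0" for f using le[of f] q0[of f] unfolding q r_def by (simp del: ennreal_power)
  have rD: "r d = 0" if "d \<in> D" for d using D[OF that] q0[of d] unfolding q r_def by (simp del: ennreal_power)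
  have qp: "q (f + g) + q (f - g) = 2 * q f + 2 * q g" for f g
  proof -
    have "ennreal (q (f + g) + q (f - g)) = ennreal (2 * q f + 2 * q g)"
      using frame_sum_parallelogram[of \<Phi> f g] q0 unfolding q by (simp add: ennreal_mult)
    then show ?thesis using q0 by (subst (asm) ennreal_inj) auto
  qed
  have rp: "r (f + g) + r (f - g) = 2 * r f + 2 * r g" for f g
  proof -
    have "(norm (proj W (f + g)))\<^sup>2 + (norm (proj W (f - g)))\<^sup>2 = 2 * (norm (proj W f))\<^sup>2 + 2 * (norm (proj W g))\<^sup>2"
      unfolding proj_add[OF W] proj_minus[OF W] power2_norm_eq_inner by (simp add: algebra_simps inner_commute)
    then show ?thesis unfolding r_def using qp[of f g] by simp
  qed
  have "r f \<le> 0"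
  proof -
    obtain X where X: "\<And>n. X n \<in> D" "X \<longlonglongrightarrow> f" using dense by blast
    have "r f \<le> 2 * (norm (f - X n))\<^sup>2" for n
    proof -
      have "r f \<le> 2 * r (f - X n)" using rp[of "X n" "f - X n"] r0[of "X n - (f - X n)"] rD[OF X(1)[of n]] by simp
      also have "r (f - X n) \<le> (norm (f - X n))\<^sup>2"
        unfolding r_def using q0[of "f - X n"] power_mono[OF norm_proj_le[OF W, of "f - X n"] norm_ge_zero, of 2] by linarith
      finally show ?thesis by simp
    qed
    note le = this
    have "(\<lambda>n. 2 * (norm (f - X n))\<^sup>2) \<longlonglongrightarrow> 2 * (norm (f - f))\<^sup>2" by (intro tendsto_intros X(2))
    from LIMSEQ_le_const[OF this, of "r f"] le have "r f \<le> 2 * (norm (f - f))\<^sup>2" by blast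
    then show ?thesis by simp
  qed
  then have "q f = (norm (proj W f))\<^sup>2" using r0[of f] by (simp add: r_def)
  then show ?thesis by (simp add: q)
qed

text \<open>
  Truncate the Fourier transform of \<open>f\<close> in height and in space; the transform is a multiple of an
  isometry and onto, so convergence of the truncated transforms is convergence of their preimages.
\<close>

lemma test_functions_dense:
  fixes f :: "(real^'n) l2"
  shows "\<exists>X. (\<forall>n. X n \<in> {f. \<exists>u. test_function u \<and> (AE \<xi> in lborel. ft f \<xi> = u \<xi>)}) \<and> X \<longlonglongrightarrow> f"
proof -
  define u where "u n \<xi> = indicator (cell (real (Suc n)) \<inter> {\<xi>. cmod (ft f \<xi>) \<le> real n}) \<xi> *\<^sub>R ft f \<xi>" for n \<xi>
  have t: "test_function (u n)" for n
    unfolding test_function_def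
  proof (intro conjI)
    show "u n \<in> borel_measurable borel" unfolding u_def by measurable
    show "\<exists>C. \<forall>x. cmod (u n x) \<le> C" by (intro exI[of _ "real n"]) (auto simp: u_def indicator_def)
    show "\<exists>c. \<forall>x. x \<notin> cell c \<longrightarrow> u n x = 0" by (intro exI[of _ "real (Suc n)"]) (auto simp: u_def)
  qed
  then have "\<forall>n. \<exists>X. AE \<xi> in lborel. ft X \<xi> = u n \<xi>" using exists_fourier_preimage by metis
  then obtain X where X: "\<And>n. AE \<xi> in lborel. ft (X n) \<xi> = u n \<xi>" by metis
  have "(\<lambda>n. fourier (X n)) \<longlonglongrightarrow> fourier f"
  proof (rule l2_dominated_convergence)
    have "AE \<xi> in lborel. \<forall>n. ft (X n) \<xi> = u n \<xi>" by (subst AE_all_countable) (use X in auto)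
    then show "AE \<xi> in lborel. (\<lambda>n. ft (X n) \<xi>) \<longlonglongrightarrow> ft f \<xi>"
    proof eventually_elim
      case (elim \<xi>)
      obtain N :: nat where N: "cmod (ft f \<xi>) \<le> real N" using real_arch_simple by blast
      have "eventually (\<lambda>n. ft (X n) \<xi> = ft f \<xi>) sequentially"
        using eventually_in_cell[of \<xi>] eventually_ge_at_top[of N]
      proof eventually_elim
        case (elim n)
        then have "cmod (ft f \<xi>) \<le> real n" using N by linarith
        then show ?case using elim \<open>\<forall>n. ft (X n) \<xi> = u n \<xi>\<close> by (simp add: u_def)
      qed
      then show ?case by (rule tendsto_eventually)
    qed
    show "AE \<xi> in lborel. cmod (ft (X n) \<xi>) \<le> cmod (ft f \<xi>)" for n
      using X[of n] by eventually_elim (auto simp: u_def indicator_def)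
  qed
  then have "(\<lambda>n. (norm (fourier (X n) - fourier f))\<^sup>2 / (2 * pi) ^ CARD('n)) \<longlonglongrightarrow> (norm (fourier f - fourier f))\<^sup>2 / (2 * pi) ^ CARD('n)"
    by (intro tendsto_intros) auto
  then have "(\<lambda>n. (norm (X n - f))\<^sup>2) \<longlonglongrightarrow> 0"
    unfolding fourier_minus[symmetric] norm_fourier by simp
  then have "(\<lambda>n. sqrt ((norm (X n - f))\<^sup>2)) \<longlonglongrightarrow> sqrt 0" by (rule tendsto_real_sqrt)
  then have "X \<longlonglongrightarrow> f" using LIM_zero_cancel tendsto_norm_zero_cancel by force
  then show ?thesis using t X by blast
qed

section \<open>Kernels determined by their forms\<close>

text \<open>
  The entry \<open>N \<xi> 0\<close> is real by symmetry. If \<open>u\<close> is the indicator of a subset of one tile, only \<open>t = 0\<close>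
  contributes to the form, which is then the integral of \<open>N \<xi> 0\<close> over the subset. The subset is chosen
  as the part of the tile where this entry has a given sign \<open>\<sigma>\<close>.
\<close>

lemma lattice_form_vanish_diag:
  fixes N :: "real^'n \<Rightarrow> real^'n \<Rightarrow> complex"
  assumes Nm [measurable]: "\<And>t. (\<lambda>\<xi>. N \<xi> t) \<in> borel_measurable borel"
    and herm: "\<And>\<xi> t. t \<in> int_lattice \<Longrightarrow> N (\<xi> + (2 * pi) *\<^sub>R t) (- t) = cnj (N \<xi> t)"
    and bound: "AE \<xi> in lborel. \<forall>t\<in>int_lattice. cmod (N \<xi> t) \<le> B"
    and 0: "\<And>u. test_function u \<Longrightarrow> Re (LINT \<xi>|lborel. lattice_form N u \<xi>) = 0"
  shows "AE \<xi> in lborel. N \<xi> 0 = 0"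
proof (rule AE_all_tiles)
  fix m :: "real^'n" assume m: "m \<in> int_lattice"
  have sgn0: "AE \<xi> in lborel. \<xi> \<in> tile m \<longrightarrow> \<not> \<sigma> * Re (N \<xi> 0) > 0" for \<sigma> :: real
  proof -
    define E where "E = {\<xi> \<in> tile m. \<sigma> * Re (N \<xi> 0) > 0}"
    have Em [measurable]: "E \<in> sets borel" unfolding E_def by measurable
    define u where "u \<xi> = complex_of_real (indicator E \<xi>)" for \<xi>
    have um: "u \<in> borel_measurable borel" unfolding u_def by measurable
    have tu: "test_function u"
      by (rule test_functionI[OF um, where C=1 and E="tile m"]) (auto simp: u_def E_def indicator_def bounded_tile)
    have lf: "lattice_form N u \<xi> = indicator E \<xi> * N \<xi> 0" for \<xi>
    proof (cases "\<xi> \<in> E")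
      case True
      have "lattice_form N u \<xi> = (\<Sum>t\<in>{0}. cnj (u \<xi>) * u (\<xi> + (2 * pi) *\<^sub>R t) * N \<xi> t)"
        unfolding lattice_form_def
      proof (rule integral_count_space_finite_subset)
        fix t :: "real^'n" assume t: "t \<in> int_lattice" "t \<notin> {0}"
        then have "\<xi> + (2 * pi) *\<^sub>R t \<notin> tile m" using tile_unique[of \<xi> m t m] True m by (auto simp: E_def)
        then show "cnj (u \<xi>) * u (\<xi> + (2 * pi) *\<^sub>R t) * N \<xi> t = 0" by (simp add: u_def E_def)
      qed auto
      then show ?thesis using True by (simp add: u_def)
    qed (simp add: lattice_form_def u_def)
    have i: "integrable lborel (lattice_form N u)"
      by (rule lattice_form_integrable[OF tu bound Nm])
    have "(LINT \<xi>|lborel. \<sigma> * Re (lattice_form N u \<xi>)) = \<sigma> * Re (LINT \<xi>|lborel. lattice_form N u \<xi>)"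
      using integral_Re[OF i] by simp
    also have "\<dots> = 0" using 0[OF tu] by simp
    finally have z: "(LINT \<xi>|lborel. \<sigma> * Re (lattice_form N u \<xi>)) = 0" .
    have nn: "\<sigma> * Re (lattice_form N u \<xi>) \<ge> 0" for \<xi>
      unfolding lf by (cases "\<xi> \<in> E") (auto simp: E_def)
    have "AE \<xi> in lborel. \<sigma> * Re (lattice_form N u \<xi>) = 0"
      by (subst integral_nonneg_eq_0_iff_AE[symmetric]) (use z nn integrable_Re[OF i] in auto)
    then show ?thesis
    proof eventually_elim
      case (elim \<xi>)
      then show ?case unfolding lf by (cases "\<xi> \<in> E") (auto simp: E_def)
    qed
  qed
  have im: "Im (N \<xi> 0) = 0" for \<xi>
    using herm[OF int_lattice_0, of \<xi>] by (simp add: complex_eq_iff)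
  show "AE \<xi> in lborel. \<xi> \<in> tile m \<longrightarrow> N \<xi> 0 = 0"
    using sgn0[of 1] sgn0[of "-1"] by eventually_elim (auto simp: complex_eq_iff im)
qed

text \<open>
  Let \<open>s \<noteq> 0\<close>, and let \<open>u\<close> be the sign of \<open>N \<xi> s\<close> on one tile and \<open>1\<close> on the tile shifted by \<open>s\<close>.
  Then only \<open>t = 0\<close>, \<open>t = s\<close> and \<open>t = - s\<close> contribute. The first contribution vanishes by the diagonal
  case. The other two are equal by symmetry, and each is the integral of the modulus of \<open>N \<xi> s\<close> over
  the tile, so this modulus is \<open>0\<close> almost everywhere.
\<close>

lemma lattice_form_vanish:
  fixes N :: "real^'n \<Rightarrow> real^'n \<Rightarrow> complex"
  assumes Nm [measurable]: "\<And>t. (\<lambda>\<xi>. N \<xi> t) \<in> borel_measurable borel"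
    and herm: "\<And>\<xi> t. t \<in> int_lattice \<Longrightarrow> N (\<xi> + (2 * pi) *\<^sub>R t) (- t) = cnj (N \<xi> t)"
    and bound: "AE \<xi> in lborel. \<forall>t\<in>int_lattice. cmod (N \<xi> t) \<le> B"
    and 0: "\<And>u. test_function u \<Longrightarrow> Re (LINT \<xi>|lborel. lattice_form N u \<xi>) = 0"
  shows "AE \<xi> in lborel. \<forall>t\<in>int_lattice. N \<xi> t = 0"
proof -
  have diag: "AE \<xi> in lborel. N \<xi> 0 = 0"
    by (rule lattice_form_vanish_diag[OF Nm herm bound 0])
  have "AE \<xi> in lborel. N \<xi> s = 0" if s: "s \<in> int_lattice" for s
  proof (cases "s = 0")
    case True
    then show ?thesis using diag by simp
  next
    case s0: False
    show ?thesis
    proof (rule AE_all_tiles)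
      fix m :: "real^'n" assume m: "m \<in> int_lattice"
      have ms: "m + s \<in> int_lattice" using m s by (rule int_lattice_add)
      have disj: "\<xi> \<notin> tile (m + s)" if "\<xi> \<in> tile m" for \<xi>
        using tile_unique[of \<xi> m 0 "m + s"] that m ms s0 by auto
      \<comment> \<open>The sign of the entry; it is 0 where the entry is 0, because division by 0 gives 0.\<close>
      define v where "v \<xi> = N \<xi> s / complex_of_real (cmod (N \<xi> s))" for \<xi>
      have [measurable]: "v \<in> borel_measurable borel" unfolding v_def by measurable
      have v: "cnj (v \<xi>) * N \<xi> s = complex_of_real (cmod (N \<xi> s))" "v \<xi> * cnj (N \<xi> s) = complex_of_real (cmod (N \<xi> s))" for \<xi>
        using complex_norm_square[of "N \<xi> s"]
        by (cases "N \<xi> s = 0"; simp add: v_def power2_eq_square field_simps)+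
      have v1: "cmod (v \<xi>) \<le> 1" for \<xi> by (simp add: v_def norm_divide)
      define u where "u \<xi> = indicator (tile m) \<xi> * v \<xi> + indicator (tile (m + s)) \<xi>" for \<xi>
      have um [measurable]: "u \<in> borel_measurable borel" unfolding u_def by measurable
      have tu: "test_function u"
      proof (rule test_functionI[where C=1 and E="tile m \<union> tile (m + s)"])
        fix \<xi> show "cmod (u \<xi>) \<le> 1"
          using v1[of \<xi>] disj[of \<xi>] by (auto simp: u_def indicator_def)
      qed (auto simp: u_def bounded_tile)
      define G where "G \<xi> = indicator (tile m) \<xi> * cmod (N \<xi> s) + indicator (tile (m + s)) \<xi> * cmod (N (\<xi> - (2 * pi) *\<^sub>R s) s)" for \<xi>
      have lf: "lattice_form N u \<xi> = complex_of_real (G \<xi>)" if d: "N \<xi> 0 = 0" for \<xi>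
      proof -
        consider "\<xi> \<in> tile m" | "\<xi> \<in> tile (m + s)" | "\<xi> \<notin> tile m" "\<xi> \<notin> tile (m + s)" by blast
        then show ?thesis
        proof cases
          case 1
          have nd: "\<xi> \<notin> tile (m + s)" by (rule disj[OF 1])
          have ss: "\<xi> + (2 * pi) *\<^sub>R s \<in> tile (m + s)" by (rule tile_shift[OF 1])
          then have sm: "\<xi> + (2 * pi) *\<^sub>R s \<notin> tile m" using disj by blast
          have "lattice_form N u \<xi> = (\<Sum>t\<in>{0, s}. cnj (u \<xi>) * u (\<xi> + (2 * pi) *\<^sub>R t) * N \<xi> t)"
            unfolding lattice_form_def
          proof (rule integral_count_space_finite_subset)
            fix t :: "real^'n" assume t: "t \<in> int_lattice" "t \<notin> {0, s}"
            then have "\<xi> + (2 * pi) *\<^sub>R t \<notin> tile m" "\<xi> + (2 * pi) *\<^sub>R t \<notin> tile (m + s)"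
              using tile_unique[OF 1 _ m m t(1)] tile_unique[OF 1 _ m ms t(1)] by auto
            then show "cnj (u \<xi>) * u (\<xi> + (2 * pi) *\<^sub>R t) * N \<xi> t = 0" by (simp add: u_def)
          qed (use s in auto)
          also have "\<dots> = cnj (u \<xi>) * u (\<xi> + (2 * pi) *\<^sub>R s) * N \<xi> s" using s0 d by simp
          also have "\<dots> = complex_of_real (G \<xi>)"
            using 1 nd ss sm v(1)[of \<xi>] by (simp add: u_def G_def)
          finally show ?thesis .
        next
          case 2
          define x where "x = \<xi> - (2 * pi) *\<^sub>R s"
          have x: "\<xi> = x + (2 * pi) *\<^sub>R s" by (simp add: x_def)
          have xm: "x \<in> tile m" using 2 by (simp add: x_def tile_def algebra_simps)
          have nd: "\<xi> \<notin> tile m" using 2 disj by blast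
          have "lattice_form N u \<xi> = (\<Sum>t\<in>{0, - s}. cnj (u \<xi>) * u (\<xi> + (2 * pi) *\<^sub>R t) * N \<xi> t)"
            unfolding lattice_form_def
          proof (rule integral_count_space_finite_subset)
            fix t :: "real^'n" assume t: "t \<in> int_lattice" "t \<notin> {0, - s}"
            then have "\<xi> + (2 * pi) *\<^sub>R t \<notin> tile m" "\<xi> + (2 * pi) *\<^sub>R t \<notin> tile (m + s)"
              using tile_unique[OF 2 _ ms m t(1)] tile_unique[OF 2 _ ms ms t(1)] by auto
            then show "cnj (u \<xi>) * u (\<xi> + (2 * pi) *\<^sub>R t) * N \<xi> t = 0" by (simp add: u_def)
          qed (use s int_lattice_minus in auto)
          also have "\<dots> = cnj (u \<xi>) * u x * N \<xi> (- s)" using s0 d by (simp add: x_def)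
          also have "N \<xi> (- s) = cnj (N x s)" unfolding x by (rule herm[OF s])
          also have "cnj (u \<xi>) * u x * cnj (N x s) = complex_of_real (G \<xi>)"
            using 2 nd xm disj[OF xm] v(2)[of x] by (simp add: u_def G_def x_def[symmetric])
          finally show ?thesis .
        next
          case 3
          then show ?thesis by (simp add: lattice_form_def u_def G_def)
        qed
      qed
      have i: "integrable lborel (lattice_form N u)"
        by (rule lattice_form_integrable[OF tu bound Nm])
      have AEG: "AE \<xi> in lborel. Re (lattice_form N u \<xi>) = G \<xi>"
        using diag by eventually_elim (simp add: lf)
      have G0: "G \<xi> \<ge> 0" for \<xi> by (simp add: G_def)
      have "(LINT \<xi>|lborel. Re (lattice_form N u \<xi>)) = 0"
        using integral_Re[OF i] 0[OF tu] by simp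
      moreover have "AE \<xi> in lborel. 0 \<le> Re (lattice_form N u \<xi>)"
        using AEG by eventually_elim (simp add: G0)
      ultimately have "AE \<xi> in lborel. Re (lattice_form N u \<xi>) = 0"
        using integral_nonneg_eq_0_iff_AE[OF integrable_Re[OF i]] by simp
      with AEG show "AE \<xi> in lborel. \<xi> \<in> tile m \<longrightarrow> N \<xi> s = 0"
      proof eventually_elim
        case (elim \<xi>)
        show ?case
        proof
          assume "\<xi> \<in> tile m"
          then have "G \<xi> = cmod (N \<xi> s)" using disj by (simp add: G_def)
          then show "N \<xi> s = 0" using elim by simp
        qed
      qed
    qed
  qed
  then show ?thesis by (subst AE_ball_countable) auto
qed

section \<open>The dilated form\<close>

lemma matrix_inv_unique:
  fixes X Y :: "real^'n^'n"
  assumes "X ** Y = mat 1" "Y ** X = mat 1" shows "matrix_inv X = Y"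
proof -
  have "invertible X" using assms unfolding invertible_def by blast
  then have "matrix_inv X = matrix_inv X ** (X ** Y)" "matrix_inv X ** X = mat 1"
    using assms by (simp_all add: matrix_inv_left)
  then show ?thesis by (simp add: matrix_mul_assoc)
qed

lemma norm_sq_lcomp:
  assumes "invertible M" shows "(norm (lcomp M f))\<^sup>2 = jacobian M * (norm f)\<^sup>2"
proof -
  have "complex_of_real ((norm (lcomp M f))\<^sup>2) = complex_of_real (jacobian M * (norm f)\<^sup>2)"
    using cinner_lcomp[OF assms, of f f] unfolding cinner_self by simp
  then show ?thesis by (simp only: of_real_eq_iff)
qed

lemma lcomp_minus:
  assumes M: "invertible M" shows "lcomp M (f - g) = lcomp M f - lcomp M g"
proof (rule l2_eqI)
  show "AE x in lborel. rep_l2 (lcomp M (f - g)) x = rep_l2 (lcomp M f - lcomp M g) x"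
    using rep_lcomp[OF M, of "f - g"] AE_linear_image[OF M rep_minus[of f g]] rep_minus[of "lcomp M f" "lcomp M g"]
      rep_lcomp[OF M, of f] rep_lcomp[OF M, of g]
    by eventually_elim simp
qed

lemma exists_nonzero_l2: "\<exists>f :: (real^'n) l2. f \<noteq> 0"
proof -
  let ?u = "\<lambda>x :: real^'n. indicator (cell 1) x *\<^sub>R (1 :: complex)"
  have sq: "square_integrable ?u"
    by (rule square_integrable_indicator_bounded[where C=1]) (auto simp: emeasure_cell_finite[simplified])
  have "ennreal ((norm (abs_l2 ?u))\<^sup>2) = (\<integral>\<^sup>+x. indicator (cell 1 :: (real^'n) set) x \<partial>lborel)"
    unfolding norm_sq_nn_integral using rep_abs_l2[OF sq]
    by (intro nn_integral_cong_AE) (auto elim!: eventually_mono simp: indicator_def)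
  also have "\<dots> = 1" using emeasure_cell[of 1, where 'n='n] by simp
  finally have "abs_l2 ?u \<noteq> 0" by auto
  then show ?thesis by blast
qed

text \<open>
  Compare the norms of both sides in the formula for the transform of a composition, using
  Plancherel's identity on each side.
\<close>

lemma jacobian_dual:
  fixes M :: "real^'n^'n"
  assumes M: "invertible M"
  shows "jacobian M * jacobian (matrix_inv (transpose M)) = 1"
proof -
  let ?N = "matrix_inv (transpose M)"
  have N: "invertible ?N" by (intro matrix_inv_invertible invertible_transpose M)
  obtain f :: "(real^'n) l2" where f: "f \<noteq> 0" using exists_nonzero_l2 by blast
  define C where "C = (2 * pi) ^ CARD('n)"
  have C: "C > 0" by (simp add: C_def)
  have "C * (jacobian M * (norm f)\<^sup>2) = (norm (fourier (lcomp M f)))\<^sup>2"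
    unfolding norm_fourier norm_sq_lcomp[OF M] C_def ..
  also have "\<dots> = (jacobian M)\<^sup>2 * (jacobian ?N * (C * (norm f)\<^sup>2))"
    unfolding fourier_lcomp[OF M] norm_scale_l2 power_mult_distrib norm_sq_lcomp[OF N] norm_fourier C_def by simp
  finally have "(C * jacobian M * (norm f)\<^sup>2) * (jacobian M * jacobian ?N) = (C * jacobian M * (norm f)\<^sup>2) * 1"
    by (simp add: power2_eq_square mult_ac)
  then show ?thesis using C f jacobian(1)[OF M] by (subst (asm) mult_cancel_left) auto
qed

text \<open>
  The kernel of the frame sum for the dilates of the translates of \<open>\<Phi>\<close>. These are translates
  along a finer lattice, whose dual is the image of the integer lattice under the transpose of
  \<open>A\<close>; only differences in this coarser dual lattice are coupled.
\<close>

definition dilated_kernel :: "real^'n^'n \<Rightarrow> (real^'n) l2 set \<Rightarrow> real^'n \<Rightarrow> real^'n \<Rightarrow> complex" where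
  "dilated_kernel A \<Phi> \<xi> t = (if t \<in> (*v) (transpose A) ` int_lattice
     then fourier_sum \<Phi> (matrix_inv (transpose A) *v \<xi>) (matrix_inv (transpose A) *v (\<xi> + (2 * pi) *\<^sub>R t)) else 0)"

lemma dilated_kernel_measurable [measurable]:
  assumes "countable \<Phi>"
  shows "(\<lambda>\<xi>. dilated_kernel A \<Phi> \<xi> t) \<in> borel_measurable borel"
proof (cases "t \<in> (*v) (transpose A) ` int_lattice")
  case True
  have "(\<lambda>\<xi>. fourier_sum \<Phi> (matrix_inv (transpose A) *v \<xi>) (matrix_inv (transpose A) *v (\<xi> + (2 * pi) *\<^sub>R t))) \<in> borel_measurable borel"
    by (rule fourier_sum_measurable[OF assms]) measurable
  then show ?thesis using True by (simp add: dilated_kernel_def)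
qed (simp add: dilated_kernel_def)

text \<open>
  The transform of \<open>f\<close> composed with the inverse of \<open>A\<close> is a multiple \<open>J\<close> of \<open>u\<close> composed with the
  transpose of \<open>A\<close>. Inserting this into the formula for the frame sum and substituting the transpose
  into the integral turns congruence modulo the integer lattice into congruence modulo its image. Of
  the factors \<open>J\<^sup>2\<close> and the Jacobian of the substitution one factor \<open>J\<close> remains.
\<close>

lemma frame_sum_dilated:
  fixes A :: "real^'n^'n" and f :: "(real^'n) l2"
  assumes A: "invertible A" and AL: "(*v) (transpose A) ` int_lattice \<subseteq> int_lattice"
    and cnt: "countable \<Phi>" and sp: "AE \<xi> in lborel. spectral \<Phi> \<xi> \<le> 1"
    and u: "test_function u" and f: "AE \<xi> in lborel. ft f \<xi> = u \<xi>"
  shows "frame_sum \<Phi> (lcomp (matrix_inv A) f) =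
      ennreal (jacobian (matrix_inv A) * (1 / (2 * pi) ^ CARD('n) * Re (LINT \<xi>|lborel. lattice_form (dilated_kernel A \<Phi>) u \<xi>)))"
    and "Re (LINT \<xi>|lborel. lattice_form (dilated_kernel A \<Phi>) u \<xi>) \<ge> 0"
proof -
  let ?T = "transpose A" and ?B = "matrix_inv (transpose A)"
  define J where "J = jacobian (matrix_inv A)"
  have A': "invertible (matrix_inv A)" by (rule matrix_inv_invertible[OF A])
  have T: "invertible ?T" by (rule invertible_transpose[OF A])
  have BT: "?B *v (?T *v x) = x" "?T *v (?B *v x) = x" for x
    by (simp_all only: matrix_vector_mul_assoc matrix_inv_left[OF T] matrix_inv_right[OF T] matrix_vector_mul_lid)
  have TT: "matrix_inv (transpose (matrix_inv A)) = ?T"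
    by (rule matrix_inv_unique) (simp_all add: matrix_transpose_mul[symmetric] matrix_inv_left[OF A] matrix_inv_right[OF A] transpose_mat)
  have J: "J > 0" unfolding J_def by (rule jacobian(1)[OF A'])
  have JT: "J * jacobian ?T = 1" using jacobian_dual[OF A'] by (simp add: J_def TT)
  obtain C c where uC: "C \<ge> 0" "\<And>x. cmod (u x) \<le> C" "\<And>x. x \<notin> cell c \<Longrightarrow> u x = 0" and um [measurable]: "u \<in> borel_measurable borel"
    using test_functionE[OF u] by metis
  define u1 where "u1 \<xi> = complex_of_real J * u (?T *v \<xi>)" for \<xi>
  have tu: "test_function u1"
  proof (rule test_functionI[where C="J * C" and E="(*v) ?B ` cell c"])
    show "u1 \<in> borel_measurable borel" unfolding u1_def by measurable
    show "cmod (u1 x) \<le> J * C" for x using J uC by (simp add: u1_def norm_mult)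
    show "bounded ((*v) ?B ` cell c)"
      by (intro bounded_linear_image bounded_cell matrix_vector_mul_bounded_linear)
    fix x assume "x \<notin> (*v) ?B ` cell c"
    then have "?T *v x \<notin> cell c" using BT(1)[of x] by (metis image_eqI)
    then show "u1 x = 0" using uC(3) by (simp add: u1_def)
  qed
  have f1: "AE \<xi> in lborel. ft (lcomp (matrix_inv A) f) \<xi> = u1 \<xi>"
    unfolding fourier_lcomp[OF A'] TT J_def[symmetric]
    using rep_scale[of "of_real J" "lcomp ?T (fourier f)"] rep_lcomp[OF T, of "fourier f"] AE_linear_image[OF T f]
    by eventually_elim (simp add: u1_def)
  let ?h = "lattice_form (dilated_kernel A \<Phi>) u"
  have hm [measurable]: "?h \<in> borel_measurable borel"
    by (rule lattice_form_measurable[OF dilated_kernel_measurable[OF cnt] um])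
  have injT: "inj_on ((*v) ?T) int_lattice" by (rule inj_on_inverseI[where g="(*v) ?B"]) (rule BT)
  have gram: "gram \<Phi> u1 \<xi> = complex_of_real (J\<^sup>2) * ?h (?T *v \<xi>)" for \<xi>
  proof -
    let ?\<eta> = "?T *v \<xi>"
    let ?H = "\<lambda>t. cnj (u ?\<eta>) * u (?\<eta> + (2 * pi) *\<^sub>R t) * fourier_sum \<Phi> (?B *v ?\<eta>) (?B *v (?\<eta> + (2 * pi) *\<^sub>R t))"
    have "?h ?\<eta> = infsetsum ?H ((*v) ?T ` int_lattice)"
      unfolding lattice_form_def infsetsum_def[symmetric]
      by (rule infsetsum_cong_neutral) (use AL in \<open>auto simp: dilated_kernel_def\<close>)
    also have "\<dots> = infsetsum (\<lambda>t. ?H (?T *v t)) int_lattice"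
      by (rule infsetsum_reindex[OF injT])
    finally have h: "?h ?\<eta> = infsetsum (\<lambda>t. ?H (?T *v t)) int_lattice" .
    have lin: "?\<eta> + (2 * pi) *\<^sub>R (?T *v t) = ?T *v (\<xi> + (2 * pi) *\<^sub>R t)" for t
      by (simp add: matrix_vector_right_distrib matrix_vector_mult_scaleR)
    show ?thesis
      unfolding h gram_def lattice_form_def[of _ u1] infsetsum_def lin BT u1_def
      by (subst integral_mult_right_zero[symmetric])
         (intro Bochner_Integration.integral_cong refl, simp add: power2_eq_square mult_ac)
  qed
  have "(LINT \<xi>|lborel. gram \<Phi> u1 \<xi>) = complex_of_real (J\<^sup>2) * (LINT \<xi>|lborel. ?h (?T *v \<xi>))"
    unfolding gram by simp
  also have "\<dots> = complex_of_real (J\<^sup>2) * (complex_of_real (jacobian ?T) * (LINT \<xi>|lborel. ?h \<xi>))"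
    by (subst integral_linear[OF T hm]) simp
  also have "\<dots> = complex_of_real (J * (J * jacobian ?T)) * (LINT \<xi>|lborel. ?h \<xi>)"
    by (simp add: power2_eq_square)
  finally have g: "Re (LINT \<xi>|lborel. gram \<Phi> u1 \<xi>) = J * Re (LINT \<xi>|lborel. ?h \<xi>)" unfolding JT by simp
  show "Re (LINT \<xi>|lborel. ?h \<xi>) \<ge> 0"
    using frame_sum_gram(3)[OF cnt sp tu f1] J unfolding g by (simp add: zero_le_mult_iff)
  show "frame_sum \<Phi> (lcomp (matrix_inv A) f) =
      ennreal (jacobian (matrix_inv A) * (1 / (2 * pi) ^ CARD('n) * Re (LINT \<xi>|lborel. ?h \<xi>)))"
    using frame_sum_gram(2)[OF cnt sp tu f1] unfolding g J_def by (simp add: mult_ac)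
qed

text \<open>
  A kernel vector would be an eigenvector to the eigenvalue \<open>0\<close>, which does not have modulus above
  \<open>1\<close>.
\<close>

lemma dilation_matrix_invertible:
  assumes "dilation_matrix (A :: real^'n^'n)" shows "invertible A"
proof -
  have "x = 0" if x: "A *v x = 0" for x
  proof (rule ccontr)
    assume "x \<noteq> 0"
    define z :: "complex^'n" where "z = (\<chi> i. complex_of_real (x $ i))"
    have "z \<noteq> 0" using \<open>x \<noteq> 0\<close> by (auto simp: z_def vec_eq_iff)
    moreover have "map_matrix complex_of_real A *v z = 0 *s z"
    proof (subst vec_eq_iff, rule allI)
      fix i
      have "(map_matrix complex_of_real A *v z) $ i = complex_of_real ((A *v x) $ i)"
        by (simp add: matrix_vector_mult_def map_matrix_def z_def)
      then show "(map_matrix complex_of_real A *v z) $ i = (0 *s z) $ i" using x by simp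
    qed
    ultimately have "eigenvalue (map_matrix complex_of_real A) 0" unfolding eigenvalue_def by blast
    then have "cmod 0 > 1" using assms unfolding dilation_matrix_def by blast
    then show False by simp
  qed
  then have "\<exists>B. B ** A = mat 1" using matrix_left_invertible_ker by blast
  then show ?thesis using invertible_left_inverse by blast
qed

text \<open>
  A matrix preserves the integer lattice if and only if its entries are integers.
\<close>

lemma dilation_matrix_transpose_lattice:
  assumes "dilation_matrix (A :: real^'n^'n)" shows "(*v) (transpose A) ` int_lattice \<subseteq> int_lattice"
proof -
  have "A $ j $ i \<in> \<int>" for i j
  proof -
    have "A *v axis i 1 \<in> int_lattice" using assms axis_int_lattice unfolding dilation_matrix_def by blast
    then have "(A *v axis i 1) $ j \<in> \<int>" by (simp add: int_lattice_def)
    then show ?thesis by (simp add: matrix_vector_mult_basis column_def)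
  qed
  then show ?thesis
    by (auto simp: int_lattice_def matrix_vector_mult_def transpose_def intro!: Ints_sum Ints_mult)
qed

section \<open>The multiresolution spaces and the characterisation\<close>

text \<open>
  The normalising factor of the dilation is absorbed by the invariance of \<open>V0\<close> under scalars.
\<close>

lemma dilate_preimage_iff:
  assumes A: "invertible A" and sub: "\<And>f c. f \<in> V0 \<Longrightarrow> scale_l2 c f \<in> V0"
    and V: "\<And>f. f \<in> V0 \<longleftrightarrow> dilate A f \<in> V1"
  shows "f \<in> V1 \<longleftrightarrow> lcomp (matrix_inv A) f \<in> V0"
proof -
  define d where "d = complex_of_real (sqrt \<bar>det A\<bar>)"
  have d: "d \<noteq> 0" using A invertible_det_nz[of A] by (simp add: d_def)
  let ?g = "scale_l2 (1 / d) (lcomp (matrix_inv A) f)"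
  have "lcomp A (scale_l2 c h) = scale_l2 c (lcomp A h)" for c h
  proof (rule l2_eqI)
    show "AE x in lborel. rep_l2 (lcomp A (scale_l2 c h)) x = rep_l2 (scale_l2 c (lcomp A h)) x"
      using rep_lcomp[OF A, of "scale_l2 c h"] AE_linear_image[OF A rep_scale[of c h]]
        rep_scale[of c "lcomp A h"] rep_lcomp[OF A, of h]
      by eventually_elim simp
  qed
  then have "dilate A ?g = f"
    unfolding dilate_eq_lcomp[OF A] d_def[symmetric] using d by (simp add: lcomp_inv[OF A])
  then have "f \<in> V1 \<longleftrightarrow> ?g \<in> V0" using V by metis
  moreover have "lcomp (matrix_inv A) f = scale_l2 d ?g" using d by simp
  ultimately show ?thesis using sub by metis
qed

lemma gmra_dilated_space:
  fixes A :: "real^'n^'n"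
  assumes A: "dilation_matrix A" and V: "gmra A V"
  shows gmra_lcomp_iff: "f \<in> V 1 \<longleftrightarrow> lcomp (matrix_inv A) f \<in> V 0"
    and gmra_shift_invariant_0: "shift_invariant (V 0)"
    and gmra_shift_invariant_1: "shift_invariant (V 1)"
proof -
  have inv: "invertible A" by (rule dilation_matrix_invertible[OF A])
  have cl: "closed_subspace (V j)" for j using V by (auto simp: gmra_def)
  have step: "f \<in> V 0 \<longleftrightarrow> dilate A f \<in> V (0 + 1)" for f
  proof -
    have "\<forall>j f. f \<in> V j \<longleftrightarrow> dilate A f \<in> V (j + 1)" using V unfolding gmra_def by (elim conjE)
    then show ?thesis by (elim allE)
  qed
  show iff: "f \<in> V 1 \<longleftrightarrow> lcomp (matrix_inv A) f \<in> V 0" for f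
    by (rule dilate_preimage_iff[OF inv closed_subspace_scale[OF cl]]) (use step in simp_all)
  show V0: "shift_invariant (V 0)" using V cl by (auto simp: shift_invariant_def gmra_def)
  show "shift_invariant (V 1)"
  proof (rule shift_invariantI[OF cl])
    fix k :: "real^'n" and f assume k: "k \<in> int_lattice" and f: "f \<in> V 1"
    have Ak: "A *v k \<in> int_lattice" using A k unfolding dilation_matrix_def by blast
    have "translate k f = translate k (lcomp A (lcomp (matrix_inv A) f))" by (simp add: lcomp_inv[OF inv])
    also have "\<dots> = lcomp A (translate (A *v k) (lcomp (matrix_inv A) f))" by (rule translate_lcomp[OF inv])
    finally have "lcomp (matrix_inv A) (translate k f) = translate (A *v k) (lcomp (matrix_inv A) f)"
      by (simp add: lcomp_inv[OF inv])
    then show "translate k f \<in> V 1"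
      using shift_invariantD[OF V0 Ak] f unfolding iff by simp
  qed
qed

text \<open>
  Composition with an invertible matrix multiplies all inner products by the same constant, so it
  maps orthogonal decompositions to orthogonal decompositions.
\<close>

lemma proj_lcomp:
  assumes A: "invertible A" and cV0: "closed_subspace V0" and cV1: "closed_subspace V1"
    and iff: "\<And>f. f \<in> V1 \<longleftrightarrow> lcomp (matrix_inv A) f \<in> V0"
  shows "proj V0 (lcomp (matrix_inv A) f) = lcomp (matrix_inv A) (proj V1 f)"
proof (rule proj_eqI[OF cV0])
  have A': "invertible (matrix_inv A)" by (rule matrix_inv_invertible[OF A])
  show "lcomp (matrix_inv A) (proj V1 f) \<in> V0" using proj_in[OF cV1, of f] iff by blast
  fix v assume v: "v \<in> V0"
  have "lcomp A v \<in> V1" unfolding iff using v by (simp add: lcomp_inv[OF A])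
  then have "cinner (f - proj V1 f) (lcomp A v) = 0" by (rule proj_orth[OF cV1])
  moreover have "cinner (lcomp (matrix_inv A) (f - proj V1 f)) (lcomp (matrix_inv A) (lcomp A v))
      = of_real (jacobian (matrix_inv A)) * cinner (f - proj V1 f) (lcomp A v)"
    by (rule cinner_lcomp[OF A'])
  ultimately show "cinner (lcomp (matrix_inv A) f - lcomp (matrix_inv A) (proj V1 f)) v = 0"
    by (simp add: lcomp_minus[OF A'] lcomp_inv[OF A])
qed

theorem theorem3p1:
  fixes A :: "real^'n^'n"
    and V :: "int \<Rightarrow> (real^'n) l2 set"
    and \<Phi> \<Psi> :: "(real^'n) l2 set"
  assumes "dilation_matrix A"
    and "gmra A V"
    and "ntf_generator \<Phi> (V 0)"
    and "countable \<Psi>"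
  shows "ntf_generator \<Psi> (orth_diff (V 1) (V 0)) \<longleftrightarrow>
    (AE \<xi> in lborel.
      (\<forall>s \<in> int_lattice - (*v) (transpose A) ` int_lattice.
         let \<eta> = \<xi> + (2 * pi) *\<^sub>R s in
         fourier_summable \<Phi> \<xi> \<eta> \<and> fourier_summable \<Psi> \<xi> \<eta> \<and>
         - fourier_sum \<Phi> \<xi> \<eta> = fourier_sum \<Psi> \<xi> \<eta>) \<and>
      (\<forall>s \<in> (*v) (transpose A) ` int_lattice.
         let \<eta> = \<xi> + (2 * pi) *\<^sub>R s; B = matrix_inv (transpose A) in
         fourier_summable \<Phi> (B *v \<xi>) (B *v \<eta>) \<and>
         fourier_summable \<Phi> \<xi> \<eta> \<and> fourier_summable \<Psi> \<xi> \<eta> \<and>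
         fourier_sum \<Phi> (B *v \<xi>) (B *v \<eta>) - fourier_sum \<Phi> \<xi> \<eta> = fourier_sum \<Psi> \<xi> \<eta>))"
proof -
  note A = \<open>dilation_matrix A\<close> and V = \<open>gmra A V\<close> and Phi = \<open>ntf_generator \<Phi> (V 0)\<close> and cPsi = \<open>countable \<Psi>\<close>
  let ?T = "transpose A" and ?B = "matrix_inv (transpose A)" and ?W = "orth_diff (V 1) (V 0)"
  have inv: "invertible A" by (rule dilation_matrix_invertible[OF A])
  have A': "invertible (matrix_inv A)" by (rule matrix_inv_invertible[OF inv])
  have B: "invertible ?B" by (intro matrix_inv_invertible invertible_transpose inv)
  have AL: "(*v) ?T ` int_lattice \<subseteq> int_lattice" by (rule dilation_matrix_transpose_lattice[OF A])
  have cl: "closed_subspace (V j)" for j using V by (auto simp: gmra_def)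
  have "\<forall>j. V j \<subseteq> V (j + 1)" using V unfolding gmra_def by (elim conjE)
  from spec[OF this, of 0] have V01: "V 0 \<subseteq> V 1" by simp
  have cPhi: "countable \<Phi>" by (rule ntf_generator_countable[OF Phi])
  have cW: "closed_subspace ?W" by (rule closed_subspace_orth_diff[OF cl])
  have siW: "shift_invariant ?W"
    by (rule shift_invariant_orth_diff[OF gmra_shift_invariant_1[OF A V] gmra_shift_invariant_0[OF A V]])
  have spPhi: "AE \<xi> in lborel. spectral \<Phi> \<xi> \<le> 1"
    by (rule spectral_le_1[OF cPhi frame_sum_le_norm[OF Phi]])
  have spPhiB: "AE \<xi> in lborel. \<forall>t\<in>int_lattice. spectral \<Phi> (?B *v (\<xi> + (2 * pi) *\<^sub>R t)) \<le> 1"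
    by (subst AE_ball_countable) (use AE_translate[OF AE_linear_image[OF B spPhi]] in auto)
  \<comment> \<open>The two equations of the theorem say that this kernel vanishes.\<close>
  define N where "N \<xi> t = fourier_sum \<Psi> \<xi> (\<xi> + (2 * pi) *\<^sub>R t) + fourier_sum \<Phi> \<xi> (\<xi> + (2 * pi) *\<^sub>R t)
    - dilated_kernel A \<Phi> \<xi> t" for \<xi> t
  let ?h = "\<lambda>u. lattice_form (dilated_kernel A \<Phi>) u"
  let ?P = "(2 * pi) ^ CARD('n)"
  have P: "?P > 0" by simp

  have dk_bound: "AE \<xi> in lborel. \<forall>t\<in>int_lattice. cmod (dilated_kernel A \<Phi> \<xi> t) \<le> 1"
    using spPhiB
  proof eventually_elim
    case (elim \<xi>)
    then show ?case using elim[rule_format, OF int_lattice_0]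
      by (auto simp: dilated_kernel_def intro!: fourier_sum_bound)
  qed
  have fs_bound: "AE \<xi> in lborel. \<forall>t\<in>int_lattice. cmod (fourier_sum \<Theta> \<xi> (\<xi> + (2 * pi) *\<^sub>R t)) \<le> 1"
    if "AE \<xi> in lborel. spectral \<Theta> \<xi> \<le> 1" for \<Theta> :: "(real^'n) l2 set"
    using AE_spectral_lattice[OF that]
  proof eventually_elim
    case (elim \<xi>)
    then show ?case using elim[rule_format, OF int_lattice_0] by (auto intro!: fourier_sum_bound)
  qed

  have cond_iff: "(\<forall>s \<in> int_lattice - (*v) ?T ` int_lattice.
         let \<eta> = \<xi> + (2 * pi) *\<^sub>R s in
         fourier_summable \<Phi> \<xi> \<eta> \<and> fourier_summable \<Psi> \<xi> \<eta> \<and>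
         - fourier_sum \<Phi> \<xi> \<eta> = fourier_sum \<Psi> \<xi> \<eta>) \<and>
      (\<forall>s \<in> (*v) ?T ` int_lattice.
         let \<eta> = \<xi> + (2 * pi) *\<^sub>R s; B = ?B in
         fourier_summable \<Phi> (B *v \<xi>) (B *v \<eta>) \<and>
         fourier_summable \<Phi> \<xi> \<eta> \<and> fourier_summable \<Psi> \<xi> \<eta> \<and>
         fourier_sum \<Phi> (B *v \<xi>) (B *v \<eta>) - fourier_sum \<Phi> \<xi> \<eta> = fourier_sum \<Psi> \<xi> \<eta>)
    \<longleftrightarrow> (\<forall>t\<in>int_lattice. fourier_summable \<Phi> \<xi> (\<xi> + (2 * pi) *\<^sub>R t) \<and> fourier_summable \<Psi> \<xi> (\<xi> + (2 * pi) *\<^sub>R t) \<and>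
        (t \<in> (*v) ?T ` int_lattice \<longrightarrow> fourier_summable \<Phi> (?B *v \<xi>) (?B *v (\<xi> + (2 * pi) *\<^sub>R t))) \<and> N \<xi> t = 0)" for \<xi>
  proof -
    have out: "- fourier_sum \<Phi> \<xi> (\<xi> + (2 * pi) *\<^sub>R t) = fourier_sum \<Psi> \<xi> (\<xi> + (2 * pi) *\<^sub>R t) \<longleftrightarrow> N \<xi> t = 0"
      if "t \<notin> (*v) ?T ` int_lattice" for t
      unfolding N_def dilated_kernel_def if_not_P[OF that] by (simp add: neg_eq_iff_add_eq_0 add.commute)
    have inn: "fourier_sum \<Phi> (?B *v \<xi>) (?B *v (\<xi> + (2 * pi) *\<^sub>R t)) - fourier_sum \<Phi> \<xi> (\<xi> + (2 * pi) *\<^sub>R t) = fourier_sum \<Psi> \<xi> (\<xi> + (2 * pi) *\<^sub>R t) \<longleftrightarrow> N \<xi> t = 0"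
      if "t \<in> (*v) ?T ` int_lattice" for t
      unfolding N_def dilated_kernel_def if_P[OF that] by (auto simp: algebra_simps)
    show ?thesis unfolding Let_def using out inn AL by blast
  qed

  have forms: "integrable lborel (gram \<Phi> u)" "integrable lborel (?h u)"
    "(norm (proj (V 0) f))\<^sup>2 = 1 / ?P * Re (LINT \<xi>|lborel. gram \<Phi> u \<xi>)"
    "(norm (proj (V 1) f))\<^sup>2 = 1 / ?P * Re (LINT \<xi>|lborel. ?h u \<xi>)"
    if u: "test_function u" and f: "AE \<xi> in lborel. ft f \<xi> = u \<xi>" for u f
  proof -
    note g = frame_sum_gram[OF cPhi spPhi u f]
    show "integrable lborel (gram \<Phi> u)" by (rule g(1))
    show "integrable lborel (?h u)"
      by (rule lattice_form_integrable[OF u dk_bound dilated_kernel_measurable[OF cPhi]])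
    have "ennreal ((norm (proj (V 0) f))\<^sup>2) = ennreal (1 / ?P * Re (LINT \<xi>|lborel. gram \<Phi> u \<xi>))"
      using g(2) frame_sum_proj[OF Phi, of f] by simp
    then show "(norm (proj (V 0) f))\<^sup>2 = 1 / ?P * Re (LINT \<xi>|lborel. gram \<Phi> u \<xi>)"
      using g(3) by (subst (asm) ennreal_inj) auto
    define J where "J = jacobian (matrix_inv A)"
    have J: "J > 0" unfolding J_def by (rule jacobian(1)[OF A'])
    note d = frame_sum_dilated[OF inv AL cPhi spPhi u f]
    have "frame_sum \<Phi> (lcomp (matrix_inv A) f) = ennreal (J * (norm (proj (V 1) f))\<^sup>2)"
      unfolding frame_sum_proj[OF Phi] proj_lcomp[OF inv cl cl gmra_lcomp_iff[OF A V]] norm_sq_lcomp[OF A'] J_def ..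
    then have "ennreal (J * (norm (proj (V 1) f))\<^sup>2) = ennreal (J * (1 / ?P * Re (LINT \<xi>|lborel. ?h u \<xi>)))"
      using d(1) unfolding J_def by simp
    then have "J * (norm (proj (V 1) f))\<^sup>2 = J * (1 / ?P * Re (LINT \<xi>|lborel. ?h u \<xi>))"
      using d(2) J by (subst (asm) ennreal_inj) auto
    then show "(norm (proj (V 1) f))\<^sup>2 = 1 / ?P * Re (LINT \<xi>|lborel. ?h u \<xi>)"
      using J by (simp only: mult_cancel_left) auto
  qed

  \<comment> \<open>The form of the difference kernel measures the defect of the identity for the projections.\<close>
  have N_form: "Re (LINT \<xi>|lborel. lattice_form N u \<xi>)
      = Re (LINT \<xi>|lborel. gram \<Psi> u \<xi>) - ?P * (norm (proj ?W f))\<^sup>2"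
    if spPsi: "AE \<xi> in lborel. spectral \<Psi> \<xi> \<le> 1" and u: "test_function u" and f: "AE \<xi> in lborel. ft f \<xi> = u \<xi>" for u f
  proof -
    note g = frame_sum_gram[OF cPsi spPsi u f]
    have "lattice_form N u = (\<lambda>\<xi>. gram \<Psi> u \<xi> + gram \<Phi> u \<xi> - ?h u \<xi>)"
      unfolding gram_def N_def[abs_def] by (rule ext, rule lattice_form_combine[OF u])
    then have "(LINT \<xi>|lborel. lattice_form N u \<xi>) = (LINT \<xi>|lborel. gram \<Psi> u \<xi>) + (LINT \<xi>|lborel. gram \<Phi> u \<xi>) - (LINT \<xi>|lborel. ?h u \<xi>)"
      using g(1) forms(1,2)[OF u f] by simp
    then have "Re (LINT \<xi>|lborel. lattice_form N u \<xi>)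
        = Re (LINT \<xi>|lborel. gram \<Psi> u \<xi>) + Re (LINT \<xi>|lborel. gram \<Phi> u \<xi>) - Re (LINT \<xi>|lborel. ?h u \<xi>)"
      by simp
    moreover have "Re (LINT \<xi>|lborel. ?h u \<xi>) = Re (LINT \<xi>|lborel. gram \<Phi> u \<xi>) + ?P * (norm (proj ?W f))\<^sup>2"
      using orth_diff_pythagoras[OF cl cl V01, of f] P unfolding forms(3,4)[OF u f] by (simp add: field_simps)
    ultimately show ?thesis by linarith
  qed

  have gen_iff: "ntf_generator \<Psi> ?W \<longleftrightarrow> (AE \<xi> in lborel. spectral \<Psi> \<xi> \<le> 1) \<and> (AE \<xi> in lborel. \<forall>t\<in>int_lattice. N \<xi> t = 0)"
  proof (intro iffI conjI)
    assume gen: "ntf_generator \<Psi> ?W"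
    show sp: "AE \<xi> in lborel. spectral \<Psi> \<xi> \<le> 1" by (rule spectral_le_1[OF cPsi frame_sum_le_norm[OF gen]])
    show "AE \<xi> in lborel. \<forall>t\<in>int_lattice. N \<xi> t = 0"
    proof (rule lattice_form_vanish[where B=3])
      show "(\<lambda>\<xi>. N \<xi> t) \<in> borel_measurable borel" for t
        unfolding N_def
        by (intro borel_measurable_diff borel_measurable_add dilated_kernel_measurable cPhi cPsi fourier_sum_measurable) measurable
      show "AE \<xi> in lborel. \<forall>t\<in>int_lattice. cmod (N \<xi> t) \<le> 3"
        using fs_bound[OF sp] fs_bound[OF spPhi] dk_bound
      proof eventually_elim
        case (elim \<xi>)
        show ?case
        proof
          fix t :: "real^'n" assume t: "t \<in> int_lattice"
          have "cmod (N \<xi> t) \<le> cmod (fourier_sum \<Psi> \<xi> (\<xi> + (2 * pi) *\<^sub>R t)) + cmod (fourier_sum \<Phi> \<xi> (\<xi> + (2 * pi) *\<^sub>R t)) + cmod (dilated_kernel A \<Phi> \<xi> t)"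
            unfolding N_def by (rule order_trans[OF norm_triangle_ineq4 add_right_mono[OF norm_triangle_ineq]])
          then show "cmod (N \<xi> t) \<le> 3" using elim t by (smt (verit))
        qed
      qed
      show "N (\<xi> + (2 * pi) *\<^sub>R t) (- t) = cnj (N \<xi> t)" if "t \<in> int_lattice" for \<xi> t
      proof -
        have shift_back: "\<xi> + (2 * pi) *\<^sub>R t + (2 * pi) *\<^sub>R (- t) = \<xi>" by simp
        have neg: "- t \<in> (*v) ?T ` int_lattice \<longleftrightarrow> t \<in> (*v) ?T ` int_lattice"
        proof -
          have "- s \<in> (*v) ?T ` int_lattice" if s: "s \<in> (*v) ?T ` int_lattice" for s
          proof -
            obtain r where r: "r \<in> int_lattice" "s = ?T *v r" using s by blast
            have "- s = ?T *v (- r)" unfolding r(2) by (rule linear_neg[OF matrix_vector_mul_linear, symmetric])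
            then show ?thesis using int_lattice_minus[OF r(1)] by blast
          qed
          from this[of t] this[of "- t"] show ?thesis by auto
        qed
        show ?thesis
          unfolding N_def dilated_kernel_def shift_back neg
          by (auto simp: fourier_sum_commute[of _ "\<xi> + (2 * pi) *\<^sub>R t" \<xi>]
              fourier_sum_commute[of _ "?B *v (\<xi> + (2 * pi) *\<^sub>R t)" "?B *v \<xi>"])
      qed
      fix u :: "real^'n \<Rightarrow> complex" assume u: "test_function u"
      obtain f where f: "AE \<xi> in lborel. ft f \<xi> = u \<xi>" using exists_fourier_preimage[OF u] .
      note g = frame_sum_gram[OF cPsi sp u f]
      have "ennreal ((norm (proj ?W f))\<^sup>2) = ennreal (1 / ?P * Re (LINT \<xi>|lborel. gram \<Psi> u \<xi>))"
        using g(2) frame_sum_proj[OF gen, of f] by simp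
      then have "(norm (proj ?W f))\<^sup>2 = 1 / ?P * Re (LINT \<xi>|lborel. gram \<Psi> u \<xi>)"
        using g(3) by (subst (asm) ennreal_inj) auto
      then show "Re (LINT \<xi>|lborel. lattice_form N u \<xi>) = 0"
        unfolding N_form[OF sp u f] by simp
    qed
  next
    assume as: "(AE \<xi> in lborel. spectral \<Psi> \<xi> \<le> 1) \<and> (AE \<xi> in lborel. \<forall>t\<in>int_lattice. N \<xi> t = 0)"
    then have sp: "AE \<xi> in lborel. spectral \<Psi> \<xi> \<le> 1" and N0: "AE \<xi> in lborel. \<forall>t\<in>int_lattice. N \<xi> t = 0" by auto
    have D: "frame_sum \<Psi> f = ennreal ((norm (proj ?W f))\<^sup>2)"
      if "f \<in> {f. \<exists>u. test_function u \<and> (AE \<xi> in lborel. ft f \<xi> = u \<xi>)}" for f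
    proof -
      obtain u where u: "test_function u" and f: "AE \<xi> in lborel. ft f \<xi> = u \<xi>" using \<open>f \<in> _\<close> by auto
      have "AE \<xi> in lborel. lattice_form N u \<xi> = 0"
        using N0
      proof eventually_elim
        case (elim \<xi>)
        then have "lattice_form N u \<xi> = (LINT t|count_space (int_lattice :: (real^'n) set). 0)"
          unfolding lattice_form_def by (intro Bochner_Integration.integral_cong) auto
        then show ?case by simp
      qed
      then have "(LINT \<xi>|lborel. lattice_form N u \<xi>) = 0" by (rule integral_eq_zero_AE)
      then have "(norm (proj ?W f))\<^sup>2 = 1 / ?P * Re (LINT \<xi>|lborel. gram \<Psi> u \<xi>)"
        using N_form[OF sp u f] P by (simp add: field_simps)
      then show ?thesis using frame_sum_gram(2)[OF cPsi sp u f] by simp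
    qed
    show "ntf_generator \<Psi> ?W"
      by (rule ntf_generatorI[OF siW frame_sum_dense_ext[OF cW D test_functions_dense]])
  qed

  show ?thesis unfolding cond_iff
  proof
    assume "ntf_generator \<Psi> ?W"
    then have sp: "AE \<xi> in lborel. spectral \<Psi> \<xi> \<le> 1" and N0: "AE \<xi> in lborel. \<forall>t\<in>int_lattice. N \<xi> t = 0"
      using gen_iff by auto
    show "AE \<xi> in lborel. \<forall>t\<in>int_lattice. fourier_summable \<Phi> \<xi> (\<xi> + (2 * pi) *\<^sub>R t) \<and> fourier_summable \<Psi> \<xi> (\<xi> + (2 * pi) *\<^sub>R t) \<and>
        (t \<in> (*v) ?T ` int_lattice \<longrightarrow> fourier_summable \<Phi> (?B *v \<xi>) (?B *v (\<xi> + (2 * pi) *\<^sub>R t))) \<and> N \<xi> t = 0"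
      using AE_spectral_lattice[OF sp] AE_spectral_lattice[OF spPhi] spPhiB N0
    proof eventually_elim
      case (elim \<xi>)
      have z: "spectral \<Psi> \<xi> \<le> 1" "spectral \<Phi> \<xi> \<le> 1" "spectral \<Phi> (?B *v \<xi>) \<le> 1"
        using elim(1)[rule_format, OF int_lattice_0] elim(2)[rule_format, OF int_lattice_0]
          elim(3)[rule_format, OF int_lattice_0] by simp_all
      show ?case
        using elim fourier_sum_bound(1)[OF z(1)] fourier_sum_bound(1)[OF z(2)] fourier_sum_bound(1)[OF z(3)] by blast
    qed
  next
    assume cond: "AE \<xi> in lborel. \<forall>t\<in>int_lattice. fourier_summable \<Phi> \<xi> (\<xi> + (2 * pi) *\<^sub>R t) \<and> fourier_summable \<Psi> \<xi> (\<xi> + (2 * pi) *\<^sub>R t) \<and>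
        (t \<in> (*v) ?T ` int_lattice \<longrightarrow> fourier_summable \<Phi> (?B *v \<xi>) (?B *v (\<xi> + (2 * pi) *\<^sub>R t))) \<and> N \<xi> t = 0"
    have "AE \<xi> in lborel. spectral \<Psi> \<xi> \<le> 1"
      using cond dk_bound
    proof eventually_elim
      case (elim \<xi>)
      have s: "fourier_summable \<Psi> \<xi> \<xi>" and n: "N \<xi> 0 = 0" and k: "cmod (dilated_kernel A \<Phi> \<xi> 0) \<le> 1"
        using elim(1)[rule_format, OF int_lattice_0] elim(2)[rule_format, OF int_lattice_0] by simp_all
      \<comment> \<open>The equation at difference 0 bounds the diagonal of the kernel of the unknown set.\<close>
      have "Re (fourier_sum \<Psi> \<xi> \<xi>) = Re (dilated_kernel A \<Phi> \<xi> 0) - Re (fourier_sum \<Phi> \<xi> \<xi>)"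
        using arg_cong[OF n, of Re] by (simp add: N_def)
      also have "\<dots> \<le> 1"
        using k complex_Re_le_cmod[of "dilated_kernel A \<Phi> \<xi> 0"] fourier_sum_diag(3)[of \<Phi> \<xi>] by linarith
      finally show ?case unfolding fourier_sum_diag(1)[OF s] by simp
    qed
    moreover have "AE \<xi> in lborel. \<forall>t\<in>int_lattice. N \<xi> t = 0" using cond by eventually_elim blast
    ultimately show "ntf_generator \<Psi> ?W" unfolding gen_iff by blast
  qed
qed

end
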